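(* For each $n$ let $\mathbf X=\mathbf X^{(n)}=(X_1,\dots,X_n)$ be an exchangeable and unconditional random vector in $\mathbb R^n$, let $d=d_n$ be positive integers, and put $p=\binom{n}{d}$. Let $m=m(p)\in\mathbb N$ be the sample size, suppose $p/m\to c$ for some fixed constant $c>0$, and let $\mathbf x^{(1)},\dots,\mathbf x^{(m)}$ be i.i.d. with law $\mathrm{PrincipalT}(n,d,\mathbf X)$. Let $L=L_n$ be a sequence such that $Ld^2/n\to0$. Suppose that, as $n\to\infty$, (A) $\mathbb E(X_1^2\cdots X_d^2)\to 1$; (B) $\mathbb E(X_1^2\cdots X_{2d}^2)-\bigl(\mathbb E(X_1^2\cdots X_d^2)\bigr)^2\to0$; (C) for all $n$ large enough and for all $1\le r\le d$, $\ \mathbb E(X_1^4\cdots X_r^4X_{r+1}^2\cdots X_{2d-r}^2)\le L^r$. Then for the sample covariance matrix $K=\frac1m\sum_{k=1}^m\mathbf x^{(k)}(\mathbf x^{(k)})^{\mathrm T}$, with probability $1$, $\mathrm{ESD}(K)$ converges weakly to $\mu_{\mathrm{MP}(c)}$.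
   Context: All limits are as $n\to\infty$, and all samples, for all $n$, live on a common probability space. $\mathbf X$ is exchangeable if $(X_1,\dots,X_n)$ has the same law as $(X_{\sigma(1)},\dots,X_{\sigma(n)})$ for every permutation $\sigma$ of $[n]=\{1,\dots,n\}$; it is unconditional if $(X_1,\dots,X_n)$ has the same law as $(\varepsilon_1X_1,\dots,\varepsilon_nX_n)$ where $\varepsilon_i$ are independent Rademacher signs independent of $\mathbf X$. $\mathrm{PrincipalT}(n,d,\mathbf X)$ is the law of the random vector $\bigl(\prod_{\alpha\in i}X_\alpha\bigr)_{i}\in\mathbb R^p$, $p=\binom nd$, whose coordinates are indexed by the subsets $i\subseteq[n]$ of size $d$. For a real symmetric $p\times p$ matrix $K$ with eigenvalues $\lambda_1\ge\dots\ge\lambda_p$, $\mathrm{ESD}(K)=\frac1p\sum_{j=1}^p\delta_{\lambda_j}$. For $c>0$ the standard Marchenko–Pastur law is $$\mu_{\mathrm{MP}(c)}=\bigl(1-\tfrac1c\bigr)^+\delta_0+\frac{\sqrt{(b-x)(x-a)}}{2\pi c x}\mathbf 1_{[a,b]}(x)\,dx,\quad a=(1-\sqrt c)^2,\ b=(1+\sqrt c)^2.$$ *)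

theory Defs
  imports "HOL-Probability.Probability" "Jordan_Normal_Form.Char_Poly"
begin

abbreviation vecspace :: "'i set \<Rightarrow> ('i \<Rightarrow> real) measure" where
  "vecspace I \<equiv> PiM I (\<lambda>_. borel)"

text \<open>A random vector in $\mathbb{R}^n$ on a probability space \<open>N\<close> is a measurable map into
  \<open>vecspace {1..n}\<close>; its values are functions that are \<open>undefined\<close> outside \<open>{1..n}\<close>.\<close>

definition exchangeable :: "nat \<Rightarrow> 'a measure \<Rightarrow> ('a \<Rightarrow> nat \<Rightarrow> real) \<Rightarrow> bool" where
  "exchangeable n N X \<longleftrightarrow>
    (\<forall>\<sigma>. \<sigma> permutes {1..n} \<longrightarrow>
      distr N (vecspace {1..n}) X
        = distr N (vecspace {1..n}) (\<lambda>\<omega>. \<lambda>i\<in>{1..n}. X \<omega> (\<sigma> i)))"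

definition rademacher :: "real pmf" where
  "rademacher = pmf_of_set {-1, 1}"

text \<open>The independent signs, independent of the vector, are realised on the product of \<open>N\<close> with
  the \<open>n\<close>-fold product of the Rademacher law.\<close>

definition unconditional :: "nat \<Rightarrow> 'a measure \<Rightarrow> ('a \<Rightarrow> nat \<Rightarrow> real) \<Rightarrow> bool" where
  "unconditional n N X \<longleftrightarrow>
    distr N (vecspace {1..n}) X
      = distr (N \<Otimes>\<^sub>M PiM {1..n} (\<lambda>_. measure_pmf rademacher)) (vecspace {1..n})
          (\<lambda>(\<omega>, \<epsilon>). \<lambda>i\<in>{1..n}. \<epsilon> i * X \<omega> i)"

definition dsubsets :: "nat \<Rightarrow> nat \<Rightarrow> nat set set" where
  "dsubsets n d = {i. i \<subseteq> {1..n} \<and> card i = d}"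

definition PrincipalT ::
    "nat \<Rightarrow> nat \<Rightarrow> 'a measure \<Rightarrow> ('a \<Rightarrow> nat \<Rightarrow> real) \<Rightarrow> (nat set \<Rightarrow> real) measure" where
  "PrincipalT n d N X =
    distr N (vecspace (dsubsets n d)) (\<lambda>\<omega>. \<lambda>i\<in>dsubsets n d. \<Prod>\<alpha>\<in>i. X \<omega> \<alpha>)"

text \<open>Matrices are indexed by \<open>{0..<p}\<close>, so a vector indexed by \<open>dsubsets n d\<close> is transported
  along a fixed enumeration of that set.\<close>

definition dsubset_list :: "nat \<Rightarrow> nat \<Rightarrow> nat set list" where
  "dsubset_list n d = map set (filter (\<lambda>xs. length xs = d) (List.subseqs [1..<Suc n]))"

lemma dsubset_list:
  "set (dsubset_list n d) = dsubsets n d"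
  "distinct (dsubset_list n d)"
  "length (dsubset_list n d) = n choose d"
proof -
  have len: "length xs = card (set xs)" if "xs \<in> set (List.subseqs [1..<Suc n])" for xs
    using that subseqs_distinctD[of xs "[1..<Suc n]"] by (simp add: distinct_card)
  have pow: "set ` set (List.subseqs [1..<Suc n]) = Pow {1..n}"
    by (subst subseqs_powset) (auto simp del: upt_Suc)
  have "set (dsubset_list n d)
      = {i \<in> set ` set (List.subseqs [1..<Suc n]). card i = d}"
    unfolding dsubset_list_def using len by (auto simp del: upt_Suc)
  then show s: "set (dsubset_list n d) = dsubsets n d"
    unfolding pow dsubsets_def by auto
  have "distinct (map set (List.subseqs [1..<Suc n]))"
    by (rule distinct_set_subseqs) simp
  then show dist: "distinct (dsubset_list n d)"
    unfolding dsubset_list_def by (auto simp: distinct_map inj_on_def simp del: upt_Suc)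
  show "length (dsubset_list n d) = n choose d"
    using distinct_card[OF dist] n_subsets[of "{1..n}" d] by (simp add: s dsubsets_def)
qed

definition coord_vec :: "nat \<Rightarrow> nat \<Rightarrow> (nat set \<Rightarrow> real) \<Rightarrow> real vec" where
  "coord_vec n d x = vec (n choose d) (\<lambda>a. x (dsubset_list n d ! a))"

definition sample_cov :: "nat \<Rightarrow> nat \<Rightarrow> (nat \<Rightarrow> real vec) \<Rightarrow> real mat" where
  "sample_cov p m v = mat p p (\<lambda>(a, b). 1 / real m * (\<Sum>k=1..m. v k $ a * v k $ b))"

text \<open>For a symmetric matrix of size \<open>p\<close> this list has length \<open>p\<close>: the eigenvalues, with
  multiplicity, in decreasing order.\<close>

definition eigenvalue_list :: "real mat \<Rightarrow> real list" where
  "eigenvalue_list K = rev (sorted_list_of_multiset (proots (char_poly K)))"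

definition ESD :: "real mat \<Rightarrow> real measure" where
  "ESD K = distr (uniform_count_measure {..<dim_row K}) borel (\<lambda>j. eigenvalue_list K ! j)"

definition mp_density :: "real \<Rightarrow> real \<Rightarrow> real" where
  "mp_density c x =
    (let a = (1 - sqrt c)\<^sup>2; b = (1 + sqrt c)\<^sup>2
     in sqrt ((b - x) * (x - a)) / (2 * pi * c * x) * indicator {a..b} x)"

definition marchenko_pastur :: "real \<Rightarrow> real measure" where
  "marchenko_pastur c = measure_of UNIV (sets borel)
    (\<lambda>A. ennreal (max 0 (1 - 1 / c)) * emeasure (return borel 0) A
       + emeasure (density lborel (\<lambda>x. ennreal (mp_density c x))) A)"

lemma sets_marchenko_pastur [measurable_cong, simp]:
  "sets (marchenko_pastur c) = sets borel"
  unfolding marchenko_pastur_def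
  by (metis sets.sets_measure_of_eq space_borel)

lemma emeasure_marchenko_pastur:
  assumes "A \<in> sets borel"
  shows "emeasure (marchenko_pastur c) A =
    ennreal (max 0 (1 - 1 / c)) * emeasure (return borel 0) A
    + emeasure (density lborel (\<lambda>x. ennreal (mp_density c x))) A"
proof (rule emeasure_measure_of[OF marchenko_pastur_def])
  show "countably_additive (sets (marchenko_pastur c))
     (\<lambda>A. ennreal (max 0 (1 - 1 / c)) * emeasure (return borel 0) A
       + emeasure (density lborel (\<lambda>x. ennreal (mp_density c x))) A)"
  proof (rule countably_additiveI)
    fix F :: "nat \<Rightarrow> real set"
    assume F: "range F \<subseteq> sets (marchenko_pastur c)" "disjoint_family F"
    have "(\<Sum>i. emeasure M (F i)) = emeasure M (\<Union> (range F))" if "sets M = sets borel" for M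
      using F that by (intro suminf_emeasure) auto
    then show "(\<Sum>i. ennreal (max 0 (1 - 1 / c)) * emeasure (return borel 0) (F i)
          + emeasure (density lborel (\<lambda>x. ennreal (mp_density c x))) (F i))
        = ennreal (max 0 (1 - 1 / c)) * emeasure (return borel 0) (\<Union> (range F))
          + emeasure (density lborel (\<lambda>x. ennreal (mp_density c x))) (\<Union> (range F))"
      by (subst suminf_add[symmetric]) (auto simp del: emeasure_return)
  qed
qed (use assms in \<open>auto simp: positive_def\<close>)

end

theory Submission
  imports Defs "HOL-Combinatorics.Combinatorics"
begin

text \<open>
  The spectral distribution of \<open>K\<close> lives on the half line, so it is determined by its Stieltjes
  transform at negative arguments, \<open>s(t) = tr R / p\<close> with \<open>R\<close> the inverse of \<open>K + t\<close> and \<open>t > 0\<close>; no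
  complex resolvents are needed. Put \<open>q\<^sub>k = (x\<^sub>k\<^sup>T R\<^sub>k x\<^sub>k) / m\<close>, where \<open>R\<^sub>k\<close> is the resolvent without
  the \<open>k\<close>-th sample.
  The Sherman--Morrison formula gives \<open>p = t tr R + (\<Sum>k. q\<^sub>k / (1 + q\<^sub>k))\<close>, and adding one sample
  changes \<open>tr R\<close> by at most \<open>1 / t\<close>. Two consequences: McDiarmid's inequality yields
  \<open>s(t) - E s(t) \<rightarrow> 0\<close> almost surely, whatever the coupling between different \<open>n\<close>, because \<open>p \<ge> n\<close>; and
  if a quadratic form \<open>x\<^sup>T A x\<close> in one sample stays within \<open>o(p)\<close> of \<open>tr A\<close>, then
  \<open>1 - t s - s / (1 + c s) \<rightarrow> 0\<close> for \<open>s = E s(t)\<close>, an equation whose only nonnegative solution is the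
  Stieltjes transform of the Marchenko--Pastur law.

  The quadratic form is controlled by its second moment. By unconditionality the fourth moment
  \<open>E x\<^sub>i x\<^sub>j x\<^sub>k x\<^sub>l\<close> vanishes unless \<open>i \<triangle> j = k \<triangle> l\<close>, and by exchangeability it depends only on
  \<open>r = |i \<inter> j \<inter> k \<inter> l|\<close>, where (C) bounds it by \<open>L\<^sup>r\<close>. For fixed \<open>i \<noteq> j\<close> the pair \<open>(k, l)\<close> is determined by
  \<open>k\<close>, which has to meet \<open>i \<union> j\<close>, so the relevant sum over \<open>k\<close> is at most
  \<open>p ((1 + L d / n)\<^bsup>2 d\<^esup> - 1) = o(p)\<close>.
\<close>

section \<open>Resolvents of Gram matrices\<close>

text \<open>Being independent of the \<open>k\<close>-th sample, \<open>R_k\<close> may be treated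
  as a fixed matrix \<open>A\<close> of which two facts matter: diagonal entries of size at most
  \<open>1 / t\<close>, and squared entries summing to at most \<open>p / t^2\<close>. The form
  minus the trace splits in two. Off the diagonal the coefficients are small only in square mean, so
  row sums of the moment matrix are what has to be bounded. On the diagonal the variables are
  \<open>x_i^2 - 1\<close>; for disjoint \<open>i\<close>, \<open>k\<close> their mixed moment is
  \<open>E(X_1^2 ... X_{2d}^2) - 2 E(X_1^2 ... X_d^2) + 1\<close>, which tends to
  \<open>1 - 2 + 1 = 0\<close> by (A) and (B), and every other \<open>k\<close> meets
  \<open>i\<close>, so that the same counting applies. The counting wants a base of at least 1,
  which (C) does not provide; \<open>L\<close> is replaced by \<open>max 1 L\<close>, at the price
  of showing that \<open>d^2 / n\<close> vanishes as well. The null set of an almost sure statement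
  depends on \<open>t\<close>, so only countably many \<open>t\<close> can be treated. Rational
  \<open>t > 1\<close> suffice: for laws on the half line the transform near \<open>t = 1\<close>
  determines all moments of \<open>1 / (1 + x)\<close>, a variable with values in a compact
  interval.\<close>

definition quad :: "'i set \<Rightarrow> ('i \<Rightarrow> 'i \<Rightarrow> real) \<Rightarrow> ('i \<Rightarrow> real) \<Rightarrow> real" where
  "quad I A v = (\<Sum>a\<in>I. \<Sum>b\<in>I. A a b * v a * v b)"

definition app :: "'i set \<Rightarrow> ('i \<Rightarrow> 'i \<Rightarrow> real) \<Rightarrow> ('i \<Rightarrow> real) \<Rightarrow> 'i \<Rightarrow> real" where
  "app I A v a = (\<Sum>b\<in>I. A a b * v b)"

definition tr :: "'i set \<Rightarrow> ('i \<Rightarrow> 'i \<Rightarrow> real) \<Rightarrow> real" where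
  "tr I A = (\<Sum>a\<in>I. A a a)"

definition delta :: "'i \<Rightarrow> 'i \<Rightarrow> real" where
  "delta a b = (if a = b then 1 else 0)"

text \<open>With \<open>w = 1 / m\<close> and \<open>vs\<close> the list of samples this is
  \<open>K + t\<close>. Matrices are total functions read only on \<open>I\<close>, which lets the
  samples keep their natural index set of \<open>d\<close>-subsets.\<close>

definition gram :: "real \<Rightarrow> real \<Rightarrow> ('i \<Rightarrow> real) list \<Rightarrow> 'i \<Rightarrow> 'i \<Rightarrow> real" where
  "gram t w vs a b = t * delta a b + w * (\<Sum>v\<leftarrow>vs. v a * v b)"

text \<open>The Sherman--Morrison formula, so that \<open>res I t w vs\<close> is the inverse of \<open>gram t w vs\<close>.\<close>

fun res :: "'i set \<Rightarrow> real \<Rightarrow> real \<Rightarrow> ('i \<Rightarrow> real) list \<Rightarrow> 'i \<Rightarrow> 'i \<Rightarrow> real" where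
  "res I t w [] a b = delta a b / t"
| "res I t w (v # vs) a b =
     res I t w vs a b - w * app I (res I t w vs) v a * app I (res I t w vs) v b
       / (1 + w * quad I (res I t w vs) v)"

lemma quad_app: "quad I A v = (\<Sum>a\<in>I. v a * app I A v a)"
  by (simp add: quad_def app_def sum_distrib_left algebra_simps)

lemma sum_delta_mult [simp]:
  assumes "finite I"
  shows "(\<Sum>b\<in>I. delta a b * f b) = (if a \<in> I then f a else 0)"
    "(\<Sum>b\<in>I. delta b a * f b) = (if a \<in> I then f a else 0)"
    "(\<Sum>b\<in>I. f b * delta a b) = (if a \<in> I then f a else 0)"
    "(\<Sum>b\<in>I. f b * delta b a) = (if a \<in> I then f a else 0)"
  using assms by (simp_all add: delta_def if_distrib[where f="\<lambda>x. x * _"]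
      if_distrib[where f="\<lambda>x. _ * x"] sum.delta sum.delta' cong: if_cong)

lemma res_sym: "res I t w vs a b = res I t w vs b a"
  by (induction vs arbitrary: a b) (auto simp: delta_def)

text \<open>A right inverse only, with no condition on entries outside \<open>I\<close>. In the
  symmetric case it is also a left inverse, and uniqueness rests on that.\<close>

definition inverse_on :: "'i set \<Rightarrow> ('i \<Rightarrow> 'i \<Rightarrow> real) \<Rightarrow> ('i \<Rightarrow> 'i \<Rightarrow> real) \<Rightarrow> bool" where
  "inverse_on I A R \<longleftrightarrow> (\<forall>a\<in>I. \<forall>c\<in>I. (\<Sum>b\<in>I. A a b * R b c) = delta a c)"

lemma inverse_on_app:
  assumes I: "finite I" and inv: "inverse_on I A R" and a: "a \<in> I"
  shows "(\<Sum>b\<in>I. A a b * app I R v b) = v a"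
proof -
  have "(\<Sum>b\<in>I. A a b * app I R v b) = (\<Sum>c\<in>I. (\<Sum>b\<in>I. A a b * R b c) * v c)"
    unfolding app_def sum_distrib_left sum_distrib_right by (subst sum.swap) (simp add: mult.assoc)
  also have "\<dots> = (\<Sum>c\<in>I. delta a c * v c)"
    using inv a by (intro sum.cong) (auto simp: inverse_on_def)
  finally show ?thesis using a I by simp
qed

lemma gram_sym: "gram t w vs a b = gram t w vs b a"
  by (simp add: gram_def delta_def mult.commute)

lemma gram_app:
  assumes "finite I" "a \<in> I"
  shows "(\<Sum>b\<in>I. gram t w vs a b * u b) = t * u a + w * (\<Sum>v\<leftarrow>vs. v a * (\<Sum>b\<in>I. v b * u b))"
proof -
  have "(\<Sum>b\<in>I. gram t w vs a b * u b) = t * (\<Sum>b\<in>I. delta a b * u b) + w * (\<Sum>b\<in>I. \<Sum>v\<leftarrow>vs. v a * (v b * u b))"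
    by (simp add: gram_def sum.distrib sum_distrib_left algebra_simps sum_list_const_mult[symmetric])
  also have "(\<Sum>b\<in>I. \<Sum>v\<leftarrow>vs. v a * (v b * u b)) = (\<Sum>v\<leftarrow>vs. v a * (\<Sum>b\<in>I. v b * u b))"
    by (induction vs) (simp_all add: sum.distrib sum_distrib_left)
  finally show ?thesis using assms by simp
qed

text \<open>Writing \<open>v = A u\<close> with \<open>A\<close> the matrix being inverted and \<open>u = R v\<close>, the form \<open>v\<^sup>T R v\<close>
  equals \<open>u\<^sup>T A u \<ge> t |u|\<^sup>2\<close>.\<close>

lemma inverse_quad_lower:
  assumes I: "finite I" and w: "0 \<le> w"
    and inv: "inverse_on I (gram t w vs) R"
  shows "t * (\<Sum>a\<in>I. (app I R v a)\<^sup>2) \<le> quad I R v"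
proof -
  define u where "u = app I R v"
  have Au: "(\<Sum>b\<in>I. gram t w vs a b * u b) = v a" if "a \<in> I" for a
    unfolding u_def by (rule inverse_on_app[OF I inv that])
  have "quad I R v = (\<Sum>a\<in>I. v a * u a)"
    by (simp add: quad_app u_def)
  also have "\<dots> = (\<Sum>a\<in>I. (\<Sum>b\<in>I. gram t w vs a b * u b) * u a)"
    using Au by simp
  also have "\<dots> = (\<Sum>a\<in>I. (t * u a + w * (\<Sum>v\<leftarrow>vs. v a * (\<Sum>b\<in>I. v b * u b))) * u a)"
    using I by (intro sum.cong) (simp_all add: gram_app)
  also have "\<dots> = t * (\<Sum>a\<in>I. (u a)\<^sup>2) + w * (\<Sum>a\<in>I. u a * (\<Sum>v\<leftarrow>vs. v a * (\<Sum>b\<in>I. v b * u b)))"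
    by (simp add: sum.distrib sum_distrib_left algebra_simps power2_eq_square)
  also have "(\<Sum>a\<in>I. u a * (\<Sum>v\<leftarrow>vs. v a * (\<Sum>b\<in>I. v b * u b))) = (\<Sum>v\<leftarrow>vs. (\<Sum>b\<in>I. v b * u b)\<^sup>2)"
    by (induction vs) (simp_all add: sum.distrib sum_distrib_right sum_distrib_left power2_eq_square
        algebra_simps)
  finally have eq: "quad I R v = t * (\<Sum>a\<in>I. (u a)\<^sup>2) + w * (\<Sum>v\<leftarrow>vs. (\<Sum>b\<in>I. v b * u b)\<^sup>2)" .
  have "0 \<le> (\<Sum>v\<leftarrow>vs. (\<Sum>b\<in>I. v b * u b)\<^sup>2)"
    by (intro sum_list_nonneg) auto
  then show ?thesis using eq w by (simp add: u_def)
qed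

lemma inverse_quad_nonneg:
  assumes "finite I" "0 \<le> w" "0 \<le> t" "inverse_on I (gram t w vs) R"
  shows "0 \<le> quad I R v"
  by (rule order_trans[OF _ inverse_quad_lower[OF assms(1,2,4)]])
     (use assms(3) in \<open>simp add: sum_nonneg\<close>)

text \<open>With \<open>u = R v\<close> and \<open>q = v^T R v\<close>, the rank-one change adds
  \<open>w v_a u_c\<close> and subtracts \<open>w u_c / (1 + w q)\<close> times
  \<open>v_a (1 + w q)\<close>. That \<open>1 + w q\<close> is nonzero has to be known while the
  induction is still running; this is why the bounds on \<open>quad\<close> above speak of an
  arbitrary inverse and not of \<open>res\<close>.\<close>

lemma res_inverse:
  assumes I: "finite I" and t: "0 < t" and w: "0 \<le> w"
  shows "inverse_on I (gram t w vs) (res I t w vs)"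
proof (induction vs)
  case Nil
  show ?case using t I by (auto simp: inverse_on_def gram_def)
next
  case (Cons v vs)
  define R where "R = res I t w vs"
  define u where "u = app I R v"
  define q where "q = quad I R v"
  have inv: "inverse_on I (gram t w vs) R" using Cons R_def by simp
  have q: "0 \<le> q" unfolding q_def using inverse_quad_nonneg[OF I w _ inv] t by simp
  have symR: "R a b = R b a" for a b unfolding R_def by (rule res_sym)
  have Au: "(\<Sum>b\<in>I. gram t w vs a b * u b) = v a" if "a \<in> I" for a
    unfolding u_def by (rule inverse_on_app[OF I inv that])
  have gramC: "gram t w (v # vs) a b = gram t w vs a b + w * v a * v b" for a b
    by (simp add: gram_def algebra_simps)
  have resC: "res I t w (v # vs) b c = R b c - w * u b * u c / (1 + w * q)" for b c
    by (simp add: R_def u_def q_def)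
  show ?case unfolding inverse_on_def
  proof (intro ballI)
    fix a c assume a: "a \<in> I" and c: "c \<in> I"
    have pos: "1 + w * q \<noteq> 0" using q w by (smt (verit) mult_nonneg_nonneg)
    have vR: "(\<Sum>b\<in>I. v b * R b c) = u c"
      unfolding u_def app_def by (intro sum.cong refl) (metis symR mult.commute)
    have vu: "(\<Sum>b\<in>I. v b * u b) = q"
      by (simp add: q_def quad_app u_def)
    have AR: "(\<Sum>b\<in>I. gram t w vs a b * R b c) = delta a c"
      using inv a c by (auto simp: inverse_on_def)
    have "(\<Sum>b\<in>I. gram t w (v # vs) a b * res I t w (v # vs) b c) =
       (\<Sum>b\<in>I. gram t w vs a b * R b c) + w * v a * (\<Sum>b\<in>I. v b * R b c)
        - w * u c / (1 + w * q) * (\<Sum>b\<in>I. gram t w vs a b * u b)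
        - w * v a * (w * u c / (1 + w * q)) * (\<Sum>b\<in>I. v b * u b)"
      unfolding gramC resC sum_distrib_left sum.distrib[symmetric] sum_subtractf[symmetric]
      by (intro sum.cong refl) (simp add: algebra_simps diff_divide_distrib add_divide_distrib)
    also have "\<dots> = delta a c + w * v a * u c - v a * (w * u c / (1 + w * q) * (1 + w * q))"
      unfolding vR vu AR Au[OF a] by (simp only: algebra_simps)
    also have "\<dots> = delta a c"
      using pos by simp
    finally show "(\<Sum>b\<in>I. gram t w (v # vs) a b * res I t w (v # vs) b c) = delta a c" .
  qed
qed

text \<open>Symmetry turns the right inverse \<open>R\<close> into a left inverse, so
  \<open>R = R (A R') = (R A) R' = R'\<close>. It serves twice: to show that the order of the
  samples is irrelevant in \<open>res\<close>, and to compare a resolvent with the adjugate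
  matrix.\<close>

lemma inverse_on_unique:
  assumes I: "finite I" and R: "inverse_on I A R" and R': "inverse_on I A R'"
    and symA: "\<And>a b. A a b = A b a" and symR: "\<And>a b. R a b = R b a"
    and ac: "a \<in> I" "c \<in> I"
  shows "R a c = R' a c"
proof -
  have RA: "(\<Sum>b\<in>I. R a b * A b b') = delta a b'" if "b' \<in> I" for b'
  proof -
    have "(\<Sum>b\<in>I. R a b * A b b') = (\<Sum>b\<in>I. A b' b * R b a)"
      by (intro sum.cong refl) (metis symA symR mult.commute)
    then show ?thesis using R ac that by (auto simp: inverse_on_def delta_def)
  qed
  have "R a c = (\<Sum>b\<in>I. R a b * delta b c)"
    using I ac by simp
  also have "\<dots> = (\<Sum>b\<in>I. R a b * (\<Sum>b'\<in>I. A b b' * R' b' c))"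
    using R' ac by (intro sum.cong) (auto simp: inverse_on_def)
  also have "\<dots> = (\<Sum>b'\<in>I. (\<Sum>b\<in>I. R a b * A b b') * R' b' c)"
    unfolding sum_distrib_left sum_distrib_right by (subst sum.swap) (simp add: mult.assoc)
  also have "\<dots> = (\<Sum>b'\<in>I. delta a b' * R' b' c)"
    using RA by simp
  finally show ?thesis using I ac by simp
qed

section \<open>Bounds on the resolvent that do not depend on the samples\<close>

context
  fixes I :: "'i set" and t w :: real
  assumes I: "finite I" and t: "0 < t" and w: "0 \<le> w"
begin

text \<open>\<open>gram\<close> is blind to the order of the samples although the recursion for
  \<open>res\<close> is not. Any sample can thus be brought to the head of the list and removed by
  one Sherman--Morrison step.\<close>

lemma res_perm:
  assumes "mset vs = mset vs'" "a \<in> I" "b \<in> I"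
  shows "res I t w vs a b = res I t w vs' a b"
proof (rule inverse_on_unique[OF I res_inverse[OF I t w]])
  have "gram t w vs = gram t w vs'"
    by (intro ext) (simp add: gram_def sum_mset_sum_list[symmetric] assms(1) del: sum_mset_sum_list)
  then show "inverse_on I (gram t w vs) (res I t w vs')"
    using res_inverse[OF I t w, of vs'] by simp
qed (use assms in \<open>auto intro: gram_sym res_sym\<close>)

lemma res_quad_lower: "t * (\<Sum>a\<in>I. (app I (res I t w vs) v a)\<^sup>2) \<le> quad I (res I t w vs) v"
  by (rule inverse_quad_lower[OF I w res_inverse[OF I t w]])

lemma res_quad_nonneg: "0 \<le> quad I (res I t w vs) v"
  using inverse_quad_nonneg[OF I w _ res_inverse[OF I t w]] t by simp

text \<open>The lower bound on \<open>quad\<close> at the unit vector \<open>delta a\<close>, for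
  which \<open>R v\<close> is a column of \<open>R\<close>. In matrix terms,
  \<open>t (R^2)_{aa} <= R_{aa}\<close>.\<close>

lemma res_col_sum:
  assumes "a \<in> I"
  shows "t * (\<Sum>b\<in>I. (res I t w vs a b)\<^sup>2) \<le> res I t w vs a a"
proof -
  have *: "app I (res I t w vs) (delta a) = (\<lambda>b. res I t w vs b a)"
    using I assms by (simp add: app_def fun_eq_iff)
  have "quad I (res I t w vs) (delta a) = res I t w vs a a"
    unfolding quad_app * using I assms by simp
  moreover have "(\<Sum>b\<in>I. (res I t w vs a b)\<^sup>2) = (\<Sum>b\<in>I. (res I t w vs b a)\<^sup>2)"
    by (intro sum.cong refl) (metis res_sym)
  ultimately show ?thesis
    using res_quad_lower[of vs "delta a"] unfolding * by simp
qed

text \<open>A single term of the column sum gives \<open>t r^2 <= r\<close> for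
  \<open>r = R_{aa}\<close>, which forces both bounds.\<close>

lemma res_diag:
  assumes "a \<in> I"
  shows "0 \<le> res I t w vs a a" "res I t w vs a a \<le> 1 / t"
proof -
  let ?r = "res I t w vs a a"
  have "t * ?r\<^sup>2 \<le> t * (\<Sum>b\<in>I. (res I t w vs a b)\<^sup>2)"
    using t I assms by (intro mult_left_mono member_le_sum) auto
  then have *: "t * ?r\<^sup>2 \<le> ?r" using res_col_sum[OF assms] by (rule order_trans)
  have "0 \<le> t * ?r\<^sup>2" using t by simp
  then show "0 \<le> ?r" using * by linarith
  show "?r \<le> 1 / t"
  proof (cases "?r = 0")
    case False
    then have "0 < ?r" using \<open>0 \<le> ?r\<close> by simp
    then have "t * ?r \<le> 1" using * by (simp add: power2_eq_square)
    then show ?thesis using t by (simp add: field_simps)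
  qed (use t in simp)
qed

text \<open>Every row contributes at most \<open>1 / t^2\<close>. The growth is linear in
  \<open>card I\<close>, not quadratic, and this makes the off-diagonal part of a quadratic form
  negligible.\<close>

lemma res_frobenius: "(\<Sum>a\<in>I. \<Sum>b\<in>I. (res I t w vs a b)\<^sup>2) \<le> real (card I) / t\<^sup>2"
proof -
  have "(\<Sum>a\<in>I. \<Sum>b\<in>I. (res I t w vs a b)\<^sup>2) \<le> (\<Sum>a\<in>I. 1 / t\<^sup>2)"
  proof (rule sum_mono)
    fix a assume "a \<in> I"
    then have "t * (\<Sum>b\<in>I. (res I t w vs a b)\<^sup>2) \<le> 1 / t"
      using res_col_sum[of a vs] res_diag(2)[of a vs] by linarith
    then show "(\<Sum>b\<in>I. (res I t w vs a b)\<^sup>2) \<le> 1 / t\<^sup>2"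
      using t by (simp add: field_simps power2_eq_square)
  qed
  then show ?thesis by simp
qed

lemma tr_res_bounds: "0 \<le> tr I (res I t w vs)" "tr I (res I t w vs) \<le> real (card I) / t"
  using sum_bounded_above[of I "\<lambda>a. res I t w vs a a" "1 / t"] res_diag
  by (auto simp: tr_def intro: sum_nonneg)

lemma tr_res_perm: "mset vs = mset vs' \<Longrightarrow> tr I (res I t w vs) = tr I (res I t w vs')"
  unfolding tr_def by (intro sum.cong refl res_perm)

text \<open>The trace drops by \<open>w |R v|^2 / (1 + w v^T R v)\<close>, and
  \<open>t |R v|^2 <= v^T R v\<close> bounds this by \<open>1 / t\<close> however long
  \<open>v\<close> is.\<close>

lemma tr_res_Cons:
  "tr I (res I t w (v # vs)) \<le> tr I (res I t w vs)"
  "tr I (res I t w vs) \<le> tr I (res I t w (v # vs)) + 1 / t"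
proof -
  let ?R = "res I t w vs"
  let ?q = "quad I ?R v" and ?s = "\<Sum>a\<in>I. (app I ?R v a)\<^sup>2"
  have q: "0 \<le> ?q" by (rule res_quad_nonneg)
  have s: "0 \<le> ?s" "t * ?s \<le> ?q" by (auto intro: sum_nonneg res_quad_lower)
  have eq: "tr I ?R - tr I (res I t w (v # vs)) = w * ?s / (1 + w * ?q)"
    by (simp add: tr_def sum_subtractf power2_eq_square sum_divide_distrib sum_distrib_left mult.assoc)
  have "0 \<le> w * ?s / (1 + w * ?q)" using w q s by auto
  then show "tr I (res I t w (v # vs)) \<le> tr I ?R" using eq by linarith
  have "w * (t * ?s) \<le> w * ?q" using s w by (intro mult_left_mono) auto
  moreover have "0 < 1 + w * ?q" using w q by (simp add: add_pos_nonneg)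
  ultimately have "w * ?s / (1 + w * ?q) \<le> 1 / t"
    using t by (simp add: field_simps)
  then show "tr I ?R \<le> tr I (res I t w (v # vs)) + 1 / t" using eq by linarith
qed

text \<open>\<open>q - w q^2 / (1 + w q) = q / (1 + w q)\<close>. A form in the full resolvent,
  which itself depends on \<open>v\<close>, is expressed through the resolvent without
  \<open>v\<close>.\<close>

lemma quad_res_Cons:
  "w * quad I (res I t w (v # vs)) v = w * quad I (res I t w vs) v / (1 + w * quad I (res I t w vs) v)"
proof -
  let ?R = "res I t w vs"
  let ?q = "quad I ?R v"
  have q: "0 < 1 + w * ?q" using res_quad_nonneg[of vs v] w by (simp add: add_pos_nonneg)
  have "quad I (res I t w (v # vs)) v
      = ?q - w / (1 + w * ?q) * (\<Sum>a\<in>I. \<Sum>b\<in>I. (v a * app I ?R v a) * (v b * app I ?R v b))"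
    by (simp add: quad_def sum_subtractf sum_distrib_left algebra_simps diff_divide_distrib)
  also have "(\<Sum>a\<in>I. \<Sum>b\<in>I. (v a * app I ?R v a) * (v b * app I ?R v b)) = ?q * ?q"
    by (simp add: quad_app sum_product)
  finally have "quad I (res I t w (v # vs)) v = ?q - w / (1 + w * ?q) * (?q * ?q)" .
  then show ?thesis using q by (simp add: field_simps)
qed

text \<open>Take the trace of \<open>gram t w vs\<close> times its inverse, and read each rank-one
  term as a quadratic form.\<close>

lemma tr_res_identity:
  "t * tr I (res I t w vs) + (\<Sum>v\<leftarrow>vs. w * quad I (res I t w vs) v) = real (card I)"
proof -
  let ?R = "res I t w vs"
  have "real (card I) = (\<Sum>a\<in>I. delta a a)" by (simp add: delta_def)
  also have "\<dots> = (\<Sum>a\<in>I. \<Sum>b\<in>I. gram t w vs a b * ?R b a)"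
    using res_inverse[OF I t w, of vs] by (intro sum.cong) (auto simp: inverse_on_def)
  also have "\<dots> = (\<Sum>a\<in>I. t * ?R a a + w * (\<Sum>v\<leftarrow>vs. v a * (\<Sum>b\<in>I. v b * ?R b a)))"
    using I by (intro sum.cong) (simp_all add: gram_app)
  also have "\<dots> = t * tr I ?R + w * (\<Sum>a\<in>I. \<Sum>v\<leftarrow>vs. v a * (\<Sum>b\<in>I. v b * ?R b a))"
    by (simp add: tr_def sum.distrib sum_distrib_left)
  also have "(\<Sum>a\<in>I. \<Sum>v\<leftarrow>xs. v a * (\<Sum>b\<in>I. v b * ?R b a)) = (\<Sum>v\<leftarrow>xs. quad I ?R v)" for xs
    by (induction xs) (simp_all add: sum.distrib quad_def sum_distrib_left res_sym[of I t w vs] ac_simps)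
  finally show ?thesis by (simp add: sum_list_const_mult)
qed

end

section \<open>Eigenvalues and the trace of the resolvent\<close>

text \<open>Factor over the complex numbers and test an eigenvector \<open>v = x + i y\<close> with
  eigenvalue \<open>a\<close>: in \<open>v^* K v = a |v|^2\<close> the imaginary part of the left
  side cancels by symmetry, and its real part is the form at \<open>x\<close> plus the form at
  \<open>y\<close>.\<close>

lemma symmetric_psd_char_poly:
  fixes K :: "real mat"
  assumes K: "K \<in> carrier_mat p p"
    and sym: "\<And>a b. a < p \<Longrightarrow> b < p \<Longrightarrow> K $$ (a, b) = K $$ (b, a)"
    and psd: "\<And>u. 0 \<le> (\<Sum>a<p. \<Sum>b<p. K $$ (a, b) * u a * u b)"
  obtains rs where "char_poly K = (\<Prod>r\<leftarrow>rs. [:- r, 1:])" "length rs = p" "\<And>r. r \<in> set rs \<Longrightarrow> 0 \<le> r"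
proof -
  define KC where "KC = map_mat complex_of_real K"
  have KC: "KC \<in> carrier_mat p p" using K by (simp add: KC_def)
  from char_poly_factorized[OF KC] obtain as
    where as: "char_poly KC = (\<Prod>a\<leftarrow>as. [:- a, 1:])" "length as = p" by blast
  have real: "Im a = 0 \<and> 0 \<le> Re a" if a: "a \<in> set as" for a
  proof -
    have "poly (char_poly KC) a = 0"
      unfolding as(1) poly_prod_list using a by (auto simp: prod_list_zero_iff image_iff)
    then have "eigenvalue KC a" by (simp add: eigenvalue_root_char_poly[OF KC])
    then obtain v where v: "v \<in> carrier_vec p" "v \<noteq> 0\<^sub>v p" "KC *\<^sub>v v = a \<cdot>\<^sub>v v"
      using KC by (auto simp: eigenvalue_def eigenvector_def)
    define x where "x i = Re (v $ i)" for i
    define y where "y i = Im (v $ i)" for i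
    have vi: "v $ i = Complex (x i) (y i)" for i by (simp add: x_def y_def)
    have row: "(\<Sum>j<p. complex_of_real (K $$ (i, j)) * v $ j) = a * v $ i" if "i < p" for i
    proof -
      have "(KC *\<^sub>v v) $ i = (\<Sum>j<p. complex_of_real (K $$ (i, j)) * v $ j)"
        using that KC K v(1) by (simp add: scalar_prod_def KC_def lessThan_atLeast0)
      then show ?thesis using that v by simp
    qed
    define S where "S = (\<Sum>i<p. (x i)\<^sup>2 + (y i)\<^sup>2)"
    define Q where "Q = (\<Sum>i<p. \<Sum>j<p. K $$ (i, j) * x i * x j) + (\<Sum>i<p. \<Sum>j<p. K $$ (i, j) * y i * y j)"
    have "a * complex_of_real S = (\<Sum>i<p. cnj (v $ i) * (a * v $ i))"
      unfolding S_def of_real_sum sum_distrib_left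
      by (intro sum.cong refl) (simp add: vi complex_eq_iff power2_eq_square algebra_simps)
    also have "\<dots> = (\<Sum>i<p. \<Sum>j<p. complex_of_real (K $$ (i, j)) * (cnj (v $ i) * v $ j))"
      by (intro sum.cong refl) (simp add: row[symmetric] sum_distrib_left algebra_simps)
    finally have eq: "a * complex_of_real S = (\<Sum>i<p. \<Sum>j<p. complex_of_real (K $$ (i, j)) * (cnj (v $ i) * v $ j))" .
    have "Re a * S = Q"
      using arg_cong[OF eq, of Re] by (simp add: Q_def vi sum.distrib[symmetric] algebra_simps)
    moreover have "Im a * S = 0"
    proof -
      have "Im a * S = (\<Sum>i<p. \<Sum>j<p. K $$ (i, j) * (x i * y j - y i * x j))"
        using arg_cong[OF eq, of Im] by (simp add: vi)
      also have "\<dots> = (\<Sum>i<p. \<Sum>j<p. K $$ (i, j) * (x i * y j)) - (\<Sum>i<p. \<Sum>j<p. K $$ (i, j) * (y i * x j))"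
        by (simp add: sum_subtractf algebra_simps)
      also have "(\<Sum>i<p. \<Sum>j<p. K $$ (i, j) * (y i * x j)) = (\<Sum>i<p. \<Sum>j<p. K $$ (i, j) * (x i * y j))"
        by (subst sum.swap) (intro sum.cong refl, simp add: sym ac_simps)
      finally show ?thesis by simp
    qed
    moreover have "0 < S"
    proof -
      obtain i where i: "i < p" "v $ i \<noteq> 0" using v(1,2) unfolding vec_eq_iff by auto
      then have "0 < (x i)\<^sup>2 + (y i)\<^sup>2" by (auto simp: vi complex_eq_iff sum_power2_gt_zero_iff)
      then show ?thesis unfolding S_def using i by (intro sum_pos2[of _ i]) auto
    qed
    moreover have "0 \<le> Q" unfolding Q_def using psd by (intro add_nonneg_nonneg) auto
    ultimately show ?thesis by (auto simp: zero_le_mult_iff)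
  qed
  have "char_poly K = (\<Prod>r\<leftarrow>map Re as. [:- r, 1:])"
  \<comment> \<open>Real polynomials that agree at every real point coincide, and there each complex
    factor \<open>z - a\<close> is real because \<open>Im a = 0\<close>.\<close>
  proof (rule poly_eq_poly_eq_iff[THEN iffD1], rule ext)
    fix z :: real
    have "complex_of_real (poly (char_poly K) z) = poly (map_poly of_real (char_poly K)) (of_real z)"
      by simp
    also have "\<dots> = poly (char_poly KC) (of_real z)"
      unfolding KC_def of_real_hom.char_poly_hom[OF K] ..
    also have "\<dots> = (\<Prod>a\<leftarrow>as. of_real z - a)" unfolding as(1) poly_prod_list by (simp add: o_def)
    also have "\<dots> = of_real (\<Prod>a\<leftarrow>as. z - Re a)"
      using real by (induction as) (auto simp: complex_eq_iff)
    also have "(\<Prod>a\<leftarrow>as. z - Re a) = poly (\<Prod>r\<leftarrow>map Re as. [:- r, 1:]) z"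
      unfolding poly_prod_list by (simp add: o_def)
    finally show "poly (char_poly K) z = poly (\<Prod>r\<leftarrow>map Re as. [:- r, 1:]) z"
      by (simp only: of_real_eq_iff)
  qed
  then show ?thesis
    using that[of "map Re as"] as(2) real by auto
qed

lemma pderiv_linear_factors:
  fixes z :: real
  assumes "\<And>r. r \<in> set rs \<Longrightarrow> z \<noteq> r"
  shows "poly (pderiv (\<Prod>r\<leftarrow>rs. [:- r, 1:])) z = poly (\<Prod>r\<leftarrow>rs. [:- r, 1:]) z * (\<Sum>r\<leftarrow>rs. 1 / (z - r))"
  using assms
proof (induction rs)
  case (Cons r rs)
  have "z - r \<noteq> 0" using Cons.prems[of r] by simp
  moreover have "poly (pderiv (\<Prod>r\<leftarrow>rs. [:- r, 1:])) z
      = poly (\<Prod>r\<leftarrow>rs. [:- r, 1:]) z * (\<Sum>r\<leftarrow>rs. 1 / (z - r))"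
    using Cons by auto
  ultimately show ?case
    by (simp only: list.map prod_list.Cons sum_list.Cons pderiv_mult poly_add poly_mult)
       (simp add: pderiv_pCons field_simps)
qed simp

text \<open>Both sides are the logarithmic derivative of the characteristic polynomial at \<open>-t\<close>: on the
  right, Jacobi's formula expresses it through the principal cofactors of \<open>-t - K\<close>.\<close>

lemma tr_inverse_eq_sum_roots:
  fixes K :: "real mat"
  assumes K: "K \<in> carrier_mat p p" and t: "0 < t"
    and rs: "char_poly K = (\<Prod>r\<leftarrow>rs. [:- r, 1:])" "\<And>r. r \<in> set rs \<Longrightarrow> 0 \<le> r"
    and inv: "inverse_on {..<p} A R" and A: "\<And>a b. a < p \<Longrightarrow> b < p \<Longrightarrow> A a b = K $$ (a, b) + t * delta a b"
    and symA: "\<And>a b. A a b = A b a" and symR: "\<And>a b. R a b = R b a"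
  shows "(\<Sum>r\<leftarrow>rs. 1 / (r + t)) = tr {..<p} R"
proof -
  define B where "B = - (char_matrix K (- t))"
  have B: "B \<in> carrier_mat p p" using K by (simp add: B_def char_matrix_def)
  have Bentry: "B $$ (a, b) = - A a b" if "a < p" "b < p" for a b
    using that K by (simp add: B_def char_matrix_def A delta_def)
  define D where "D = poly (char_poly K) (- t)"
  have D: "D = det B" unfolding D_def B_def by (rule char_poly_matrix[OF K])
  have D0: "D \<noteq> 0"
  proof
    assume "D = 0"
    then have "\<exists>r\<in>set rs. - t - r = 0"
      unfolding D_def rs(1) poly_prod_list by (auto simp: prod_list_zero_iff image_iff)
    then show False using rs(2) t by force
  qed
  have adj: "adj_mat B \<in> carrier_mat p p" "B * adj_mat B = det B \<cdot>\<^sub>m 1\<^sub>m p"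
    using adj_mat[OF B] by auto
  \<comment> \<open>\<open>B\<close> is \<open>-(K + t)\<close>, so its adjugate divided by its
    determinant inverts \<open>-A\<close>; hence the sign.\<close>
  define R' where "R' a b = - (adj_mat B $$ (a, b)) / D" for a b
  have inv': "inverse_on {..<p} A R'"
    unfolding inverse_on_def
  proof (intro ballI)
    fix a c assume "a \<in> {..<p}" "c \<in> {..<p}"
    then have a: "a < p" and c: "c < p" by auto
    have "(\<Sum>b<p. A a b * R' b c) = (\<Sum>b<p. B $$ (a, b) * adj_mat B $$ (b, c)) / D"
      using a by (simp add: R'_def Bentry sum_divide_distrib)
    also have "(\<Sum>b<p. B $$ (a, b) * adj_mat B $$ (b, c)) = (B * adj_mat B) $$ (a, c)"
      using a c B adj(1) by (simp add: times_mat_def scalar_prod_def lessThan_atLeast0)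
    also have "\<dots> = D * delta a c" using a c by (simp add: adj(2) D delta_def)
    finally show "(\<Sum>b<p. A a b * R' b c) = delta a c" using D0 by simp
  qed
  have del: "poly (char_poly (mat_delete K i i)) (- t) = adj_mat B $$ (i, i)" if i: "i < p" for i
  proof -
    have K': "mat_delete K i i \<in> carrier_mat (p - 1) (p - 1)" by (rule mat_delete_carrier[OF K])
    have "- char_matrix (mat_delete K i i) (- t) = mat_delete B i i"
      using K i by (intro eq_matI) (auto simp: B_def char_matrix_def mat_delete_def)
    then show ?thesis
      using i B by (simp add: char_poly_matrix[OF K'] adj_mat_def cofactor_def)
  qed
  have "tr {..<p} R = tr {..<p} R'"
    unfolding tr_def by (intro sum.cong refl inverse_on_unique[OF _ inv inv' symA symR]) auto
  also have "\<dots> = - (\<Sum>i<p. poly (char_poly (mat_delete K i i)) (- t)) / D"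
    by (simp add: tr_def R'_def del sum_negf sum_divide_distrib)
  also have "(\<Sum>i<p. poly (char_poly (mat_delete K i i)) (- t)) = poly (pderiv (char_poly K)) (- t)"
    by (simp add: pderiv_char_poly[OF K] poly_sum)
  also have "\<dots> = D * (\<Sum>r\<leftarrow>rs. 1 / (- t - r))"
    unfolding D_def rs(1) by (rule pderiv_linear_factors) (use rs(2) t in force)
  also have "(\<Sum>r\<leftarrow>xs. 1 / (- t - r)) = - (\<Sum>r\<leftarrow>xs. 1 / (r + t))" for xs
  proof (induction xs)
    case (Cons r xs)
    have "1 / (- t - r) = - (1 / (r + t))" by (metis minus_add_distrib add.commute minus_divide_right uminus_add_conv_diff diff_conv_add_uminus)
    then show ?case using Cons by simp
  qed simp
  finally show ?thesis using D0 by simp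
qed

text \<open>The factorisation lists the eigenvalues in an arbitrary order. Sums over it agree with
  sums over \<open>eigenvalue_list\<close> because both lists carry the multiset
  \<open>proots (char_poly K)\<close>.\<close>

lemma ESD_roots:
  fixes K :: "real mat"
  assumes K: "K \<in> carrier_mat p p" and p: "0 < p"
    and rs: "char_poly K = (\<Prod>r\<leftarrow>rs. [:- r, 1:])" "length rs = p" "\<And>r. r \<in> set rs \<Longrightarrow> 0 \<le> r"
  shows "real_distribution (ESD K)" "AE x in ESD K. 0 \<le> x"
    "f \<in> borel_measurable borel \<Longrightarrow> (\<integral>x. f x \<partial>ESD K) = (\<Sum>r\<leftarrow>rs. f r) / real p"
proof -
  have "proots (\<Prod>r\<leftarrow>xs. [:- r, 1:]) = mset xs" for xs :: "real list"
  proof (induction xs)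
    case (Cons x xs)
    have "(\<Prod>r\<leftarrow>xs. [:- r, 1:]) \<noteq> 0" by (auto simp: prod_list_zero_iff)
    then show ?case using Cons by (simp add: proots_mult del: mult_pCons_left)
  qed simp
  then have "proots (char_poly K) = mset rs" by (simp add: rs(1))
  then have mset: "mset (eigenvalue_list K) = mset rs"
    by (simp add: eigenvalue_list_def)
  then have set: "set (eigenvalue_list K) = set rs" and len: "length (eigenvalue_list K) = p"
    using mset_eq_setD mset_eq_length rs(2) by blast+
  have dim: "dim_row K = p" using K by simp
  interpret U: prob_space "uniform_count_measure {..<p}"
    by (rule prob_space_uniform_count_measure) (use p in auto)
  have meas [measurable]: "(\<lambda>j. eigenvalue_list K ! j) \<in> uniform_count_measure {..<p} \<rightarrow>\<^sub>M borel"
    by (auto simp: measurable_def space_uniform_count_measure sets_uniform_count_measure)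
  interpret E: prob_space "ESD K"
    unfolding ESD_def dim by (rule U.prob_space_distr) measurable
  show "real_distribution (ESD K)"
    by unfold_locales (simp add: ESD_def)
  show "AE x in ESD K. 0 \<le> x"
    unfolding ESD_def dim
    by (subst AE_distr_iff) (auto intro!: AE_I2 rs(3) simp: space_uniform_count_measure set[symmetric] len)
  show "(\<integral>x. f x \<partial>ESD K) = (\<Sum>r\<leftarrow>rs. f r) / real p" if [measurable]: "f \<in> borel_measurable borel"
  proof -
    have "(\<integral>x. f x \<partial>ESD K) = (\<integral>j. f (eigenvalue_list K ! j) \<partial>uniform_count_measure {..<p})"
      unfolding ESD_def dim by (rule integral_distr) measurable
    also have "\<dots> = (\<Sum>j<p. f (eigenvalue_list K ! j)) / real p"
      unfolding uniform_count_measure_def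
      by (subst lebesgue_integral_point_measure_finite) (auto simp: sum_divide_distrib)
    also have "(\<Sum>j<p. f (eigenvalue_list K ! j)) = (\<Sum>r\<leftarrow>eigenvalue_list K. f r)"
      by (simp add: sum_list_sum_nth len lessThan_atLeast0)
    also have "\<dots> = (\<Sum>r\<leftarrow>rs. f r)"
      using mset by (metis mset_map sum_mset_sum_list)
    finally show ?thesis .
  qed
qed

text \<open>The bridge between matrices on \<open>{..<p}\<close> and functions on
  \<open>d\<close>-subsets: Gram matrix, inverse and trace are transported along the enumeration
  \<open>dsubset_list\<close>. Beyond this point the spectrum enters only through the trace of
  \<open>res\<close>.\<close>

lemma ESD_sample_cov:
  fixes v :: "nat \<Rightarrow> nat set \<Rightarrow> real"
  assumes p: "0 < n choose d" and m: "0 < m"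
  defines "K \<equiv> sample_cov (n choose d) m (\<lambda>k. coord_vec n d (v k))"
  shows "real_distribution (ESD K)" "AE x in ESD K. 0 \<le> x"
    "0 < t \<Longrightarrow> (\<integral>x. 1 / (x + t) \<partial>ESD K)
      = tr (dsubsets n d) (res (dsubsets n d) t (1 / real m) (map v [1..<Suc m])) / real (n choose d)"
proof -
  let ?p = "n choose d" and ?D = "\<lambda>a. dsubset_list n d ! a"
  have bij: "bij_betw ?D {..<?p} (dsubsets n d)"
    using bij_betw_nth[OF dsubset_list(2) refl dsubset_list(1)[symmetric]]
    by (simp add: dsubset_list(3) lessThan_def)
  have K: "K \<in> carrier_mat ?p ?p" by (simp add: K_def sample_cov_def)
  have fin: "finite (dsubsets n d)" by (simp add: dsubsets_def)
  have Kentry: "K $$ (a, b) = 1 / real m * (\<Sum>k=1..m. v k (?D a) * v k (?D b))" if "a < ?p" "b < ?p" for a b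
    using that by (simp add: K_def sample_cov_def coord_vec_def)
  have Ksym: "K $$ (a, b) = K $$ (b, a)" if "a < ?p" "b < ?p" for a b
    using that by (simp add: Kentry mult.commute)
  have Kpsd: "0 \<le> (\<Sum>a<?p. \<Sum>b<?p. K $$ (a, b) * u a * u b)" for u
  proof -
    have "(\<Sum>a<?p. \<Sum>b<?p. K $$ (a, b) * u a * u b)
        = (\<Sum>a<?p. \<Sum>b<?p. \<Sum>k=1..m. 1 / real m * ((v k (?D a) * u a) * (v k (?D b) * u b)))"
      by (intro sum.cong refl) (simp add: Kentry sum_distrib_left sum_distrib_right sum_divide_distrib algebra_simps)
    also have "\<dots> = (\<Sum>a<?p. \<Sum>k=1..m. \<Sum>b<?p. 1 / real m * ((v k (?D a) * u a) * (v k (?D b) * u b)))"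
      by (intro sum.cong refl sum.swap)
    also have "\<dots> = (\<Sum>k=1..m. \<Sum>a<?p. \<Sum>b<?p. 1 / real m * ((v k (?D a) * u a) * (v k (?D b) * u b)))"
      by (rule sum.swap)
    also have "\<dots> = (\<Sum>k=1..m. 1 / real m * (\<Sum>a<?p. v k (?D a) * u a)\<^sup>2)"
      unfolding power2_eq_square unfolding sum_product unfolding sum_distrib_left by (rule refl)
    also have "\<dots> \<ge> 0" by (intro sum_nonneg mult_nonneg_nonneg) auto
    finally show ?thesis .
  qed
  obtain rs where rs: "char_poly K = (\<Prod>r\<leftarrow>rs. [:- r, 1:])" "length rs = ?p" "\<And>r. r \<in> set rs \<Longrightarrow> 0 \<le> r"
    using symmetric_psd_char_poly[OF K Ksym Kpsd] by blast
  show "real_distribution (ESD K)" "AE x in ESD K. 0 \<le> x"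
    using ESD_roots[OF K p rs] by auto
  assume t: "0 < t"
  let ?R = "res (dsubsets n d) t (1 / real m) (map v [1..<Suc m])"
    and ?A = "gram t (1 / real m) (map v [1..<Suc m])"
  have dinj: "delta (?D a) (?D b) = delta a b" if "a < ?p" "b < ?p" for a b
    using bij that by (auto simp: delta_def bij_betw_def inj_on_def)
  have "(\<Sum>r\<leftarrow>rs. 1 / (r + t)) = tr {..<?p} (\<lambda>a b. ?R (?D a) (?D b))"
  proof (rule tr_inverse_eq_sum_roots[OF K t rs(1,3)])
    show "inverse_on {..<?p} (\<lambda>a b. ?A (?D a) (?D b)) (\<lambda>a b. ?R (?D a) (?D b))"
      unfolding inverse_on_def
    proof (intro ballI)
      fix a c assume ac: "a \<in> {..<?p}" "c \<in> {..<?p}"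
      have "(\<Sum>b<?p. ?A (?D a) (?D b) * ?R (?D b) (?D c)) = (\<Sum>i\<in>dsubsets n d. ?A (?D a) i * ?R i (?D c))"
        by (rule sum.reindex_bij_betw[OF bij])
      also have "\<dots> = delta (?D a) (?D c)"
      proof -
        have "inverse_on (dsubsets n d) ?A ?R" using t by (intro res_inverse fin) auto
        then show ?thesis using bij_betwE[OF bij] ac unfolding inverse_on_def by blast
      qed
      finally show "(\<Sum>b<?p. ?A (?D a) (?D b) * ?R (?D b) (?D c)) = delta a c" using ac dinj by simp
    qed
    show "?A (?D a) (?D b) = K $$ (a, b) + t * delta a b" if "a < ?p" "b < ?p" for a b
      unfolding gram_def Kentry[OF that] dinj[OF that]
      by (simp add: interv_sum_list_conv_sum_set_nat o_def atLeastLessThanSuc_atLeastAtMost del: upt_Suc)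
  qed (assumption | rule gram_sym res_sym)+
  also have "\<dots> = tr (dsubsets n d) ?R"
    unfolding tr_def by (rule sum.reindex_bij_betw[OF bij])
  finally show "(\<integral>x. 1 / (x + t) \<partial>ESD K) = tr (dsubsets n d) ?R / real ?p"
    using ESD_roots(3)[OF K p rs, of "\<lambda>x. 1 / (x + t)"] by simp
qed

section \<open>The Stieltjes transform of the Marchenko--Pastur law\<close>

text \<open>An explicit antiderivative \<open>F\<close>, continuous up to the edges. The case
  \<open>w = a\<close> is included because for \<open>c = 1\<close> the lower edge of the
  Marchenko--Pastur density is 0 and its Cauchy integral at 0 is wanted; there \<open>S = 0\<close>
  and the last term of \<open>F\<close> vanishes, which explains the case distinctions on
  \<open>S\<close>.\<close>

lemma semicircle_cauchy_integral:
  fixes a b w :: real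
  assumes ab: "a < b" and w: "w \<le> a"
  shows "((\<lambda>x. sqrt ((b - x) * (x - a)) / (x - w)) has_integral
    pi * ((a + b) / 2 - w - sqrt ((a - w) * (b - w)))) {a..b}"
proof -
  define \<rho> where "\<rho> = (b - a) / 2"
  define m where "m = (a + b) / 2"
  define D where "D = m - w"
  define S where "S = sqrt ((a - w) * (b - w))"
  have \<rho>: "0 < \<rho>" using ab by (simp add: \<rho>_def)
  have aeq: "a = m - \<rho>" and beq: "b = m + \<rho>" by (auto simp: \<rho>_def m_def field_simps)
  have weq: "w = m - D" by (simp add: D_def)
  have D: "\<rho> \<le> D" using w by (simp add: aeq weq)
  have S2: "S\<^sup>2 = D\<^sup>2 - \<rho>\<^sup>2"
  proof -
    have "0 \<le> (a - w) * (b - w)" using w ab by (intro mult_nonneg_nonneg) auto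
    then show ?thesis unfolding S_def
      by (simp add: aeq beq weq) (simp add: power2_eq_square algebra_simps)
  qed
  have S0: "0 \<le> S" using w ab by (simp add: S_def)
  \<comment> \<open>For \<open>w < a\<close> this is the fractional linear map with pole
    \<open>w\<close> that sends \<open>a\<close> to \<open>-1\<close> and \<open>b\<close> to
    \<open>1\<close>. With it \<open>1 - h^2\<close> is \<open>S^2 (b - x) (x - a)\<close> over a
    square, so that the derivative of \<open>S * arcsin h\<close> contains only the root already
    present in the integrand.\<close>
  define h where "h x = (D * (x - m) + \<rho>\<^sup>2) / (\<rho> * (x - w))" for x
  define F where "F x = D * arcsin ((x - m) / \<rho>) + sqrt ((b - x) * (x - a)) - S * arcsin (h x)" for x
  have h1: "1 - (h x)\<^sup>2 = S\<^sup>2 * ((b - x) * (x - a)) / (\<rho> * (x - w))\<^sup>2" if "w < x" for x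
  proof -
    have "0 < \<rho> * (x - w)" using \<rho> that by simp
    then have "\<rho> * (x - w) \<noteq> 0" by (metis less_irrefl)
    then have "1 - (h x)\<^sup>2 = ((\<rho> * (x - w))\<^sup>2 - (D * (x - m) + \<rho>\<^sup>2)\<^sup>2) / (\<rho> * (x - w))\<^sup>2"
      by (simp add: h_def power_divide diff_divide_distrib del: mult_eq_0_iff)
    also have "(\<rho> * (x - w))\<^sup>2 - (D * (x - m) + \<rho>\<^sup>2)\<^sup>2 = S\<^sup>2 * ((b - x) * (x - a))"
      unfolding S2 aeq beq weq by (simp add: power2_eq_square algebra_simps)
    finally show ?thesis .
  qed
  have hrange: "-1 \<le> h x \<and> h x \<le> 1" if "w < x" "x \<in> {a..b}" for x
  proof -
    have "0 \<le> 1 - (h x)\<^sup>2" unfolding h1[OF that(1)] using that(2) by auto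
    then have "\<bar>h x\<bar> \<le> 1" by (simp add: abs_square_le_1)
    then show ?thesis by auto
  qed
  have cont: "continuous_on {a..b} F"
  proof (cases "S = 0")
    case True
    then show ?thesis unfolding F_def using \<rho>
      by (auto intro!: continuous_intros simp: aeq beq field_simps)
  next
    case False
    then have "w < a" using w unfolding S_def by (cases "w = a") auto
    then have "continuous_on {a..b} h" unfolding h_def using \<rho>
      by (intro continuous_intros) auto
    then show ?thesis unfolding F_def using \<rho> hrange \<open>w < a\<close>
      by (intro continuous_intros) (auto simp: aeq beq field_simps)
  qed
  have deriv: "(F has_real_derivative sqrt ((b - x) * (x - a)) / (x - w)) (at x)"
    if x: "x \<in> {a<..<b}" for x
  proof -
    define g where "g = sqrt ((b - x) * (x - a))"
    have g2: "g\<^sup>2 = (b - x) * (x - a)" and gpos: "0 < g" using x by (auto simp: g_def)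
    have xw: "0 < x - w" using x w by auto
    have d1: "((\<lambda>x. D * arcsin ((x - m) / \<rho>)) has_real_derivative D / g) (at x)"
    proof -
      have r: "-1 < (x - m) / \<rho>" "(x - m) / \<rho> < 1" using x \<rho> by (auto simp: aeq beq field_simps)
      have "1 - ((x - m) / \<rho>)\<^sup>2 = (g / \<rho>)\<^sup>2"
        using \<rho> by (simp add: power_divide g2 field_simps) (simp add: aeq beq algebra_simps power2_eq_square)
      then have "sqrt (1 - ((x - m) / \<rho>)\<^sup>2) = g / \<rho>" using gpos \<rho> by simp
      then show ?thesis using r \<rho> gpos
        by (auto intro!: derivative_eq_intros simp: field_simps)
    qed
    have d2: "((\<lambda>x. sqrt ((b - x) * (x - a))) has_real_derivative (m - x) / g) (at x)"
    proof -
      have "0 < (b - x) * (x - a)" using x by auto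
      then show ?thesis unfolding g_def
        by (auto intro!: derivative_eq_intros simp: m_def field_simps)
    qed
    have d3: "((\<lambda>x. S * arcsin (h x)) has_real_derivative S\<^sup>2 / ((x - w) * g)) (at x)"
    proof (cases "S = 0")
      case False
      have pos: "0 < 1 - (h x)\<^sup>2"
        unfolding h1[OF xw[simplified]] using x False \<rho> xw by auto
      then have r: "-1 < h x" "h x < 1" using abs_square_less_1[of "h x"] by auto
      have "1 - (h x)\<^sup>2 = (S * g / (\<rho> * (x - w)))\<^sup>2"
        unfolding h1[OF xw[simplified]] by (simp add: power_divide power_mult_distrib g2)
      then have sq: "sqrt (1 - (h x)\<^sup>2) = S * g / (\<rho> * (x - w))"
        using S0 gpos \<rho> xw by simp
      have dh: "(h has_real_derivative S\<^sup>2 / (\<rho> * (x - w)\<^sup>2)) (at x)"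
      proof -
        have "(h has_real_derivative (D * (\<rho> * (x - w)) - (D * (x - m) + \<rho>\<^sup>2) * \<rho>) / (\<rho> * (x - w))\<^sup>2) (at x)"
          unfolding h_def using \<rho> xw
          by (auto intro!: derivative_eq_intros simp: power2_eq_square)
        also have "(D * (\<rho> * (x - w)) - (D * (x - m) + \<rho>\<^sup>2) * \<rho>) / (\<rho> * (x - w))\<^sup>2
            = \<rho> * S\<^sup>2 / (\<rho> * (x - w))\<^sup>2"
          unfolding S2 weq by (simp add: power2_eq_square algebra_simps)
        also have "\<dots> = S\<^sup>2 / (\<rho> * (x - w)\<^sup>2)" using \<rho> by (simp add: power2_eq_square)
        finally show ?thesis .
      qed
      have "((\<lambda>x. S * arcsin (h x)) has_real_derivative
          S * (inverse (sqrt (1 - (h x)\<^sup>2)) * (S\<^sup>2 / (\<rho> * (x - w)\<^sup>2)))) (at x)"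
        by (intro DERIV_cmult DERIV_chain2[OF DERIV_arcsin dh] r)
      also have "S * (inverse (sqrt (1 - (h x)\<^sup>2)) * (S\<^sup>2 / (\<rho> * (x - w)\<^sup>2))) = S\<^sup>2 / ((x - w) * g)"
      proof -
        have "S * (inverse (S * g / (\<rho> * y)) * (S\<^sup>2 / (\<rho> * y\<^sup>2))) = S\<^sup>2 / (y * g)" if "0 < y" for y
          using False \<rho> that gpos by (simp add: field_simps power2_eq_square)
        then show ?thesis unfolding sq using xw .
      qed
      finally show ?thesis .
    qed simp
    have "(F has_real_derivative D / g + (m - x) / g - S\<^sup>2 / ((x - w) * g)) (at x)"
      unfolding F_def by (intro DERIV_diff DERIV_add d1 d2 d3)
    also have "D / g + (m - x) / g - S\<^sup>2 / ((x - w) * g) = ((D + m - x) * (x - w) - S\<^sup>2) / ((x - w) * g)"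
      using xw gpos by (simp add: field_simps)
    also have "(D + m - x) * (x - w) - S\<^sup>2 = g * g"
      unfolding power2_eq_square[symmetric] g2 S2 unfolding aeq beq weq by (simp add: power2_eq_square algebra_simps)
    also have "g * g / ((x - w) * g) = g / (x - w)" using gpos by simp
    finally show ?thesis by (simp add: g_def)
  qed
  have "((\<lambda>x. sqrt ((b - x) * (x - a)) / (x - w)) has_integral F b - F a) {a..b}"
    using ab cont deriv
    by (intro fundamental_theorem_of_calculus_interior)
       (auto simp: has_real_derivative_iff_has_vector_derivative[symmetric])
  moreover have "F b - F a = pi * (D - S)"
  proof -
    have "S * arcsin (h b) = S * (pi / 2) \<and> S * arcsin (h a) = S * (- (pi / 2))"
    proof (cases "S = 0")
      case False
      then have "w < a" using w unfolding S_def by (cases "w = a") auto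
      then have Dr: "D - \<rho> > 0" by (simp add: aeq weq)
      have "h b = 1"
      proof -
        have "D * (b - m) + \<rho>\<^sup>2 = \<rho> * (b - w)"
          unfolding beq weq by (simp add: power2_eq_square algebra_simps)
        then show ?thesis using \<rho> \<open>w < a\<close> ab by (simp add: h_def)
      qed
      moreover have "h a = -1"
      proof -
        have "D * (a - m) + \<rho>\<^sup>2 = - (\<rho> * (a - w))"
          unfolding aeq weq by (simp add: power2_eq_square algebra_simps)
        then show ?thesis using \<rho> \<open>w < a\<close> by (simp add: h_def)
      qed
      ultimately show ?thesis by simp
    qed simp
    moreover have "(b - m) / \<rho> = 1" "(a - m) / \<rho> = -1" using \<rho> by (auto simp: aeq beq)
    ultimately have "F b = D * (pi / 2) - S * (pi / 2)" "F a = D * (- (pi / 2)) - S * (- (pi / 2))"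
      unfolding F_def by simp_all
    then show ?thesis by (simp add: algebra_simps)
  qed
  ultimately show ?thesis by (simp add: D_def m_def S_def algebra_simps)
qed

text \<open>The law is given by its values on sets, so additivity of the integral in the measure is
  obtained by induction over nonnegative measurable functions: indicators, linear combinations,
  increasing limits.\<close>

lemma nn_integral_marchenko_pastur:
  assumes f: "f \<in> borel_measurable borel"
  shows "(\<integral>\<^sup>+x. f x \<partial>marchenko_pastur c) =
    ennreal (max 0 (1 - 1 / c)) * f 0 + (\<integral>\<^sup>+x. ennreal (mp_density c x) * f x \<partial>lborel)"
proof -
  have dens [measurable]: "mp_density c \<in> borel_measurable borel"
    unfolding mp_density_def Let_def by measurable
  have "(\<integral>\<^sup>+x. f x \<partial>marchenko_pastur c) =
    ennreal (max 0 (1 - 1 / c)) * (\<integral>\<^sup>+x. f x \<partial>return borel 0)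
      + (\<integral>\<^sup>+x. f x \<partial>density lborel (\<lambda>x. ennreal (mp_density c x)))"
    using f
  proof (induction rule: borel_measurable_induct)
    case (cong f g)
    then have "f = g" by auto
    then show ?case using cong by simp
  next
    case (set A)
    then show ?case by (simp add: emeasure_marchenko_pastur)
  next
    case (mult u k)
    note [measurable] = mult(2)
    show ?case
      using mult by (simp add: nn_integral_cmult distrib_left ac_simps del: nn_integral_return)
  next
    case (add u v)
    note [measurable] = add(1,3)
    show ?case
      using add by (simp add: nn_integral_add distrib_left ac_simps del: nn_integral_return)
  next
    case (seq U)
    note [measurable] = seq(1)
    have conv: "(\<integral>\<^sup>+x. (SUP i. U i) x \<partial>N) = (SUP i. \<integral>\<^sup>+x. U i x \<partial>N)"
      if [measurable_cong]: "sets N = sets borel" for N :: "real measure"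
      unfolding SUP_apply by (rule nn_integral_monotone_convergence_SUP) (use seq in \<open>auto simp: incseq_def le_fun_def\<close>)
    have inc: "incseq (\<lambda>i. \<integral>\<^sup>+x. U i x \<partial>N)" for N :: "real measure"
      using seq by (auto simp: incseq_def le_fun_def intro!: nn_integral_mono)
    let ?k = "ennreal (max 0 (1 - 1 / c))" and ?R = "return borel (0::real)"
      and ?D = "density lborel (\<lambda>x. ennreal (mp_density c x))"
    have "(\<integral>\<^sup>+x. (SUP i. U i) x \<partial>marchenko_pastur c) = (SUP i. \<integral>\<^sup>+x. U i x \<partial>marchenko_pastur c)"
      by (rule conv) simp
    also have "\<dots> = (SUP i. ?k * (\<integral>\<^sup>+x. U i x \<partial>?R) + (\<integral>\<^sup>+x. U i x \<partial>?D))"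
      by (intro SUP_cong refl seq)
    also have "\<dots> = (SUP i. ?k * (\<integral>\<^sup>+x. U i x \<partial>?R)) + (SUP i. \<integral>\<^sup>+x. U i x \<partial>?D)"
      by (rule ennreal_SUP_add) (use inc in \<open>auto simp: incseq_def intro!: mult_left_mono simp del: nn_integral_return\<close>)
    also have "(SUP i. ?k * (\<integral>\<^sup>+x. U i x \<partial>?R)) = ?k * (SUP i. \<integral>\<^sup>+x. U i x \<partial>?R)"
      by (rule SUP_mult_left_ennreal[symmetric])
    also have "(SUP i. \<integral>\<^sup>+x. U i x \<partial>?R) = (\<integral>\<^sup>+x. (SUP i. U i) x \<partial>?R)"
      by (rule conv[symmetric]) simp
    also have "(SUP i. \<integral>\<^sup>+x. U i x \<partial>?D) = (\<integral>\<^sup>+x. (SUP i. U i) x \<partial>?D)"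
      by (rule conv[symmetric]) simp
    finally show ?case .
  qed
  then show ?thesis
    using f by (simp add: nn_integral_return nn_integral_density)
qed

text \<open>For \<open>c, t > 0\<close> the positive root \<open>s\<close> of
  \<open>c t s^2 + (1 - c + t) s - 1 = 0\<close>, which is
  \<open>1 - t s - s / (1 + c s) = 0\<close> with the denominator cleared.\<close>

definition mp_stieltjes :: "real \<Rightarrow> real \<Rightarrow> real" where
  "mp_stieltjes c t = (sqrt ((1 - c + t)\<^sup>2 + 4 * c * t) - (1 - c + t)) / (2 * c * t)"

context
  fixes c :: real
  assumes c: "0 < c"
begin

abbreviation "lo \<equiv> (1 - sqrt c)\<^sup>2"
abbreviation "hi \<equiv> (1 + sqrt c)\<^sup>2"

lemma mp_edges:
  "lo + hi = 2 + 2 * c" "lo * hi = (1 - c)\<^sup>2"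
  "lo < hi"
proof -
  have s: "sqrt c * sqrt c = c" using c by simp
  show "lo + hi = 2 + 2 * c"
    using s by (simp add: power2_eq_square algebra_simps)
  have "lo * hi = ((1 - sqrt c) * (1 + sqrt c))\<^sup>2"
    by (simp add: power_mult_distrib)
  also have "(1 - sqrt c) * (1 + sqrt c) = 1 - c" using s by (simp add: algebra_simps)
  finally show "lo * hi = (1 - c)\<^sup>2" .
  show "lo < hi"
    using c by (simp add: power2_eq_square algebra_simps)
qed

text \<open>The product \<open>(lo + t) (hi + t)\<close> under the root is the discriminant of the
  quadratic equation for \<open>mp_stieltjes c t\<close>.\<close>

lemma mp_density_cauchy:
  assumes t: "0 \<le> t"
  shows "((\<lambda>x. sqrt ((hi - x) * (x - lo)) / (x + t)) has_integral
    pi * (1 + c + t - sqrt ((1 - c + t)\<^sup>2 + 4 * c * t))) {lo..hi}"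
proof -
  have "(lo + t) * (hi + t) = lo * hi + t * (lo + hi) + t\<^sup>2"
    by (simp add: algebra_simps power2_eq_square)
  also have "\<dots> = (1 - c + t)\<^sup>2 + 4 * c * t"
    unfolding mp_edges by (simp add: algebra_simps power2_eq_square)
  finally have e: "(lo + t) * (hi + t) = (1 - c + t)\<^sup>2 + 4 * c * t" .
  have t': "- t \<le> lo" using t by (smt (verit) zero_le_power2)
  show ?thesis
    using semicircle_cauchy_integral[OF mp_edges(3) t'] unfolding mp_edges(1)
    by (simp add: e add_divide_distrib)
qed

text \<open>The indicator makes the test function nonnegative everywhere, a kernel such as
  \<open>1 / (x + t)\<close> being negative left of \<open>-t\<close>. It changes nothing under the
  density, which lives on \<open>[lo, hi]\<close>.\<close>

lemma mp_density_nn_integral: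
  assumes I: "((\<lambda>x. sqrt ((hi - x) * (x - lo)) / (2 * pi * c * x) * k x) has_integral r)
      {lo..hi}"
    and k: "\<And>x. 0 \<le> x \<Longrightarrow> 0 \<le> k x"
  shows "(\<integral>\<^sup>+x. ennreal (mp_density c x) * ennreal (indicator {0..} x * k x) \<partial>lborel) = ennreal r"
proof -
  have "ennreal (mp_density c x) * ennreal (indicator {0..} x * k x)
    = ennreal (sqrt ((hi - x) * (x - lo)) / (2 * pi * c * x) * k x) * indicator {lo..hi} x" for x
  proof (cases "x \<in> {lo..hi}")
    case True
    then have "0 \<le> lo" "lo \<le> x" by auto
    then have x: "0 \<le> x" by (rule order_trans)
    have "0 \<le> sqrt ((hi - x) * (x - lo)) / (2 * pi * c * x)" using True x c by auto
    then show ?thesis using True x k[OF x] by (simp add: mp_density_def Let_def ennreal_mult[symmetric])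
  qed (simp add: mp_density_def Let_def)
  then have "(\<integral>\<^sup>+x. ennreal (mp_density c x) * ennreal (indicator {0..} x * k x) \<partial>lborel)
    = (\<integral>\<^sup>+x. ennreal (sqrt ((hi - x) * (x - lo)) / (2 * pi * c * x) * k x) * indicator {lo..hi} x \<partial>lborel)"
    by simp
  also have "\<dots> = ennreal r"
  proof (rule nn_integral_has_integral_lebesgue'[OF _ I])
    fix x assume True: "x \<in> {lo..hi}"
    then have "0 \<le> lo" "lo \<le> x" by auto
    then have x: "0 \<le> x" by (rule order_trans)
    show "0 \<le> sqrt ((hi - x) * (x - lo)) / (2 * pi * c * x) * k x"
      using True x c k[OF x] by auto
  qed
  finally show ?thesis .
qed

lemma mp_negative: "emeasure (marchenko_pastur c) {..<0} = 0"
proof -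
  have "mp_density c x * indicator {..<0} x = 0" for x
  proof (cases "x < 0")
    case True
    have "0 \<le> lo" by simp
    then have "x \<notin> {lo..hi}" using True by (metis atLeastAtMost_iff not_less order_trans)
    then show ?thesis by (simp add: mp_density_def Let_def)
  qed simp
  then have *: "ennreal (mp_density c x) * indicator {..<0} x = 0" for x
    by (metis ennreal_0 indicator_simps(1) indicator_simps(2) mult.right_neutral mult_zero_right)
  have "(\<lambda>x. ennreal (mp_density c x)) \<in> borel_measurable lborel"
    unfolding mp_density_def Let_def by measurable
  then have "emeasure (density lborel (\<lambda>x. ennreal (mp_density c x))) {..<0} = 0"
    by (subst emeasure_density) (simp_all only: * nn_integral_const mult_zero_left, simp)
  then show ?thesis
    by (simp add: emeasure_marchenko_pastur)
qed

text \<open>The continuous part has mass \<open>(1 + c - |1 - c|) / (2 c)\<close>, which is the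
  minimum of \<open>1\<close> and \<open>1 / c\<close>; the atom at 0 supplies the rest.\<close>

lemma prob_space_marchenko_pastur: "prob_space (marchenko_pastur c)"
proof
  have s: "space (marchenko_pastur c) = UNIV"
    using sets_eq_imp_space_eq[OF sets_marchenko_pastur] by simp
  have "((\<lambda>x. sqrt ((hi - x) * (x - lo)) / (2 * pi * c * x) * 1) has_integral
      1 / (2 * pi * c) * (pi * (1 + c + 0 - sqrt ((1 - c + 0)\<^sup>2 + 4 * c * 0))))
      {lo..hi}"
    using has_integral_mult_right[OF mp_density_cauchy[of 0], of "1 / (2 * pi * c)"]
    by (simp add: field_simps)
  note I = this
  have val: "1 / (2 * pi * c) * (pi * y) = y / (2 * c)" for y by simp
  from mp_density_nn_integral[OF I[unfolded val]]
  have "(\<integral>\<^sup>+x. ennreal (mp_density c x) * ennreal (indicator {0..} x * 1) \<partial>lborel)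
      = ennreal ((1 + c - \<bar>1 - c\<bar>) / (2 * c))"
    by simp
  moreover have "emeasure (marchenko_pastur c) {0..} = (\<integral>\<^sup>+x. ennreal (indicator {0..} x * 1) \<partial>marchenko_pastur c)"
    by (simp add: ennreal_indicator)
  ultimately have "emeasure (marchenko_pastur c) {0..} =
      ennreal (max 0 (1 - 1 / c)) + ennreal ((1 + c - \<bar>1 - c\<bar>) / (2 * c))"
    using nn_integral_marchenko_pastur[of "\<lambda>x. ennreal (indicator {0..} x * 1)" c] by simp
  also have "\<dots> = ennreal (max 0 (1 - 1 / c) + (1 + c - \<bar>1 - c\<bar>) / (2 * c))"
    using c by (subst ennreal_plus) auto
  also have "max 0 (1 - 1 / c) + (1 + c - \<bar>1 - c\<bar>) / (2 * c) = 1"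
    using c by (auto simp: max_def field_simps abs_if)
  finally have "emeasure (marchenko_pastur c) {0..} = 1" by simp
  moreover have "emeasure (marchenko_pastur c) UNIV
      = emeasure (marchenko_pastur c) {..<0} + emeasure (marchenko_pastur c) {0..}"
    by (subst plus_emeasure) (auto intro!: arg_cong[where f="emeasure _"])
  ultimately show "emeasure (marchenko_pastur c) (space (marchenko_pastur c)) = 1"
    by (simp add: mp_negative s)
qed

lemma AE_marchenko_pastur_nonneg: "AE x in marchenko_pastur c. 0 \<le> x"
proof (rule AE_I[OF _ mp_negative])
  show "{x \<in> space (marchenko_pastur c). \<not> 0 \<le> x} \<subseteq> {..<0}" by auto
qed simp

text \<open>Partial fractions, \<open>1 / (x (x + t)) = (1 / x - 1 / (x + t)) / t\<close>, reduce
  the integral to the Cauchy integrals at \<open>0\<close> and at \<open>-t\<close>. The atom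
  contributes its mass times \<open>1 / t\<close>.\<close>

lemma stieltjes_marchenko_pastur:
  assumes t: "0 < t"
  shows "(\<integral>x. 1 / (x + t) \<partial>marchenko_pastur c) = mp_stieltjes c t"
proof -
  let ?g = "\<lambda>x. sqrt ((hi - x) * (x - lo))"
  let ?S = "sqrt ((1 - c + t)\<^sup>2 + 4 * c * t)"
  have "((\<lambda>x. 1 / (2 * pi * c * t) * (?g x / (x + 0) - ?g x / (x + t))) has_integral
      1 / (2 * pi * c * t) * (pi * (1 + c + 0 - sqrt ((1 - c + 0)\<^sup>2 + 4 * c * 0)) - pi * (1 + c + t - ?S))) {lo..hi}"
    using t by (intro has_integral_mult_right has_integral_diff mp_density_cauchy) auto
  then have I: "((\<lambda>x. ?g x / (2 * pi * c * x) * (1 / (x + t))) has_integral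
      1 / (2 * pi * c * t) * (pi * (1 + c + 0 - sqrt ((1 - c + 0)\<^sup>2 + 4 * c * 0)) - pi * (1 + c + t - ?S))) {lo..hi}"
  proof (rule has_integral_eq[rotated])
    fix x assume x: "x \<in> {lo..hi}"
    then have "0 \<le> lo" "lo \<le> x" by auto
    then have x0: "0 \<le> x" by (rule order_trans)
    \<comment> \<open>The point \<open>x = 0\<close> belongs to the interval only when
      \<open>lo = 0\<close>; the root vanishes there, so both sides are 0.\<close>
    show "1 / (2 * pi * c * t) * (?g x / (x + 0) - ?g x / (x + t)) = ?g x / (2 * pi * c * x) * (1 / (x + t))"
    proof (cases "x = 0")
      case True
      then have "lo = 0" using x by auto
      then show ?thesis using True by simp
    next
      case False
      then show ?thesis using c t x0 by (simp add: field_simps)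
    qed
  qed
  have val: "1 / (2 * pi * c * t) * (pi * (1 + c + 0 - sqrt ((1 - c + 0)\<^sup>2 + 4 * c * 0)) - pi * (1 + c + t - ?S))
      = (?S - t - \<bar>1 - c\<bar>) / (2 * c * t)"
    using c t by (simp add: field_simps)
  have nn: "(\<integral>\<^sup>+x. ennreal (mp_density c x) * ennreal (indicator {0..} x * (1 / (x + t))) \<partial>lborel)
      = ennreal ((?S - t - \<bar>1 - c\<bar>) / (2 * c * t))"
    using mp_density_nn_integral[OF I] t unfolding val by simp
  have pos: "0 \<le> (?S - t - \<bar>1 - c\<bar>) / (2 * c * t)"
  proof -
    have "(t + \<bar>1 - c\<bar>)\<^sup>2 \<le> (1 - c + t)\<^sup>2 + 4 * c * t"
      using c t by (auto simp: power2_eq_square algebra_simps abs_if)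
    then have "t + \<bar>1 - c\<bar> \<le> ?S" by (rule real_le_rsqrt)
    then show ?thesis using c t by simp
  qed
  have "(\<integral>\<^sup>+x. ennreal (indicator {0..} x * (1 / (x + t))) \<partial>marchenko_pastur c)
      = ennreal (max 0 (1 - 1 / c)) * ennreal (1 / t) + ennreal ((?S - t - \<bar>1 - c\<bar>) / (2 * c * t))"
    using nn_integral_marchenko_pastur[of "\<lambda>x. ennreal (indicator {0..} x * (1 / (x + t)))" c] unfolding nn by simp
  also have "\<dots> = ennreal (max 0 (1 - 1 / c) * (1 / t) + (?S - t - \<bar>1 - c\<bar>) / (2 * c * t))"
    using t pos by (subst ennreal_plus) (simp_all add: ennreal_mult[symmetric] del: ennreal_max_0 ennreal_max_0')
  also have "max 0 (1 - 1 / c) * (1 / t) + (?S - t - \<bar>1 - c\<bar>) / (2 * c * t) = mp_stieltjes c t"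
    using c t by (auto simp: mp_stieltjes_def max_def field_simps abs_if)
  finally have fin: "(\<integral>\<^sup>+x. ennreal (indicator {0..} x * (1 / (x + t))) \<partial>marchenko_pastur c)
      = ennreal (mp_stieltjes c t)" .
  have "0 \<le> mp_stieltjes c t"
  proof -
    have "1 - c + t \<le> ?S" by (rule real_le_rsqrt) (use c t in simp)
    then show ?thesis using c t by (simp add: mp_stieltjes_def)
  qed
  moreover have "(\<integral>x. 1 / (x + t) \<partial>marchenko_pastur c) = (\<integral>x. indicator {0..} x * (1 / (x + t)) \<partial>marchenko_pastur c)"
    by (intro integral_cong_AE) (use AE_marchenko_pastur_nonneg in auto)
  moreover have "\<dots> = mp_stieltjes c t"
    by (subst integral_eq_nn_integral) (use fin t calculation(1) in \<open>auto simp: indicator_def\<close>)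
  ultimately show ?thesis by simp
qed

end

section \<open>Weak convergence from Stieltjes transforms\<close>

text \<open>The half line is mapped into the compact interval \<open>[0, 1]\<close>, with infinity
  going to 0. For \<open>u = 1 / (1 + x)\<close> one has
  \<open>1 / (x + 1 + s) = u / (1 + s u)\<close>. The maximum keeps the function bounded on the
  negative half line.\<close>

definition inv1p :: "real \<Rightarrow> real" where
  "inv1p x = 1 / (1 + max 0 x)"

lemma inv1p_bounds: "0 \<le> inv1p x" "inv1p x \<le> 1"
  by (auto simp: inv1p_def max_def)

lemma inv1p_measurable [measurable]: "inv1p \<in> borel_measurable borel"
  unfolding inv1p_def by measurable

text \<open>The truncated geometric series has the exact remainder
  \<open>(- s)^(k+1) u^(k+2) / (1 + s u)\<close>; no smallness of \<open>s\<close> is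
  involved.\<close>

lemma geometric_remainder:
  fixes s u :: real
  assumes "0 \<le> s" "0 \<le> u" "u \<le> 1"
  shows "\<bar>u / (1 + s * u) - (\<Sum>j\<le>k. (- s) ^ j * u ^ Suc j)\<bar> \<le> s ^ Suc k"
proof -
  have pos: "1 \<le> 1 + s * u" using assms by simp
  then have nz: "1 + s * u \<noteq> 0" by linarith
  have "(1 + s * u) * (\<Sum>j\<le>k. (- s) ^ j * u ^ Suc j) = u - (- s) ^ Suc k * u ^ Suc (Suc k)" for k
    by (induction k) (simp_all add: algebra_simps)
  then have "u / (1 + s * u) - (\<Sum>j\<le>k. (- s) ^ j * u ^ Suc j) = (- s) ^ Suc k * u ^ Suc (Suc k) / (1 + s * u)"
    using nz by (simp add: divide_simps) (simp add: algebra_simps)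
  also have "\<bar>\<dots>\<bar> = s ^ Suc k * (u ^ Suc (Suc k) / (1 + s * u))"
    using assms pos by (simp add: abs_mult power_abs)
  also have "\<dots> \<le> s ^ Suc k * 1"
  proof (intro mult_left_mono)
    have "u ^ Suc (Suc k) \<le> 1" using assms by (intro power_le_one) auto
    then show "u ^ Suc (Suc k) / (1 + s * u) \<le> 1" using pos by (simp add: divide_le_eq)
  qed (use assms in auto)
  finally show ?thesis by simp
qed

context
  fixes \<mu> :: "nat \<Rightarrow> real measure" and \<nu> :: "real measure"
  assumes \<mu>: "\<And>n. real_distribution (\<mu> n)" and \<nu>: "real_distribution \<nu>"
    and \<mu>0: "\<And>n. AE x in \<mu> n. 0 \<le> x" and \<nu>0: "AE x in \<nu>. 0 \<le> x"
    and conv: "\<And>t. t \<in> \<rat> \<Longrightarrow> 1 < t \<Longrightarrow> (\<lambda>n. \<integral>x. 1 / (x + t) \<partial>\<mu> n) \<longlonglongrightarrow> (\<integral>x. 1 / (x + t) \<partial>\<nu>)"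
begin

lemma stieltjes_geometric:
  assumes N: "real_distribution N" and N0: "AE x in N. 0 \<le> x" and s: "0 \<le> s"
  shows "\<bar>(\<integral>x. 1 / (x + (1 + s)) \<partial>N) - (\<Sum>j\<le>k. (- s) ^ j * (\<integral>x. inv1p x ^ Suc j \<partial>N))\<bar> \<le> s ^ Suc k"
proof -
  interpret N: real_distribution N by fact
  have int: "integrable N (\<lambda>x. inv1p x ^ j)" for j
    by (rule N.integrable_const_bound[of _ 1]) (auto intro!: power_le_one inv1p_bounds simp: inv1p_bounds)
  have int2: "integrable N (\<lambda>x. inv1p x / (1 + s * inv1p x))"
  proof (rule N.integrable_const_bound[of _ 1])
    have "\<bar>inv1p x / (1 + s * inv1p x)\<bar> \<le> 1" for x
    proof -
      have "1 \<le> 1 + s * inv1p x" using s inv1p_bounds[of x] by simp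
      then have "0 \<le> inv1p x / (1 + s * inv1p x)" "inv1p x / (1 + s * inv1p x) \<le> 1"
        using inv1p_bounds[of x] by (simp_all add: divide_le_eq)
      then show ?thesis by (subst abs_of_nonneg)
    qed
    then show "AE x in N. norm (inv1p x / (1 + s * inv1p x)) \<le> 1" by simp
  qed measurable
  have "(\<integral>x. 1 / (x + (1 + s)) \<partial>N) = (\<integral>x. inv1p x / (1 + s * inv1p x) \<partial>N)"
  proof (rule integral_cong_AE)
    show "AE x in N. 1 / (x + (1 + s)) = inv1p x / (1 + s * inv1p x)"
      using N0
    proof eventually_elim
      case (elim x)
      then show ?case using s by (simp add: inv1p_def divide_simps)
    qed
  qed measurable
  also have "\<dots> - (\<Sum>j\<le>k. (- s) ^ j * (\<integral>x. inv1p x ^ Suc j \<partial>N))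
      = (\<integral>x. inv1p x / (1 + s * inv1p x) - (\<Sum>j\<le>k. (- s) ^ j * inv1p x ^ Suc j) \<partial>N)"
    using int int2 by (subst Bochner_Integration.integral_diff) (auto simp del: power_Suc)
  also have "\<bar>\<dots>\<bar> \<le> (\<integral>x. \<bar>inv1p x / (1 + s * inv1p x) - (\<Sum>j\<le>k. (- s) ^ j * inv1p x ^ Suc j)\<bar> \<partial>N)"
    by (rule integral_abs_bound)
  also have "\<dots> \<le> (\<integral>x. s ^ Suc k \<partial>N)"
    using int int2 s
    by (intro integral_mono geometric_remainder inv1p_bounds integrable_abs Bochner_Integration.integrable_diff
        Bochner_Integration.integrable_sum integrable_mult_right) (auto simp del: power_Suc)
  finally show ?thesis using N.prob_space by simp
qed

text \<open>The Stieltjes transform at \<open>1 + s\<close> is a power series in \<open>s\<close> whose coefficients are the moments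
  of \<open>inv1p\<close>; they are recovered one after the other by letting \<open>s\<close> tend to 0.\<close>

lemma inv1p_moment_conv:
  "(\<lambda>n. \<integral>x. inv1p x ^ Suc k \<partial>\<mu> n) \<longlonglongrightarrow> (\<integral>x. inv1p x ^ Suc k \<partial>\<nu>)"
proof (induction k rule: less_induct)
  case (less k)
  define D where "D n j = (\<integral>x. inv1p x ^ Suc j \<partial>\<mu> n) - (\<integral>x. inv1p x ^ Suc j \<partial>\<nu>)" for n j
  define E where "E s n = (\<integral>x. 1 / (x + (1 + s)) \<partial>\<mu> n) - (\<integral>x. 1 / (x + (1 + s)) \<partial>\<nu>)" for s n
  have D0: "(\<lambda>n. D n j) \<longlonglongrightarrow> 0" if "j < k" for j
    unfolding D_def using less[OF that] by (rule LIM_zero)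
  have E0: "E s \<longlonglongrightarrow> 0" if "s \<in> \<rat>" "0 < s" for s
    unfolding E_def using conv[of "1 + s"] that by (intro LIM_zero) auto
  have bound: "\<bar>D n k\<bar> \<le> (\<bar>E s n\<bar> + (\<Sum>j<k. s ^ j * \<bar>D n j\<bar>)) / s ^ k + 2 * s" if s: "0 < s" for n s
  proof -
    let ?m = "\<lambda>N. \<Sum>j\<le>k. (- s) ^ j * (\<integral>x. inv1p x ^ Suc j \<partial>N)"
    have "\<bar>E s n - (?m (\<mu> n) - ?m \<nu>)\<bar> \<le> 2 * s ^ Suc k"
      using stieltjes_geometric[OF \<mu> \<mu>0, of s n k] stieltjes_geometric[OF \<nu> \<nu>0, of s k] s
      unfolding E_def by linarith
    moreover have "?m (\<mu> n) - ?m \<nu> = (\<Sum>j\<le>k. (- s) ^ j * D n j)"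
      by (simp add: D_def sum_subtractf algebra_simps)
    moreover have "\<dots> = (\<Sum>j<k. (- s) ^ j * D n j) + (- s) ^ k * D n k"
      by (simp add: lessThan_Suc_atMost[symmetric])
    moreover have "\<bar>\<Sum>j<k. (- s) ^ j * D n j\<bar> \<le> (\<Sum>j<k. s ^ j * \<bar>D n j\<bar>)"
      by (rule order_trans[OF sum_abs]) (use s in \<open>simp add: abs_mult power_abs\<close>)
    moreover have "\<bar>(- s) ^ k * D n k\<bar> = s ^ k * \<bar>D n k\<bar>"
      using s by (simp add: abs_mult power_abs)
    ultimately have "s ^ k * \<bar>D n k\<bar> \<le> \<bar>E s n\<bar> + (\<Sum>j<k. s ^ j * \<bar>D n j\<bar>) + 2 * s ^ Suc k"
      by linarith
    then show ?thesis using s by (simp add: field_simps)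
  qed
  have "(\<lambda>n. D n k) \<longlonglongrightarrow> 0"
  proof (rule tendstoI)
    fix e :: real assume e: "0 < e"
    \<comment> \<open>The order of the limits matters: \<open>s\<close> is fixed first so that the
      remainder \<open>2 s\<close> stays below \<open>e\<close>; then the other terms, even divided
      by \<open>s ^ k\<close>, vanish as \<open>n\<close> grows.\<close>
    obtain s where s: "s \<in> \<rat>" "0 < s" "s < e / 2"
      using Rats_dense_in_real[of 0 "e / 2"] e by auto
    have "(\<lambda>n. (\<bar>E s n\<bar> + (\<Sum>j<k. s ^ j * \<bar>D n j\<bar>)) / s ^ k + 2 * s) \<longlonglongrightarrow> (\<bar>0\<bar> + (\<Sum>j<k. s ^ j * \<bar>0\<bar>)) / s ^ k + 2 * s"
      using s by (intro tendsto_intros E0 D0) auto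
    then have "\<forall>\<^sub>F n in sequentially. (\<bar>E s n\<bar> + (\<Sum>j<k. s ^ j * \<bar>D n j\<bar>)) / s ^ k + 2 * s < e"
      by (rule order_tendstoD) (use s in simp)
    then show "\<forall>\<^sub>F n in sequentially. dist (D n k) 0 < e"
      by eventually_elim (use bound[OF s(2)] in \<open>simp, smt (verit)\<close>)
  qed
  then show ?case unfolding D_def by (rule LIM_zero_cancel)
qed

text \<open>Weierstrass approximation on \<open>[0, 1]\<close> extends convergence from powers to
  continuous functions. No tightness argument is involved, the range of \<open>inv1p\<close> being
  compact.\<close>

lemma inv1p_continuous_conv:
  fixes \<phi> :: "real \<Rightarrow> real"
  assumes \<phi>: "continuous_on UNIV \<phi>"
  shows "(\<lambda>n. \<integral>x. \<phi> (inv1p x) \<partial>\<mu> n) \<longlonglongrightarrow> (\<integral>x. \<phi> (inv1p x) \<partial>\<nu>)"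
proof -
  have [measurable]: "\<phi> \<in> borel_measurable borel"
    using \<phi> by (rule borel_measurable_continuous_onI)
  have int: "integrable N (\<lambda>x. inv1p x ^ j)" if "real_distribution N" for j N
  proof -
    interpret real_distribution N by fact
    show ?thesis
      by (rule integrable_const_bound[of _ 1]) (auto intro!: power_le_one inv1p_bounds simp: inv1p_bounds)
  qed
  have mom: "(\<lambda>n. \<integral>x. inv1p x ^ i \<partial>\<mu> n) \<longlonglongrightarrow> (\<integral>x. inv1p x ^ i \<partial>\<nu>)" for i
  proof (cases i)
    case 0
    then show ?thesis
      using \<mu> \<nu> by (simp add: prob_space.prob_space real_distribution_def)
  qed (simp only: inv1p_moment_conv)
  have "bounded (\<phi> ` {0..1})"
    by (intro compact_imp_bounded compact_continuous_image continuous_on_subset[OF \<phi>]) auto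
  then obtain Bd where Bd: "\<And>v. v \<in> {0..1} \<Longrightarrow> norm (\<phi> v) \<le> Bd"
    unfolding bounded_iff by blast
  have intphi: "integrable N (\<lambda>x. \<phi> (inv1p x))" if "real_distribution N" for N
  proof -
    interpret real_distribution N by fact
    show ?thesis
      by (rule integrable_const_bound[of _ Bd]) (use Bd inv1p_bounds in auto)
  qed
  show ?thesis
  proof (rule tendstoI)
    fix e :: real assume e: "0 < e"
    obtain g where g: "real_polynomial_function g" "\<And>v. v \<in> {0..1} \<Longrightarrow> \<bar>\<phi> v - g v\<bar> < e / 3"
      using Stone_Weierstrass_real_polynomial_function[of "{0..1::real}" \<phi> "e / 3"] \<phi> e
      by (auto intro: continuous_on_subset)
    obtain a k where gk: "g = (\<lambda>v. \<Sum>i\<le>k. a i * v ^ i)"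
      using g(1) unfolding real_polynomial_function_iff_sum by blast
    have gint: "integrable N (\<lambda>x. g (inv1p x))" if "real_distribution N" for N
      unfolding gk using int[OF that] by auto
    have geq: "(\<integral>x. g (inv1p x) \<partial>N) = (\<Sum>i\<le>k. a i * (\<integral>x. inv1p x ^ i \<partial>N))" if "real_distribution N" for N
      unfolding gk using int[OF that] by simp
    have gconv: "(\<lambda>n. \<integral>x. g (inv1p x) \<partial>\<mu> n) \<longlonglongrightarrow> (\<integral>x. g (inv1p x) \<partial>\<nu>)"
      unfolding geq[OF \<mu>] geq[OF \<nu>] by (intro tendsto_intros mom)
    have close: "\<bar>(\<integral>x. \<phi> (inv1p x) \<partial>N) - (\<integral>x. g (inv1p x) \<partial>N)\<bar> \<le> e / 3" if N: "real_distribution N" for N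
    proof -
      interpret real_distribution N by fact
      have "\<bar>(\<integral>x. \<phi> (inv1p x) \<partial>N) - (\<integral>x. g (inv1p x) \<partial>N)\<bar> = \<bar>\<integral>x. \<phi> (inv1p x) - g (inv1p x) \<partial>N\<bar>"
        using intphi[OF N] gint[OF N] by simp
      also have "\<dots> \<le> (\<integral>x. \<bar>\<phi> (inv1p x) - g (inv1p x)\<bar> \<partial>N)" by (rule integral_abs_bound)
      also have "\<dots> \<le> (\<integral>x. e / 3 \<partial>N)"
        using intphi[OF N] gint[OF N] g(2) inv1p_bounds by (intro integral_mono) (auto simp: less_imp_le)
      finally show ?thesis using prob_space by simp
    qed
    have "\<forall>\<^sub>F n in sequentially. dist (\<integral>x. g (inv1p x) \<partial>\<mu> n) (\<integral>x. g (inv1p x) \<partial>\<nu>) < e / 3"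
      using tendstoD[OF gconv, of "e / 3"] e by simp
    then show "\<forall>\<^sub>F n in sequentially. dist (\<integral>x. \<phi> (inv1p x) \<partial>\<mu> n) (\<integral>x. \<phi> (inv1p x) \<partial>\<nu>) < e"
    proof eventually_elim
      case (elim n)
      then show ?case using close[OF \<mu>, of n] close[OF \<nu>] unfolding dist_real_def by linarith
    qed
  qed
qed

text \<open>Continuous step functions are constant near infinity, so on the half line they are
  continuous functions of \<open>inv1p\<close>, including at the value 0 that stands for
  infinity.\<close>

lemma weak_conv_of_stieltjes: "weak_conv_m \<mu> \<nu>"
proof (rule integral_cts_step_conv_imp_weak_conv[OF \<mu> \<nu>])
  fix x y :: real assume xy: "x < y"
  \<comment> \<open>If \<open>inv1p z < \<delta>\<close> then \<open>z > 1 + |y|\<close>, where the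
    step function has already dropped to 0. Cutting \<open>v\<close> off at \<open>\<delta>\<close>
    therefore keeps \<open>1 / v - 1\<close>, the inverse of \<open>inv1p\<close>, continuous
    without changing the values that matter.\<close>
  define \<delta> where "\<delta> = 1 / (2 + \<bar>y\<bar>)"
  have \<delta>: "0 < \<delta>" by (simp add: \<delta>_def add_pos_nonneg)
  define \<phi> where "\<phi> v = cts_step x y (1 / max v \<delta> - 1)" for v
  have "continuous_on UNIV (\<lambda>v::real. 1 / max v \<delta> - 1)"
    using \<delta> by (intro continuous_intros) (auto simp: max_def)
  then have cont: "continuous_on UNIV \<phi>"
    unfolding \<phi>_def
    by (rule continuous_on_compose2[OF uniformly_continuous_imp_continuous[OF cts_step_uniformly_continuous[OF xy]]]) auto
  have eq: "\<phi> (inv1p z) = cts_step x y z" if z: "0 \<le> z" for z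
  proof (cases "\<delta> \<le> inv1p z")
    case True
    then show ?thesis using z by (simp add: \<phi>_def inv1p_def)
  next
    case False
    then have "2 + \<bar>y\<bar> < 1 + z" using z
      by (simp add: \<delta>_def inv1p_def divide_simps split: if_splits)
    then have "y \<le> z" by linarith
    moreover have "1 / max (inv1p z) \<delta> - 1 = 1 + \<bar>y\<bar>" using False by (simp add: \<delta>_def)
    ultimately show ?thesis using xy by (simp add: \<phi>_def cts_step_def)
  qed
  have [measurable]: "cts_step x y \<in> borel_measurable borel"
    unfolding cts_step_def by measurable
  have [measurable]: "\<phi> \<in> borel_measurable borel"
    using cont by (rule borel_measurable_continuous_onI)
  have int: "integral\<^sup>L N (cts_step x y) = (\<integral>z. \<phi> (inv1p z) \<partial>N)"
    if "real_distribution N" "AE x in N. 0 \<le> x" for N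
  proof -
    interpret real_distribution N by fact
    show ?thesis using that(2) by (intro integral_cong_AE) (auto simp: eq)
  qed
  show "(\<lambda>n. integral\<^sup>L (\<mu> n) (cts_step x y)) \<longlonglongrightarrow> integral\<^sup>L \<nu> (cts_step x y)"
    unfolding int[OF \<mu> \<mu>0] int[OF \<nu> \<nu>0] by (rule inv1p_continuous_conv[OF cont])
qed

end

section \<open>McDiarmid's inequality\<close>

definition bounded_differences :: "'k set \<Rightarrow> 'a measure \<Rightarrow> real \<Rightarrow> (('k \<Rightarrow> 'a) \<Rightarrow> real) \<Rightarrow> bool" where
  "bounded_differences J P c f \<longleftrightarrow>
    (\<forall>x\<in>space (PiM J (\<lambda>_. P)). \<forall>k\<in>J. \<forall>y\<in>space P. \<bar>f (x(k := y)) - f x\<bar> \<le> c)"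

lemma fun_upd_in_space_PiM:
  assumes "x \<in> space (PiM J (\<lambda>_. P))" "y \<in> space P"
  shows "x(i := y) \<in> space (PiM (insert i J) (\<lambda>_. P))"
  using assms by (auto simp: space_PiM PiE_def extensional_def)

lemma (in prob_space) Hoeffding_osc:
  fixes f :: "'a \<Rightarrow> real"
  assumes f: "f \<in> borel_measurable M" and l: "0 < l"
    and osc: "\<And>x y. x \<in> space M \<Longrightarrow> y \<in> space M \<Longrightarrow> \<bar>f x - f y\<bar> \<le> c"
  shows "(\<integral>\<^sup>+x. ennreal (exp (l * (f x - expectation f))) \<partial>M) \<le> ennreal (exp (l\<^sup>2 * c\<^sup>2 / 8))"
proof -
  define a where "a = (INF x\<in>space M. f x)"
  obtain x0 where x0: "x0 \<in> space M" using not_empty by auto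
  have bdd: "bdd_below (f ` space M)"
  proof (rule bdd_belowI2)
    show "f x0 - c \<le> f x" if "x \<in> space M" for x using osc[OF x0 that] by linarith
  qed
  have "f x \<in> {a..a + c}" if x: "x \<in> space M" for x
  proof -
    have "a \<le> f x" unfolding a_def using bdd x by (rule cINF_lower)
    moreover have "f x - c \<le> a" unfolding a_def
    proof (rule cINF_greatest)
      show "f x - c \<le> f y" if "y \<in> space M" for y using osc[OF x that] by linarith
    qed (use x0 in auto)
    ultimately show ?thesis by auto
  qed
  then interpret interval_bounded_random_variable M f a "a + c"
    using f by unfold_locales auto
  show ?thesis using Hoeffdings_lemma_nn_integral[OF l] by simp
qed

text \<open>The martingale argument as an induction on coordinates: \<open>g\<close> integrates out
  the coordinate \<open>i\<close>, and \<open>f - E f = (f - g) + (g - E g)\<close>. With the other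
  coordinates frozen, the first summand is handled by Hoeffding's lemma; the second by induction,
  since \<open>g\<close> inherits the bounded differences.\<close>

lemma bounded_differences_exp_moment:
  fixes f :: "('k \<Rightarrow> 'a) \<Rightarrow> real"
  assumes P: "prob_space P" and J: "finite J" and l: "0 < l"
    and f: "f \<in> borel_measurable (PiM J (\<lambda>_. P))"
    and B: "\<And>x. \<bar>f x\<bar> \<le> B"
    and diff: "bounded_differences J P c f"
  shows "(\<integral>\<^sup>+x. ennreal (exp (l * (f x - (\<integral>x. f x \<partial>PiM J (\<lambda>_. P))))) \<partial>PiM J (\<lambda>_. P))
    \<le> ennreal (exp (l\<^sup>2 * c\<^sup>2 * real (card J) / 8))"
  using J f B diff
proof (induction J arbitrary: f rule: finite_induct)
  case empty
  interpret P: prob_space P by fact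
  interpret product_sigma_finite "\<lambda>_. P" by unfold_locales
  show ?case by (simp add: PiM_empty nn_integral_count_space_finite lebesgue_integral_count_space_finite)
next
  case (insert i J)
  interpret P: prob_space P by fact
  interpret product_sigma_finite "\<lambda>_. P" by unfold_locales
  note f [measurable] = insert.prems(1)
  define g where "g x = (\<integral>y. f (x(i := y)) \<partial>P)" for x
  have upd [measurable]: "(\<lambda>(x, y). x(i := y)) \<in> PiM J (\<lambda>_. P) \<Otimes>\<^sub>M P \<rightarrow>\<^sub>M PiM (insert i J) (\<lambda>_. P)"
    by (rule measurable_add_dim)
  have fu [measurable]: "(\<lambda>y. f (x(i := y))) \<in> borel_measurable P" if "x \<in> space (PiM J (\<lambda>_. P))" for x
    using measurable_compose[OF measurable_component_update[OF that insert.hyps(2)] f] by (simp add: fun_upd_def)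
  have "(\<lambda>(x, y). f (x(i := y))) \<in> borel_measurable (PiM J (\<lambda>_. P) \<Otimes>\<^sub>M P)"
    using measurable_compose[OF upd f] by (simp add: case_prod_beta)
  then have g [measurable]: "g \<in> borel_measurable (PiM J (\<lambda>_. P))"
    unfolding g_def by (rule P.borel_measurable_lebesgue_integral)
  have intf: "integrable P (\<lambda>y. f (x(i := y)))" if "x \<in> space (PiM J (\<lambda>_. P))" for x
    by (rule P.integrable_const_bound[of _ B]) (use insert.prems(2) fu[OF that] in auto)
  have intF: "integrable (PiM (insert i J) (\<lambda>_. P)) f"
  proof -
    interpret Q: prob_space "PiM (insert i J) (\<lambda>_. P)" using P by (rule prob_space_PiM)
    show ?thesis by (rule Q.integrable_const_bound[of _ B]) (use insert.prems(2) in auto)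
  qed
  have Ef: "(\<integral>x. f x \<partial>PiM (insert i J) (\<lambda>_. P)) = (\<integral>x. g x \<partial>PiM J (\<lambda>_. P))"
    unfolding g_def by (rule product_integral_insert[OF insert.hyps intF])
  let ?E = "\<integral>x. g x \<partial>PiM J (\<lambda>_. P)"
  have gB: "\<bar>g x\<bar> \<le> B" for x
  proof -
    have B0: "0 \<le> B" using insert.prems(2)[of x] by linarith
    show ?thesis
    \<comment> \<open>The bound is wanted for every \<open>x\<close>, also outside the product
      space, where integrability may fail and the integral takes its default value 0.\<close>
    proof (cases "integrable P (\<lambda>y. f (x(i := y)))")
      case True
      have "\<bar>g x\<bar> \<le> (\<integral>y. \<bar>f (x(i := y))\<bar> \<partial>P)" unfolding g_def by (rule integral_abs_bound)
      also have "\<dots> \<le> (\<integral>y. B \<partial>P)"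
        using True insert.prems(2) by (intro integral_mono) auto
      finally show ?thesis by (simp add: P.prob_space)
    qed (use B0 in \<open>simp add: g_def not_integrable_integral_eq\<close>)
  qed
  have gdiff: "bounded_differences J P c g"
    unfolding bounded_differences_def
  proof (intro ballI)
    fix x k z assume x: "x \<in> space (PiM J (\<lambda>_. P))" and k: "k \<in> J" and z: "z \<in> space P"
    have xz: "x(k := z) \<in> space (PiM J (\<lambda>_. P))"
      using fun_upd_in_space_PiM[OF x z, of k] k by (simp add: insert_absorb)
    have ki: "k \<noteq> i" using k insert.hyps by auto
    have "\<bar>g (x(k := z)) - g x\<bar> = \<bar>\<integral>y. f (x(k := z, i := y)) - f (x(i := y)) \<partial>P\<bar>"
      unfolding g_def using intf[OF x] intf[OF xz] by simp
    also have "\<dots> \<le> (\<integral>y. \<bar>f (x(k := z, i := y)) - f (x(i := y))\<bar> \<partial>P)"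
      by (rule integral_abs_bound)
    also have "\<dots> \<le> (\<integral>y. c \<partial>P)"
    proof (intro integral_mono)
      fix y assume y: "y \<in> space P"
      have "x(i := y) \<in> space (PiM (insert i J) (\<lambda>_. P))" by (rule fun_upd_in_space_PiM[OF x y])
      then show "\<bar>f (x(k := z, i := y)) - f (x(i := y))\<bar> \<le> c"
        using insert.prems(3) k z ki
        by (simp add: bounded_differences_def fun_upd_twist)
    qed (use intf[OF x] intf[OF xz] in auto)
    finally show "\<bar>g (x(k := z)) - g x\<bar> \<le> c" by (simp add: P.prob_space)
  qed
  have osc: "\<bar>f (x(i := y)) - f (x(i := y'))\<bar> \<le> c"
    if "x \<in> space (PiM J (\<lambda>_. P))" "y \<in> space P" "y' \<in> space P" for x y y'
    using insert.prems(3) fun_upd_in_space_PiM[OF that(1,3), of i] that(2)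
    by (auto simp: bounded_differences_def dest!: bspec[of _ _ "x(i := y')"])
  have "(\<integral>\<^sup>+x. ennreal (exp (l * (f x - ?E))) \<partial>PiM (insert i J) (\<lambda>_. P))
      = (\<integral>\<^sup>+x. (\<integral>\<^sup>+y. ennreal (exp (l * (f (x(i := y)) - ?E))) \<partial>P) \<partial>PiM J (\<lambda>_. P))"
    by (rule product_nn_integral_insert[OF insert.hyps]) measurable
  also have "\<dots> \<le> (\<integral>\<^sup>+x. ennreal (exp (l\<^sup>2 * c\<^sup>2 / 8)) * ennreal (exp (l * (g x - ?E))) \<partial>PiM J (\<lambda>_. P))"
  proof (rule nn_integral_mono)
    fix x assume x: "x \<in> space (PiM J (\<lambda>_. P))"
    have [measurable]: "(\<lambda>y. f (x(i := y))) \<in> borel_measurable P" by (rule fu[OF x])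
    have "(\<integral>\<^sup>+y. ennreal (exp (l * (f (x(i := y)) - ?E))) \<partial>P)
        = (\<integral>\<^sup>+y. ennreal (exp (l * (f (x(i := y)) - g x))) * ennreal (exp (l * (g x - ?E))) \<partial>P)"
      by (intro nn_integral_cong) (simp add: ennreal_mult[symmetric] exp_add[symmetric] algebra_simps)
    also have "\<dots> = (\<integral>\<^sup>+y. ennreal (exp (l * (f (x(i := y)) - g x))) \<partial>P) * ennreal (exp (l * (g x - ?E)))"
      by (rule nn_integral_multc) measurable
    also have "\<dots> \<le> ennreal (exp (l\<^sup>2 * c\<^sup>2 / 8)) * ennreal (exp (l * (g x - ?E)))"
      unfolding g_def using P.Hoeffding_osc[OF fu[OF x] l osc[OF x]]
      by (intro mult_right_mono) auto
    finally show "(\<integral>\<^sup>+y. ennreal (exp (l * (f (x(i := y)) - ?E))) \<partial>P)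
        \<le> ennreal (exp (l\<^sup>2 * c\<^sup>2 / 8)) * ennreal (exp (l * (g x - ?E)))" .
  qed
  also have "\<dots> = ennreal (exp (l\<^sup>2 * c\<^sup>2 / 8)) * (\<integral>\<^sup>+x. ennreal (exp (l * (g x - ?E))) \<partial>PiM J (\<lambda>_. P))"
    by (rule nn_integral_cmult) measurable
  also have "\<dots> \<le> ennreal (exp (l\<^sup>2 * c\<^sup>2 / 8)) * ennreal (exp (l\<^sup>2 * c\<^sup>2 * real (card J) / 8))"
    by (intro mult_left_mono insert.IH g gB gdiff) auto
  also have "\<dots> = ennreal (exp (l\<^sup>2 * c\<^sup>2 * real (card (insert i J)) / 8))"
    using insert.hyps by (simp add: ennreal_mult[symmetric] exp_add[symmetric] algebra_simps add_divide_distrib)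
  finally show ?case unfolding Ef .
qed

lemma McDiarmid_inequality_ge:
  fixes f :: "('k \<Rightarrow> 'a) \<Rightarrow> real"
  assumes P: "prob_space P" and J: "finite J" "J \<noteq> {}" and c: "0 < c" and eps: "0 < eps"
    and f: "f \<in> borel_measurable (PiM J (\<lambda>_. P))"
    and B: "\<And>x. \<bar>f x\<bar> \<le> B"
    and diff: "bounded_differences J P c f"
  shows "measure (PiM J (\<lambda>_. P)) {x\<in>space (PiM J (\<lambda>_. P)). f x - (\<integral>x. f x \<partial>PiM J (\<lambda>_. P)) \<ge> eps}
    \<le> exp (- 2 * eps\<^sup>2 / (real (card J) * c\<^sup>2))"
proof -
  let ?Q = "PiM J (\<lambda>_. P)"
  interpret Q: prob_space ?Q using P by (rule prob_space_PiM)
  note f [measurable]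
  define E where "E = (\<integral>x. f x \<partial>?Q)"
  define N where "N = real (card J)"
  have N: "0 < N" using J by (simp add: N_def card_gt_0_iff)
  \<comment> \<open>The minimiser of the Chernoff exponent
    \<open>- l eps + l^2 c^2 N / 8\<close>.\<close>
  define l where "l = 4 * eps / (N * c\<^sup>2)"
  have l: "0 < l" using N c eps by (simp add: l_def)
  have "ennreal (measure ?Q {x\<in>space ?Q. f x - E \<ge> eps}) = emeasure ?Q {x\<in>space ?Q. f x - E \<ge> eps}"
    by (simp add: Q.emeasure_eq_measure)
  also have "\<dots> = (\<integral>\<^sup>+x. indicator {x\<in>space ?Q. f x - E \<ge> eps} x \<partial>?Q)"
    by (rule nn_integral_indicator[symmetric]) measurable
  also have "\<dots> \<le> (\<integral>\<^sup>+x. ennreal (exp (- l * eps)) * ennreal (exp (l * (f x - E))) \<partial>?Q)"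
  proof (intro nn_integral_mono)
    fix x assume "x \<in> space ?Q"
    have "1 \<le> exp (- l * eps) * exp (l * (f x - E))" if "f x - E \<ge> eps"
    proof -
      have "0 \<le> l * ((f x - E) - eps)" using l that by simp
      then show ?thesis by (simp add: exp_add[symmetric] algebra_simps)
    qed
    then show "indicator {x\<in>space ?Q. f x - E \<ge> eps} x
        \<le> ennreal (exp (- l * eps)) * ennreal (exp (l * (f x - E)))"
      by (auto simp: indicator_def ennreal_mult[symmetric])
  qed
  also have "\<dots> = ennreal (exp (- l * eps)) * (\<integral>\<^sup>+x. ennreal (exp (l * (f x - E))) \<partial>?Q)"
    by (rule nn_integral_cmult) measurable
  also have "\<dots> \<le> ennreal (exp (- l * eps)) * ennreal (exp (l\<^sup>2 * c\<^sup>2 * N / 8))"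
    unfolding E_def N_def
    by (intro mult_left_mono bounded_differences_exp_moment[OF P J(1) l f B diff]) auto
  also have "\<dots> = ennreal (exp (- 2 * eps\<^sup>2 / (N * c\<^sup>2)))"
  proof -
    have "- l * eps + l\<^sup>2 * c\<^sup>2 * N / 8 = - 2 * eps\<^sup>2 / (N * c\<^sup>2)"
      unfolding l_def using N c by (simp add: field_simps power2_eq_square)
    then show ?thesis by (simp add: ennreal_mult[symmetric] exp_add[symmetric])
  qed
  finally show ?thesis by (simp add: E_def N_def)
qed

lemma McDiarmid_inequality:
  fixes f :: "('k \<Rightarrow> 'a) \<Rightarrow> real"
  assumes P: "prob_space P" and J: "finite J" "J \<noteq> {}" and c: "0 < c" and eps: "0 < eps"
    and f: "f \<in> borel_measurable (PiM J (\<lambda>_. P))"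
    and B: "\<And>x. \<bar>f x\<bar> \<le> B"
    and diff: "bounded_differences J P c f"
  shows "measure (PiM J (\<lambda>_. P)) {x\<in>space (PiM J (\<lambda>_. P)). \<bar>f x - (\<integral>x. f x \<partial>PiM J (\<lambda>_. P))\<bar> \<ge> eps}
    \<le> 2 * exp (- 2 * eps\<^sup>2 / (real (card J) * c\<^sup>2))"
proof -
  let ?Q = "PiM J (\<lambda>_. P)"
  interpret Q: prob_space ?Q using P by (rule prob_space_PiM)
  note f [measurable]
  have diff': "bounded_differences J P c (\<lambda>x. - f x)"
    using diff by (auto simp: bounded_differences_def abs_minus_commute)
  have "{x\<in>space ?Q. \<bar>f x - (\<integral>x. f x \<partial>?Q)\<bar> \<ge> eps}
      = {x\<in>space ?Q. f x - (\<integral>x. f x \<partial>?Q) \<ge> eps} \<union> {x\<in>space ?Q. - f x - (\<integral>x. - f x \<partial>?Q) \<ge> eps}"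
    by auto
  also have "measure ?Q \<dots> \<le> measure ?Q {x\<in>space ?Q. f x - (\<integral>x. f x \<partial>?Q) \<ge> eps}
      + measure ?Q {x\<in>space ?Q. - f x - (\<integral>x. - f x \<partial>?Q) \<ge> eps}"
    by (intro measure_subadditive) (auto simp: Q.emeasure_eq_measure)
  also have "\<dots> \<le> 2 * exp (- 2 * eps\<^sup>2 / (real (card J) * c\<^sup>2))"
    using McDiarmid_inequality_ge[OF P J c eps f B diff]
      McDiarmid_inequality_ge[OF P J c eps borel_measurable_uminus[OF f] _ diff', of B] B
    by simp
  finally show ?thesis .
qed

section \<open>Leave-one-out analysis of the resolvent\<close>

lemma saturation_lipschitz:
  fixes x y :: real
  assumes "0 \<le> x" "0 \<le> y"
  shows "\<bar>x / (1 + x) - y / (1 + y)\<bar> \<le> \<bar>x - y\<bar>"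
proof -
  have "x / (1 + x) - y / (1 + y) = (x - y) / ((1 + x) * (1 + y))"
    using assms by (simp add: field_simps)
  also have "\<bar>\<dots>\<bar> = \<bar>x - y\<bar> / ((1 + x) * (1 + y))"
    using assms by simp
  also have "\<dots> \<le> \<bar>x - y\<bar> / 1"
    using assms by (intro divide_left_mono) (auto simp: algebra_simps add_pos_nonneg)
  finally show ?thesis by simp
qed

definition sample_trace :: "'i set \<Rightarrow> real \<Rightarrow> nat \<Rightarrow> (nat \<Rightarrow> 'i \<Rightarrow> real) \<Rightarrow> real" where
  "sample_trace I t m x = tr I (res I t (1 / real m) (map x [1..<Suc m])) / real (card I)"

context
  fixes I :: "'i set" and t :: real and m :: nat and J :: "nat set" and P :: "('i \<Rightarrow> real) measure"
  assumes I: "finite I" "I \<noteq> {}" and t: "0 < t" and m: "1 \<le> m" and J: "J = {1..m}"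
    and P: "prob_space P" and setsP: "sets P = sets (PiM I (\<lambda>_. borel))"
begin

abbreviation "others k \<equiv> remove1 k [1..<Suc m]"
abbreviation "Q \<equiv> PiM J (\<lambda>_. P)"
abbreviation "wt \<equiv> 1 / real m"
abbreviation "dimI \<equiv> real (card I)"
abbreviation "R_all x \<equiv> res I t wt (map x [1..<Suc m])"
abbreviation "R_out x k \<equiv> res I t wt (map x (others k))"
abbreviation "tail e \<equiv> exp (- 2 * e\<^sup>2 * t\<^sup>2 * dimI\<^sup>2 / real m)"

lemma finJ: "finite J"
  by (simp add: J)

lemma w_nonneg: "0 \<le> wt"
  by simp

lemma mset_others: "k \<in> J \<Longrightarrow> mset (map x [1..<Suc m]) = mset (x k # map x (others k))"
proof -
  assume "k \<in> J"
  then have "mset [1..<Suc m] = add_mset k (mset (others k))"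
    using J by (simp del: upt_Suc)
  then show ?thesis by (simp del: upt_Suc mset_remove1)
qed

lemma set_others: "set (others k) = J - {k}"
  using J by (subst set_remove1_eq) (auto simp del: upt_Suc)

lemma map_upd_others: "map (x(k := y)) (others k) = map x (others k)"
  by (intro map_cong refl) (use set_others in auto)

lemma entry_measurable:
  assumes "k \<in> H" "a \<in> I"
  shows "(\<lambda>x. x k a) \<in> borel_measurable (PiM H (\<lambda>_. P))"
proof -
  have "(\<lambda>v. v a) \<in> borel_measurable P"
    unfolding measurable_cong_sets[OF setsP refl] using assms by measurable
  moreover have "(\<lambda>x. x k) \<in> PiM H (\<lambda>_. P) \<rightarrow>\<^sub>M P" using assms by measurable
  ultimately show ?thesis by (rule measurable_compose[rotated])
qed

lemma res_measurable:
  assumes "set ks \<subseteq> H" "a \<in> I" "b \<in> I"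
  shows "(\<lambda>x. res I t wt (map x ks) a b) \<in> borel_measurable (PiM H (\<lambda>_. P))"
  using assms
proof (induction ks arbitrary: a b)
  case (Cons k ks)
  have R: "(\<lambda>x. res I t wt (map x ks) a b) \<in> borel_measurable (PiM H (\<lambda>_. P))"
    if "a \<in> I" "b \<in> I" for a b using Cons that by auto
  have v: "(\<lambda>x. x k a) \<in> borel_measurable (PiM H (\<lambda>_. P))" if "a \<in> I" for a
    using Cons.prems that by (intro entry_measurable) auto
  show ?case unfolding list.map res.simps app_def quad_def
    by (intro borel_measurable_sum borel_measurable_times borel_measurable_add borel_measurable_diff
        borel_measurable_divide borel_measurable_const R v Cons.prems)
qed simp

lemma quad_res_measurable:
  assumes "set ks \<subseteq> H" "k \<in> H"
  shows "(\<lambda>x. quad I (res I t wt (map x ks)) (x k)) \<in> borel_measurable (PiM H (\<lambda>_. P))"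
  unfolding quad_def
  by (intro borel_measurable_sum borel_measurable_times res_measurable entry_measurable assms)

lemma tr_res_measurable:
  assumes "set ks \<subseteq> H"
  shows "(\<lambda>x. tr I (res I t wt (map x ks))) \<in> borel_measurable (PiM H (\<lambda>_. P))"
  unfolding tr_def by (intro borel_measurable_sum res_measurable assms)

lemma sample_trace_measurable [measurable]: "sample_trace I t m \<in> borel_measurable Q"
proof -
  have "(\<lambda>x. tr I (R_all x) / dimI) \<in> borel_measurable Q"
    by (intro borel_measurable_divide tr_res_measurable borel_measurable_const) (auto simp: J simp del: upt_Suc)
  then show ?thesis unfolding sample_trace_def[abs_def] .
qed

lemma cardI: "0 < dimI"
  using I by (simp add: card_gt_0_iff)

lemma sample_trace_bounds: "0 \<le> sample_trace I t m x" "sample_trace I t m x \<le> 1 / t"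
proof -
  let ?T = "tr I (R_all x)"
  have "0 \<le> ?T" "?T \<le> dimI / t" using tr_res_bounds[OF I(1) t w_nonneg] by blast+
  then show "0 \<le> sample_trace I t m x" "sample_trace I t m x \<le> 1 / t"
    unfolding sample_trace_def using cardI t by (simp_all add: divide_simps ac_simps del: upt_Suc)
qed

lemma tr_leave_one_out:
  assumes "k \<in> J"
  shows "tr I (R_all x) \<le> tr I (R_out x k)"
    "tr I (R_out x k) \<le> tr I (R_all x) + 1 / t"
  unfolding tr_res_perm[OF I(1) t w_nonneg mset_others[OF assms]]
  by (rule tr_res_Cons[OF I(1) t w_nonneg])+

text \<open>Before and after the replacement of one sample the trace lies in the same interval of
  length \<open>1 / t\<close>, whose right end is the trace of the resolvent without that
  sample.\<close>

lemma sample_trace_bounded_differences: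
  "bounded_differences J P (1 / (t * dimI)) (sample_trace I t m)"
  unfolding bounded_differences_def
proof (intro ballI)
  fix x k y assume k: "k \<in> J"
  have "\<bar>tr I (res I t wt (map (x(k := y)) [1..<Suc m])) - tr I (R_all x)\<bar> \<le> 1 / t"
    using tr_leave_one_out[OF k, of x] tr_leave_one_out[OF k, of "x(k := y)"]
    unfolding map_upd_others by linarith
  then have "\<bar>tr I (res I t wt (map (x(k := y)) [1..<Suc m])) - tr I (R_all x)\<bar> / dimI \<le> 1 / t / dimI"
    using cardI by (intro divide_right_mono) auto
  then show "\<bar>sample_trace I t m (x(k := y)) - sample_trace I t m x\<bar> \<le> 1 / (t * dimI)"
    unfolding sample_trace_def diff_divide_distrib[symmetric] by simp
qed

text \<open>There are \<open>m\<close> coordinates with differences \<open>1 / (t p)\<close>, whence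
  the exponent \<open>2 eps^2 t^2 p^2 / m\<close>; it is of order \<open>p\<close> as long as
  \<open>p / m\<close> stays away from 0.\<close>

lemma sample_trace_tail:
  assumes eps: "0 < eps"
  shows "measure Q {x\<in>space Q. eps \<le> \<bar>sample_trace I t m x - (\<integral>x. sample_trace I t m x \<partial>Q)\<bar>}
    \<le> 2 * tail eps"
proof -
  have "measure Q {x\<in>space Q. eps \<le> \<bar>sample_trace I t m x - (\<integral>x. sample_trace I t m x \<partial>Q)\<bar>}
    \<le> 2 * exp (- 2 * eps\<^sup>2 / (real (card J) * (1 / (t * dimI))\<^sup>2))"
  proof (rule McDiarmid_inequality[OF P _ _ _ eps])
    show "\<bar>sample_trace I t m x\<bar> \<le> 1 / t" for x using sample_trace_bounds[of x] by simp
  qed (use m t cardI sample_trace_bounded_differences J sample_trace_measurable in \<open>auto simp del: One_nat_def\<close>)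
  also have "- 2 * eps\<^sup>2 / (real (card J) * (1 / (t * dimI))\<^sup>2) = - 2 * eps\<^sup>2 * t\<^sup>2 * dimI\<^sup>2 / real m"
    by (simp add: J power_divide power_mult_distrib)
  finally show ?thesis .
qed

text \<open>The deviation is below \<open>eps\<close> off an event of small probability, and never
  exceeds \<open>1 / t\<close> because the trace and its mean both lie in
  \<open>[0, 1 / t]\<close>.\<close>

lemma sample_trace_mean_dev:
  assumes eps: "0 < eps"
  shows "(\<integral>x. \<bar>sample_trace I t m x - (\<integral>x. sample_trace I t m x \<partial>Q)\<bar> \<partial>Q)
    \<le> eps + 2 / t * tail eps"
proof -
  interpret Q: prob_space Q using P by (rule prob_space_PiM)
  let ?F = "sample_trace I t m" let ?s = "\<integral>x. ?F x \<partial>Q"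
  let ?A = "{x\<in>space Q. eps \<le> \<bar>?F x - ?s\<bar>}"
  have intF: "integrable Q ?F"
    by (rule Q.integrable_const_bound[of _ "1 / t"]) (use sample_trace_bounds in auto)
  have s: "0 \<le> ?s" "?s \<le> 1 / t"
    using integral_mono[OF intF _ sample_trace_bounds(2)]
    by (auto simp: sample_trace_bounds Q.prob_space)
  have A: "?A \<in> sets Q" by measurable
  have "(\<integral>x. \<bar>?F x - ?s\<bar> \<partial>Q) \<le> (\<integral>x. eps + 1 / t * indicator ?A x \<partial>Q)"
  proof (rule integral_mono)
    show "integrable Q (\<lambda>x. eps + 1 / t * indicator ?A x)"
      using A by (intro Bochner_Integration.integrable_add integrable_mult_right) (auto simp: Q.emeasure_eq_measure)
    fix x assume x: "x \<in> space Q"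
    have "\<bar>?F x - ?s\<bar> \<le> 1 / t" using sample_trace_bounds[of x] s by linarith
    then show "\<bar>?F x - ?s\<bar> \<le> eps + 1 / t * indicator ?A x"
      using x eps by (auto simp: indicator_def)
  qed (use intF in auto)
  also have "\<dots> = eps + 1 / t * measure Q ?A"
    using A by (subst Bochner_Integration.integral_add) (auto simp: Q.emeasure_eq_measure Q.prob_space)
  also have "\<dots> \<le> eps + 1 / t * (2 * tail eps)"
    using t by (intro add_left_mono mult_left_mono sample_trace_tail eps) auto
  finally show ?thesis by simp
qed

text \<open>Integrate over the \<open>k\<close>-th sample first: with all other samples frozen,
  \<open>R_out x k\<close> is a fixed matrix that satisfies the two conditions of the hypothesis on
  quadratic forms.\<close>

lemma leave_one_out_quad:
  assumes k: "k \<in> J"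
    and quad: "\<And>A. (\<And>a. a \<in> I \<Longrightarrow> \<bar>A a a\<bar> \<le> 1 / t) \<Longrightarrow> (\<Sum>a\<in>I. \<Sum>b\<in>I. (A a b)\<^sup>2) \<le> dimI / t\<^sup>2
      \<Longrightarrow> (\<integral>\<^sup>+v. ennreal \<bar>quad I A v - tr I A\<bar> \<partial>P) \<le> ennreal (dimI * \<eta>)"
    and \<eta>: "0 \<le> \<eta>"
  defines "f \<equiv> \<lambda>x. wt * \<bar>quad I (R_out x k) (x k) - tr I (R_out x k)\<bar>"
  shows "integrable Q f" "(\<integral>x. f x \<partial>Q) \<le> wt * dimI * \<eta>"
proof -
  interpret P: prob_space P by (rule P)
  interpret product_sigma_finite "\<lambda>_. P" by unfold_locales
  let ?J = "J - {k}"
  interpret J: prob_space "PiM ?J (\<lambda>_. P)" using P by (rule prob_space_PiM)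
  have ins: "insert k ?J = J" using k by auto
  have sub: "set (others k) \<subseteq> J" using set_others by auto
  have fm [measurable]: "f \<in> borel_measurable Q" unfolding f_def
    by (intro borel_measurable_times borel_measurable_const borel_measurable_abs borel_measurable_diff
        quad_res_measurable tr_res_measurable sub k)
  have "(\<integral>\<^sup>+x. ennreal (f x) \<partial>Q) = (\<integral>\<^sup>+x. (\<integral>\<^sup>+y. ennreal (f (x(k := y))) \<partial>P) \<partial>PiM ?J (\<lambda>_. P))"
    using product_nn_integral_insert[of ?J k "\<lambda>x. ennreal (f x)"] unfolding ins using finJ by simp
  also have "\<dots> \<le> (\<integral>\<^sup>+x. ennreal (wt * dimI * \<eta>) \<partial>PiM ?J (\<lambda>_. P))"
  proof (rule nn_integral_mono)
    fix x assume x: "x \<in> space (PiM ?J (\<lambda>_. P))"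
    let ?R = "R_out x k"
    have upd: "f (x(k := y)) = wt * \<bar>quad I ?R y - tr I ?R\<bar>" for y
      unfolding f_def map_upd_others by simp
    have meas: "(\<lambda>v. \<bar>quad I ?R v - tr I ?R\<bar>) \<in> borel_measurable P"
      unfolding quad_def measurable_cong_sets[OF setsP refl] by measurable
    have "(\<integral>\<^sup>+y. ennreal (f (x(k := y))) \<partial>P) = (\<integral>\<^sup>+y. ennreal wt * ennreal \<bar>quad I ?R y - tr I ?R\<bar> \<partial>P)"
      unfolding upd by (intro nn_integral_cong) (simp add: ennreal_mult[symmetric])
    also have "\<dots> = ennreal wt * (\<integral>\<^sup>+y. ennreal \<bar>quad I ?R y - tr I ?R\<bar> \<partial>P)"
      using meas by (intro nn_integral_cmult) auto
    also have "\<dots> \<le> ennreal wt * ennreal (dimI * \<eta>)"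
    proof (intro mult_left_mono quad)
      show "\<bar>?R a a\<bar> \<le> 1 / t" if "a \<in> I" for a
        using res_diag[OF I(1) t w_nonneg that] by (simp add: abs_of_nonneg del: upt_Suc)
      show "(\<Sum>a\<in>I. \<Sum>b\<in>I. (?R a b)\<^sup>2) \<le> dimI / t\<^sup>2"
        by (rule res_frobenius[OF I(1) t w_nonneg])
    qed simp
    also have "\<dots> = ennreal (wt * dimI * \<eta>)" using \<eta> by (simp add: ennreal_mult[symmetric])
    finally show "(\<integral>\<^sup>+y. ennreal (f (x(k := y))) \<partial>P) \<le> ennreal (wt * dimI * \<eta>)" .
  qed
  also have "\<dots> = ennreal (wt * dimI * \<eta>)" by (simp add: J.emeasure_space_1)
  finally have *: "(\<integral>\<^sup>+x. ennreal (f x) \<partial>Q) \<le> ennreal (wt * dimI * \<eta>)" .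
  have f0: "0 \<le> f x" for x by (simp add: f_def)
  show "integrable Q f"
    by (rule integrableI_nonneg[OF fm]) (use f0 * in \<open>auto intro: le_less_trans\<close>)
  show "(\<integral>x. f x \<partial>Q) \<le> wt * dimI * \<eta>"
    using * f0 \<eta> by (subst integral_eq_nn_integral) (auto intro!: enn2real_leI)
qed

text \<open>Since \<open>q / (1 + q)\<close> is 1-Lipschitz, each \<open>q_k\<close> in the trace
  identity may be replaced by the deterministic \<open>p \<sigma> / m\<close>. The three errors are
  the deviation of the form from its trace (\<open>\<eta>\<close>), the effect of removing one
  sample (\<open>1 / (t p)\<close>), and the fluctuation of the trace around its mean.\<close>

lemma sample_trace_mean_equation:
  assumes quad: "\<And>A. (\<And>a. a \<in> I \<Longrightarrow> \<bar>A a a\<bar> \<le> 1 / t) \<Longrightarrow> (\<Sum>a\<in>I. \<Sum>b\<in>I. (A a b)\<^sup>2) \<le> dimI / t\<^sup>2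
      \<Longrightarrow> (\<integral>\<^sup>+v. ennreal \<bar>quad I A v - tr I A\<bar> \<partial>P) \<le> ennreal (dimI * \<eta>)"
    and \<eta>: "0 \<le> \<eta>" and eps: "0 < eps"
  defines "\<sigma> \<equiv> \<integral>x. sample_trace I t m x \<partial>Q"
  shows "0 \<le> \<sigma>" "\<sigma> \<le> 1 / t"
    "\<bar>1 - t * \<sigma> - \<sigma> / (1 + dimI / real m * \<sigma>)\<bar>
      \<le> \<eta> + 1 / (t * dimI) + (eps + 2 / t * tail eps)"
proof -
  interpret Q: prob_space Q using P by (rule prob_space_PiM)
  let ?F = "sample_trace I t m"
  have intF: "integrable Q ?F"
    by (rule Q.integrable_const_bound[of _ "1 / t"]) (use sample_trace_bounds in auto)
  show s0: "0 \<le> \<sigma>" and "\<sigma> \<le> 1 / t"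
    using integral_mono[OF intF _ sample_trace_bounds(2)]
    by (auto simp: sample_trace_bounds Q.prob_space \<sigma>_def)
  define f where "f k x = wt * \<bar>quad I (R_out x k) (x k) - tr I (R_out x k)\<bar>" for k x
  have f: "integrable Q (f k)" "(\<integral>x. f k x \<partial>Q) \<le> wt * dimI * \<eta>" if "k \<in> J" for k
    using leave_one_out_quad[OF that quad \<eta>] unfolding f_def by auto
  define \<phi> where "\<phi> q = q / (1 + q)" for q :: real
  have \<phi>: "\<bar>\<phi> a - \<phi> b\<bar> \<le> \<bar>a - b\<bar>" if "0 \<le> a" "0 \<le> b" for a b
    unfolding \<phi>_def using that by (rule saturation_lipschitz)
  have mw: "real m * wt = 1" using m by simp
  have cardJ: "card J = m" using J by simp
  have det: "\<bar>dimI * (1 - t * ?F x) - real m * \<phi> (wt * dimI * \<sigma>)\<bar> \<le> (\<Sum>k\<in>J. f k x) + 1 / t + dimI * \<bar>?F x - \<sigma>\<bar>" for x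
  proof -
    define T where "T = tr I (R_all x)"
    have T: "T = dimI * ?F x" unfolding T_def sample_trace_def using cardI by simp
    define q where "q k = wt * quad I (R_out x k) (x k)" for k
    have tri: "\<bar>a + b + e\<bar> \<le> \<bar>a\<bar> + \<bar>b\<bar> + \<bar>e\<bar>" for a b e :: real by linarith
    have q0: "0 \<le> q k" for k unfolding q_def using res_quad_nonneg[OF I(1) t w_nonneg] by simp
    have T0: "0 \<le> T" unfolding T_def using tr_res_bounds[OF I(1) t w_nonneg] by blast
    have qk: "wt * quad I (R_all x) (x k) = \<phi> (q k)" if k: "k \<in> J" for k
    proof -
      have "quad I (R_all x) (x k) = quad I (res I t wt (x k # map x (others k))) (x k)"
        unfolding quad_def
        by (intro sum.cong refl arg_cong2[where f=times] res_perm[OF I(1) t w_nonneg mset_others[OF k]])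
      then show ?thesis
        using quad_res_Cons[OF I(1) t w_nonneg, where vs = "map x (others k)" and v = "x k"]
        by (simp add: \<phi>_def q_def del: upt_Suc)
    qed
    have "t * T + (\<Sum>v\<leftarrow>map x [1..<Suc m]. wt * quad I (R_all x) v) = dimI"
      unfolding T_def by (rule tr_res_identity[OF I(1) t w_nonneg])
    also have "(\<Sum>v\<leftarrow>map x [1..<Suc m]. wt * quad I (R_all x) v)
        = (\<Sum>k\<in>J. wt * quad I (R_all x) (x k))"
      by (simp add: J interv_sum_list_conv_sum_set_nat o_def atLeastLessThanSuc_atLeastAtMost del: upt_Suc)
    also have "\<dots> = (\<Sum>k\<in>J. \<phi> (q k))" using qk by (intro sum.cong) auto
    finally have "dimI - t * T - real m * \<phi> (wt * dimI * \<sigma>) = (\<Sum>k\<in>J. \<phi> (q k) - \<phi> (wt * dimI * \<sigma>))"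
      by (simp add: sum_subtractf cardJ)
    also have "\<bar>\<dots>\<bar> \<le> (\<Sum>k\<in>J. \<bar>\<phi> (q k) - \<phi> (wt * dimI * \<sigma>)\<bar>)" by (rule sum_abs)
    also have "\<dots> \<le> (\<Sum>k\<in>J. f k x + wt / t + wt * dimI * \<bar>?F x - \<sigma>\<bar>)"
    proof (rule sum_mono)
      fix k assume k: "k \<in> J"
      let ?Tk = "tr I (R_out x k)"
      have "\<bar>\<phi> (q k) - \<phi> (wt * dimI * \<sigma>)\<bar> \<le> \<bar>q k - wt * dimI * \<sigma>\<bar>"
        using q0 s0 by (intro \<phi>) auto
      also have "\<dots> = \<bar>(q k - wt * ?Tk) + wt * (?Tk - T) + wt * dimI * (?F x - \<sigma>)\<bar>"
        by (simp add: T algebra_simps)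
      also have "\<dots> \<le> \<bar>q k - wt * ?Tk\<bar> + \<bar>wt * (?Tk - T)\<bar> + \<bar>wt * dimI * (?F x - \<sigma>)\<bar>"
        by (rule tri)
      also have "\<bar>q k - wt * ?Tk\<bar> = f k x"
        unfolding f_def q_def right_diff_distrib[symmetric] by (simp add: abs_mult del: upt_Suc)
      also have "\<bar>wt * (?Tk - T)\<bar> \<le> wt * (1 / t)"
        using tr_leave_one_out[OF k, of x] unfolding abs_mult T_def
        by (intro mult_mono) auto
      also have "\<bar>wt * dimI * (?F x - \<sigma>)\<bar> = wt * dimI * \<bar>?F x - \<sigma>\<bar>" by (simp add: abs_mult)
      finally show "\<bar>\<phi> (q k) - \<phi> (wt * dimI * \<sigma>)\<bar> \<le> f k x + wt / t + wt * dimI * \<bar>?F x - \<sigma>\<bar>" by simp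
    qed
    also have "\<dots> = (\<Sum>k\<in>J. f k x) + real m * wt / t + real m * wt * dimI * \<bar>?F x - \<sigma>\<bar>"
      by (simp add: sum.distrib cardJ)
    finally show ?thesis unfolding mw by (simp add: T algebra_simps)
  qed
  have intdev: "integrable Q (\<lambda>x. \<bar>?F x - \<sigma>\<bar>)" using intF by auto
  have sumf: "integrable Q (\<lambda>x. \<Sum>k\<in>J. f k x)"
    by (rule Bochner_Integration.integrable_sum) (rule f(1))
  have lhs: "integrable Q (\<lambda>x. \<bar>dimI * (1 - t * ?F x) - real m * \<phi> (wt * dimI * \<sigma>)\<bar>)"
    by (intro integrable_abs Bochner_Integration.integrable_diff integrable_mult_right Q.integrable_const intF)
  have rhs: "integrable Q (\<lambda>x. (\<Sum>k\<in>J. f k x) + 1 / t + dimI * \<bar>?F x - \<sigma>\<bar>)"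
    by (intro Bochner_Integration.integrable_add sumf Q.integrable_const integrable_mult_right intdev)
  have e: "dimI * (1 - t * \<sigma>) - real m * \<phi> (wt * dimI * \<sigma>) = (\<integral>x. dimI * (1 - t * ?F x) - real m * \<phi> (wt * dimI * \<sigma>) \<partial>Q)"
    using intF by (simp add: Q.prob_space \<sigma>_def)
  have e1: "(\<integral>x. (\<Sum>k\<in>J. f k x) + 1 / t + dimI * \<bar>?F x - \<sigma>\<bar> \<partial>Q) = (\<integral>x. (\<Sum>k\<in>J. f k x) + 1 / t \<partial>Q) + (\<integral>x. dimI * \<bar>?F x - \<sigma>\<bar> \<partial>Q)"
    by (rule Bochner_Integration.integral_add)
       (intro Bochner_Integration.integrable_add sumf Q.integrable_const integrable_mult_right intdev)+
  have e2: "(\<integral>x. (\<Sum>k\<in>J. f k x) + 1 / t \<partial>Q) = (\<integral>x. (\<Sum>k\<in>J. f k x) \<partial>Q) + (\<integral>x. 1 / t \<partial>Q)"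
    by (rule Bochner_Integration.integral_add) (intro sumf Q.integrable_const)+
  have e3: "(\<integral>x. (\<Sum>k\<in>J. f k x) \<partial>Q) = (\<Sum>k\<in>J. \<integral>x. f k x \<partial>Q)"
    by (rule Bochner_Integration.integral_sum) (rule f(1))
  have e4: "(\<integral>x. 1 / t \<partial>Q) = 1 / t"
    by (simp only: lebesgue_integral_const Q.prob_space scaleR_one)
  have e5: "(\<integral>x. dimI * \<bar>?F x - \<sigma>\<bar> \<partial>Q) = dimI * (\<integral>x. \<bar>?F x - \<sigma>\<bar> \<partial>Q)"
    by (rule integral_mult_right_zero)
  have "\<bar>dimI * (1 - t * \<sigma>) - real m * \<phi> (wt * dimI * \<sigma>)\<bar> \<le> (\<integral>x. \<bar>dimI * (1 - t * ?F x) - real m * \<phi> (wt * dimI * \<sigma>)\<bar> \<partial>Q)"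
    unfolding e by (rule integral_abs_bound)
  also have "\<dots> \<le> (\<integral>x. (\<Sum>k\<in>J. f k x) + 1 / t + dimI * \<bar>?F x - \<sigma>\<bar> \<partial>Q)"
    by (rule integral_mono[OF lhs rhs det])
  also have "\<dots> = (\<Sum>k\<in>J. \<integral>x. f k x \<partial>Q) + 1 / t + dimI * (\<integral>x. \<bar>?F x - \<sigma>\<bar> \<partial>Q)"
    unfolding e1 e2 e3 e4 e5 ..
  also have "\<dots> \<le> (\<Sum>k\<in>J. wt * dimI * \<eta>) + 1 / t
      + dimI * (eps + 2 / t * tail eps)"
    unfolding \<sigma>_def using f(2) cardI
    by (intro add_mono sum_mono mult_left_mono sample_trace_mean_dev eps) auto
  also have "\<dots> = dimI * \<eta> + 1 / t + dimI * (eps + 2 / t * tail eps)"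
    using m by (simp add: cardJ)
  finally have "\<bar>dimI * (1 - t * \<sigma>) - real m * \<phi> (wt * dimI * \<sigma>)\<bar> / dimI
      \<le> (dimI * \<eta> + 1 / t + dimI * (eps + 2 / t * tail eps)) / dimI"
    using cardI by (intro divide_right_mono) auto
  also have "\<dots> = \<eta> + 1 / (t * dimI) + (eps + 2 / t * tail eps)"
    using cardI by (simp add: add_divide_distrib)
  finally have fin: "\<bar>dimI * (1 - t * \<sigma>) - real m * \<phi> (wt * dimI * \<sigma>)\<bar> / dimI
      \<le> \<eta> + 1 / (t * dimI) + (eps + 2 / t * tail eps)" .
  \<comment> \<open>Because \<open>m \<phi>(p \<sigma> / m) / p = \<sigma> / (1 + p \<sigma> /
    m)\<close>.\<close>
  have "1 - t * \<sigma> - \<sigma> / (1 + dimI / real m * \<sigma>) = (dimI * (1 - t * \<sigma>) - real m * \<phi> (wt * dimI * \<sigma>)) / dimI"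
    using cardI m by (simp add: \<phi>_def diff_divide_distrib)
  then have "\<bar>1 - t * \<sigma> - \<sigma> / (1 + dimI / real m * \<sigma>)\<bar> = \<bar>dimI * (1 - t * \<sigma>) - real m * \<phi> (wt * dimI * \<sigma>)\<bar> / dimI"
    using cardI by (simp only: abs_divide abs_of_pos)
  then show "\<bar>1 - t * \<sigma> - \<sigma> / (1 + dimI / real m * \<sigma>)\<bar>
      \<le> \<eta> + 1 / (t * dimI) + (eps + 2 / t * tail eps)"
    using fin by (simp only:)
qed

end

section \<open>Moments of exchangeable unconditional vectors\<close>

text \<open>The quotient of the two binomials is the product of \<open>(d - i) / (n - i)\<close>
  over \<open>i < j\<close>, and each factor is at most \<open>d / n\<close> because
  \<open>d <= n\<close>.\<close>

lemma binomial_shift_le: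
  assumes "j \<le> d" "d \<le> n" "1 \<le> d"
  shows "real ((n - j) choose (d - j)) \<le> real (n choose d) * (real d / real n) ^ j"
  using assms(1)
proof (induction j)
  case (Suc j)
  have j: "j < d" and jn: "j < n" using Suc.prems assms by auto
  have "(d - j) * ((n - j) choose (d - j)) = (n - j) * ((n - Suc j) choose (d - Suc j))"
    using binomial_absorption[of "d - Suc j" "n - j"] j jn by (simp add: Suc_diff_Suc)
  then have "real (d - j) * real ((n - j) choose (d - j)) = real (n - j) * real ((n - Suc j) choose (d - Suc j))"
    by (metis of_nat_mult)
  then have "real ((n - Suc j) choose (d - Suc j)) = real (d - j) / real (n - j) * real ((n - j) choose (d - j))"
    using jn by (simp add: field_simps)
  also have "\<dots> \<le> real d / real n * (real (n choose d) * (real d / real n) ^ j)"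
  proof (intro mult_mono)
    have "real (d - j) * real n \<le> real d * real (n - j)"
    proof -
      have "real j * real d \<le> real j * real n" using assms(2) by (intro mult_left_mono) auto
      then show ?thesis using j jn by (simp add: of_nat_diff algebra_simps)
    qed
    then show "real (d - j) / real (n - j) \<le> real d / real n"
      using jn by (simp add: field_simps)
  qed (use Suc j in auto)
  finally show ?case by (simp add: ac_simps)
qed simp

lemma card_dsubsets_containing:
  assumes T: "T \<subseteq> {1..n}" "card T \<le> d"
  shows "card {k\<in>dsubsets n d. T \<subseteq> k} = (n - card T) choose (d - card T)"
proof -
  have fT: "finite T" using T(1) finite_subset by blast
  have "bij_betw (\<lambda>s. s \<union> T) {s. s \<subseteq> {1..n} - T \<and> card s = d - card T} {k\<in>dsubsets n d. T \<subseteq> k}"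
  proof (rule bij_betw_byWitness[where f' = "\<lambda>k. k - T"])
    show "(\<lambda>s. s \<union> T) ` {s. s \<subseteq> {1..n} - T \<and> card s = d - card T} \<subseteq> {k\<in>dsubsets n d. T \<subseteq> k}"
    proof safe
      fix s assume s: "s \<subseteq> {1..n} - T" "card s = d - card T"
      have "finite s" using s(1) finite_subset by blast
      then have "card (s \<union> T) = d" using s T fT by (subst card_Un_disjoint) auto
      then show "s \<union> T \<in> dsubsets n d" using s T by (auto simp: dsubsets_def)
    qed
    show "(\<lambda>k. k - T) ` {k\<in>dsubsets n d. T \<subseteq> k} \<subseteq> {s. s \<subseteq> {1..n} - T \<and> card s = d - card T}"
      using fT by (auto simp: dsubsets_def card_Diff_subset)
  qed auto
  then have "card {k\<in>dsubsets n d. T \<subseteq> k} = card {s. s \<subseteq> {1..n} - T \<and> card s = d - card T}"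
    by (simp add: bij_betw_same_card)
  also have "\<dots> = card ({1..n} - T) choose (d - card T)"
    by (rule n_subsets) simp
  also have "card ({1..n} - T) = n - card T" using T(1) fT by (simp add: card_Diff_subset)
  finally show ?thesis .
qed

lemma finite_dsubsets [simp]: "finite (dsubsets n d)"
  by (simp add: dsubsets_def)

lemma card_dsubsets: "card (dsubsets n d) = n choose d"
  unfolding dsubsets_def using n_subsets[of "{1..n}" d] by simp

text \<open>Expand \<open>(1 + L d / n)\<^bsup>|U|\<^esup>\<close> over the subsets of \<open>U\<close>: a uniform \<open>d\<close>-subset contains a given set
  \<open>T\<close> with probability at most \<open>(d / n)\<^bsup>|T|\<^esup>\<close>.\<close>

lemma sum_meeting_dsubsets:
  assumes L: "0 \<le> L" and d: "1 \<le> d" "d \<le> n" and U: "U \<subseteq> {1..n}"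
  shows "(\<Sum>k | k \<in> dsubsets n d \<and> k \<inter> U \<noteq> {}. L ^ card (k \<inter> U))
    \<le> real (n choose d) * ((1 + L * real d / real n) ^ card U - 1)"
proof -
  let ?D = "dsubsets n d" and ?y = "L * real d / real n"
  have fU: "finite U" using U finite_subset by blast
  \<comment> \<open>The left side keeps one nonnegative term of the inner sum,
    \<open>T = k \<inter> U\<close>. The empty \<open>T\<close> can be left out since
    \<open>k\<close> meets \<open>U\<close>; this is the origin of the \<open>- 1\<close> in the
    bound.\<close>
  have "(\<Sum>k | k \<in> ?D \<and> k \<inter> U \<noteq> {}. L ^ card (k \<inter> U))
      \<le> (\<Sum>k | k \<in> ?D \<and> k \<inter> U \<noteq> {}. \<Sum>T\<in>Pow U - {{}}. if T \<subseteq> k then L ^ card T else 0)"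
  proof (rule sum_mono)
    fix k assume "k \<in> {k. k \<in> ?D \<and> k \<inter> U \<noteq> {}}"
    then have k: "k \<inter> U \<in> Pow U - {{}}" by auto
    have "L ^ card (k \<inter> U) = (if k \<inter> U \<subseteq> k then L ^ card (k \<inter> U) else 0)" by simp
    also have "\<dots> \<le> (\<Sum>T\<in>Pow U - {{}}. if T \<subseteq> k then L ^ card T else 0)"
      using k fU L by (intro member_le_sum[where f = "\<lambda>T. if T \<subseteq> k then L ^ card T else 0"]) auto
    finally show "L ^ card (k \<inter> U) \<le> (\<Sum>T\<in>Pow U - {{}}. if T \<subseteq> k then L ^ card T else 0)" .
  qed
  also have "\<dots> \<le> (\<Sum>k\<in>?D. \<Sum>T\<in>Pow U - {{}}. if T \<subseteq> k then L ^ card T else 0)"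
    using L by (intro sum_mono2) (auto intro!: sum_nonneg split: if_splits)
  also have "\<dots> = (\<Sum>T\<in>Pow U - {{}}. \<Sum>k\<in>?D. if T \<subseteq> k then L ^ card T else 0)"
    by (rule sum.swap)
  also have "\<dots> = (\<Sum>T\<in>Pow U - {{}}. real (card {k\<in>?D. T \<subseteq> k}) * L ^ card T)"
    by (intro sum.cong refl) (simp add: sum.If_cases Int_def conj_commute)
  also have "\<dots> \<le> (\<Sum>T\<in>Pow U - {{}}. real (n choose d) * ?y ^ card T)"
  proof (rule sum_mono)
    fix T assume "T \<in> Pow U - {{}}"
    then have T: "T \<subseteq> {1..n}" using U by auto
    have "real (card {k\<in>?D. T \<subseteq> k}) \<le> real (n choose d) * (real d / real n) ^ card T"
    proof (cases "card T \<le> d")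
      case True
      then show ?thesis
        unfolding card_dsubsets_containing[OF T True] using binomial_shift_le[of "card T" d n] d by auto
    next
      case False
      have none: "{k\<in>?D. T \<subseteq> k} = {}"
      proof -
        have "card T \<le> d" if "k \<in> ?D" "T \<subseteq> k" for k
        proof -
          have "finite k" using that(1) by (auto simp: dsubsets_def intro: finite_subset)
          then show ?thesis using that card_mono[of k T] by (auto simp: dsubsets_def)
        qed
        then show ?thesis using False by auto
      qed
      then show ?thesis unfolding none by simp
    qed
    then have "real (card {k\<in>?D. T \<subseteq> k}) * L ^ card T \<le> real (n choose d) * (real d / real n) ^ card T * L ^ card T"
      using L by (intro mult_right_mono) auto
    then show "real (card {k\<in>?D. T \<subseteq> k}) * L ^ card T \<le> real (n choose d) * ?y ^ card T"
      by (simp add: power_divide power_mult_distrib ac_simps)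
  qed
  also have "\<dots> = real (n choose d) * ((\<Sum>T\<in>Pow U. ?y ^ card T) - 1)"
    using fU by (simp add: sum_distrib_left[symmetric] sum_diff1)
  also have "(\<Sum>T\<in>Pow U. ?y ^ card T) = (1 + ?y) ^ card U"
    using prod_add[OF fU, of "\<lambda>_. ?y" "\<lambda>_. 1"] by (simp add: add.commute)
  finally show ?thesis .
qed

section \<open>Moments as functions of the exponents\<close>

definition monomial :: "nat \<Rightarrow> (nat \<Rightarrow> nat) \<Rightarrow> (nat \<Rightarrow> real) \<Rightarrow> real" where
  "monomial n e x = (\<Prod>\<alpha>\<in>{1..n}. x \<alpha> ^ e \<alpha>)"

lemma monomial_measurable [measurable]: "monomial n e \<in> borel_measurable (vecspace {1..n})"
  unfolding monomial_def[abs_def] by measurable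

context
  fixes N :: "'b measure" and X :: "'b \<Rightarrow> nat \<Rightarrow> real" and n :: nat
  assumes N: "prob_space N" and X [measurable]: "X \<in> N \<rightarrow>\<^sub>M vecspace {1..n}"
    and exch: "exchangeable n N X" and uncond: "unconditional n N X"
begin

text \<open>Two exponent functions with the same multiset of values differ by a permutation of the
  coordinates. Integrability is carried along because equality of integrals alone would not exclude
  the default value 0.\<close>

lemma exchangeable_monomial:
  assumes eq: "image_mset e (mset_set {1..n}) = image_mset e' (mset_set {1..n})"
  shows "integrable N (\<lambda>\<omega>. monomial n e (X \<omega>)) \<longleftrightarrow> integrable N (\<lambda>\<omega>. monomial n e' (X \<omega>))"
    "(\<integral>\<omega>. monomial n e (X \<omega>) \<partial>N) = (\<integral>\<omega>. monomial n e' (X \<omega>) \<partial>N)"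
proof -
  obtain \<sigma> where \<sigma>: "\<sigma> permutes {1..n}" "\<forall>x\<in>{1..n}. e x = e' (\<sigma> x)"
    using image_mset_eq_implies_permutes[OF _ eq] by blast
  let ?Y = "\<lambda>\<omega>. \<lambda>i\<in>{1..n}. X \<omega> (\<sigma> i)"
  have law: "distr N (vecspace {1..n}) X = distr N (vecspace {1..n}) ?Y"
    using exch \<sigma>(1) unfolding exchangeable_def by blast
  have \<sigma>n: "\<sigma> i \<in> {1..n}" if "i \<in> {1..n}" for i
    using permutes_in_image[OF \<sigma>(1)] that by blast
  have Y [measurable]: "?Y \<in> N \<rightarrow>\<^sub>M vecspace {1..n}"
  proof (rule measurable_restrict)
    fix i assume "i \<in> {1..n}"
    from measurable_component_singleton[OF \<sigma>n[OF this]]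
    show "(\<lambda>\<omega>. X \<omega> (\<sigma> i)) \<in> borel_measurable N" by (rule measurable_compose[OF X])
  qed
  have mono: "monomial n e (?Y \<omega>) = monomial n e' (X \<omega>)" for \<omega>
  proof -
    have "monomial n e (?Y \<omega>) = (\<Prod>\<alpha>\<in>{1..n}. X \<omega> (\<sigma> \<alpha>) ^ e' (\<sigma> \<alpha>))"
      unfolding monomial_def using \<sigma>(2) by (intro prod.cong refl) auto
    also have "\<dots> = (\<Prod>\<alpha>\<in>{1..n}. X \<omega> \<alpha> ^ e' \<alpha>)"
      using prod.permute[OF \<sigma>(1), of "\<lambda>\<alpha>. X \<omega> \<alpha> ^ e' \<alpha>"] by (simp add: o_def)
    finally show ?thesis by (simp add: monomial_def)
  qed
  have "integrable N (\<lambda>\<omega>. monomial n e (X \<omega>)) \<longleftrightarrow> integrable (distr N (vecspace {1..n}) X) (monomial n e)"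
    by (rule integrable_distr_eq[symmetric]) measurable
  also have "\<dots> \<longleftrightarrow> integrable N (\<lambda>\<omega>. monomial n e (?Y \<omega>))"
    unfolding law by (rule integrable_distr_eq) measurable
  finally show "integrable N (\<lambda>\<omega>. monomial n e (X \<omega>)) \<longleftrightarrow> integrable N (\<lambda>\<omega>. monomial n e' (X \<omega>))"
    unfolding mono .
  have "(\<integral>\<omega>. monomial n e (X \<omega>) \<partial>N) = (\<integral>x. monomial n e x \<partial>distr N (vecspace {1..n}) X)"
    by (rule integral_distr[symmetric]) measurable
  also have "\<dots> = (\<integral>\<omega>. monomial n e (?Y \<omega>) \<partial>N)"
    unfolding law by (rule integral_distr) measurable
  finally show "(\<integral>\<omega>. monomial n e (X \<omega>) \<partial>N) = (\<integral>\<omega>. monomial n e' (X \<omega>) \<partial>N)"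
    unfolding mono .
qed

text \<open>The monomial of the signed vector factors into the monomials of \<open>X\<close> and of
  the signs, and the latter has mean 0 as soon as one exponent is odd.\<close>

lemma unconditional_monomial:
  assumes \<alpha>: "\<alpha> \<in> {1..n}" "odd (e \<alpha>)"
  shows "(\<integral>\<omega>. monomial n e (X \<omega>) \<partial>N) = 0"
proof -
  interpret N: prob_space N by (rule N)
  let ?R = "PiM {1..n} (\<lambda>_. measure_pmf rademacher)"
  interpret R: prob_space ?R by (rule prob_space_PiM) (rule prob_space_measure_pmf)
  interpret pair_sigma_finite N ?R ..
  interpret product_sigma_finite "\<lambda>_. measure_pmf rademacher" by unfold_locales
  have eps [measurable]: "(\<lambda>\<epsilon>. \<epsilon> i) \<in> borel_measurable ?R" if "i \<in> {1..n}" for i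
  proof -
    have "(\<lambda>\<epsilon>. \<epsilon> i) \<in> ?R \<rightarrow>\<^sub>M measure_pmf rademacher" using that by measurable
    then show ?thesis by (rule measurable_compose) simp
  qed
  let ?Y = "\<lambda>(\<omega>, \<epsilon>). \<lambda>i\<in>{1..n}. \<epsilon> i * X \<omega> i"
  have Y [measurable]: "?Y \<in> N \<Otimes>\<^sub>M ?R \<rightarrow>\<^sub>M vecspace {1..n}"
    unfolding case_prod_beta
  proof (rule measurable_restrict)
    fix i assume i: "i \<in> {1..n}"
    have [measurable]: "(\<lambda>\<omega>. X \<omega> i) \<in> borel_measurable N"
      by (rule measurable_compose[OF X measurable_component_singleton[OF i]])
    note [measurable] = eps[OF i]
    show "(\<lambda>z. snd z i * X (fst z) i) \<in> borel_measurable (N \<Otimes>\<^sub>M ?R)" by measurable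
  qed
  have "(\<integral>\<omega>. monomial n e (X \<omega>) \<partial>N) = (\<integral>x. monomial n e x \<partial>distr N (vecspace {1..n}) X)"
    by (rule integral_distr[symmetric]) measurable
  also have "\<dots> = (\<integral>x. monomial n e x \<partial>distr (N \<Otimes>\<^sub>M ?R) (vecspace {1..n}) ?Y)"
    using uncond unfolding unconditional_def by simp
  also have "\<dots> = (\<integral>z. monomial n e (?Y z) \<partial>(N \<Otimes>\<^sub>M ?R))"
    by (rule integral_distr) measurable
  also have "\<dots> = 0"
  \<comment> \<open>Fubini covers the integrable case; otherwise the integral is 0 by convention.
    The conclusion is therefore about the value only, and integrability of mixed products is
    established separately.\<close>
  proof (cases "integrable (N \<Otimes>\<^sub>M ?R) (\<lambda>z. monomial n e (?Y z))")
    case True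
    have zero: "(\<integral>\<epsilon>. monomial n e \<epsilon> \<partial>?R) = 0"
    proof -
      have int: "integrable (measure_pmf rademacher) f" for f :: "real \<Rightarrow> real"
        by (rule integrable_measure_pmf_finite) (simp add: rademacher_def)
      have "(\<integral>\<epsilon>. monomial n e \<epsilon> \<partial>?R) = (\<Prod>i\<in>{1..n}. \<integral>x. x ^ e i \<partial>measure_pmf rademacher)"
        unfolding monomial_def by (rule product_integral_prod) (use int in auto)
      moreover have "(\<integral>x. x ^ e \<alpha> \<partial>measure_pmf rademacher) = 0"
        using \<alpha>(2) by (simp add: rademacher_def integral_pmf_of_set)
      ultimately show ?thesis using \<alpha>(1) by (auto intro!: prod_zero)
    qed
    have "(\<integral>z. monomial n e (?Y z) \<partial>(N \<Otimes>\<^sub>M ?R)) = (\<integral>\<omega>. (\<integral>\<epsilon>. monomial n e (?Y (\<omega>, \<epsilon>)) \<partial>?R) \<partial>N)"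
      using integral_fst'[OF True] by simp
    also have "\<dots> = (\<integral>\<omega>. (\<integral>\<epsilon>. monomial n e (X \<omega>) * monomial n e \<epsilon> \<partial>?R) \<partial>N)"
    proof -
      have "monomial n e (?Y (\<omega>, \<epsilon>)) = monomial n e (X \<omega>) * monomial n e \<epsilon>" for \<omega> \<epsilon>
        unfolding monomial_def prod.distrib[symmetric]
        by (intro prod.cong refl) (simp add: power_mult_distrib)
      then show ?thesis by simp
    qed
    also have "\<dots> = 0" using zero by simp
    finally show ?thesis .
  qed (rule not_integrable_integral_eq)
  finally show ?thesis .
qed

end

lemma image_mset_eq_of_card:
  fixes e e' :: "'a \<Rightarrow> nat"
  assumes A: "finite A"
    and e: "\<And>\<alpha>. \<alpha> \<in> A \<Longrightarrow> e \<alpha> \<in> {0, 2, 4}" and e': "\<And>\<alpha>. \<alpha> \<in> A \<Longrightarrow> e' \<alpha> \<in> {0, 2, 4}"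
    and c4: "card {\<alpha>\<in>A. e \<alpha> = 4} = card {\<alpha>\<in>A. e' \<alpha> = 4}"
    and c2: "card {\<alpha>\<in>A. e \<alpha> = 2} = card {\<alpha>\<in>A. e' \<alpha> = 2}"
  shows "image_mset e (mset_set A) = image_mset e' (mset_set A)"
proof (rule multiset_eqI)
  fix v
  have zero: "card {\<alpha>\<in>A. f \<alpha> = 0} = card A - card {\<alpha>\<in>A. f \<alpha> = 4} - card {\<alpha>\<in>A. f \<alpha> = 2}"
    if f: "\<And>\<alpha>. \<alpha> \<in> A \<Longrightarrow> f \<alpha> \<in> {0, 2, 4}" for f :: "'a \<Rightarrow> nat"
  proof -
    have "{\<alpha>\<in>A. f \<alpha> = 0} = A - {\<alpha>\<in>A. f \<alpha> = 4} - {\<alpha>\<in>A. f \<alpha> = 2}"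
      using f by fastforce
    also have "card \<dots> = card (A - {\<alpha>\<in>A. f \<alpha> = 4}) - card {\<alpha>\<in>A. f \<alpha> = 2}"
      using A by (intro card_Diff_subset) auto
    also have "card (A - {\<alpha>\<in>A. f \<alpha> = 4}) = card A - card {\<alpha>\<in>A. f \<alpha> = 4}"
      using A by (intro card_Diff_subset) auto
    finally show ?thesis .
  qed
  have "card {\<alpha>\<in>A. e \<alpha> = v} = card {\<alpha>\<in>A. e' \<alpha> = v}"
  proof (cases "v \<in> {0, 2, 4}")
    case True
    then show ?thesis using zero[OF e] zero[OF e'] c4 c2 by auto
  next
    case False
    then have "{\<alpha>\<in>A. e \<alpha> = v} = {}" "{\<alpha>\<in>A. e' \<alpha> = v} = {}" using e e' by blast+
    then show ?thesis by (simp only: card.empty)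
  qed
  then show "count (image_mset e (mset_set A)) v = count (image_mset e' (mset_set A)) v"
    by (simp add: count_image_mset_eq_card_vimage A)
qed

text \<open>The Schur test: \<open>a z * a z'\<close> is at most the mean of the two squares, and by
  symmetry both halves are controlled by the row sums. It applies to coefficients known only in
  square mean.\<close>

lemma symmetric_form_bound:
  fixes G :: "'z \<Rightarrow> 'z \<Rightarrow> real"
  assumes Z: "finite Z"
    and G0: "\<And>z z'. z \<in> Z \<Longrightarrow> z' \<in> Z \<Longrightarrow> 0 \<le> G z z'" and Gs: "\<And>z z'. G z z' = G z' z"
    and row: "\<And>z. z \<in> Z \<Longrightarrow> (\<Sum>z'\<in>Z. G z z') \<le> M"
  shows "(\<Sum>z\<in>Z. \<Sum>z'\<in>Z. a z * a z' * G z z') \<le> M * (\<Sum>z\<in>Z. (a z)\<^sup>2)"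
proof -
  have "(\<Sum>z\<in>Z. \<Sum>z'\<in>Z. a z * a z' * G z z') \<le> (\<Sum>z\<in>Z. \<Sum>z'\<in>Z. (a z)\<^sup>2 / 2 * G z z' + (a z')\<^sup>2 / 2 * G z z')"
  proof (intro sum_mono)
    fix z z' assume z: "z \<in> Z" "z' \<in> Z"
    have "a z * a z' \<le> (a z)\<^sup>2 / 2 + (a z')\<^sup>2 / 2"
      using sum_squares_bound[of "a z" "a z'"] by simp
    from mult_right_mono[OF this G0[OF z]]
    show "a z * a z' * G z z' \<le> (a z)\<^sup>2 / 2 * G z z' + (a z')\<^sup>2 / 2 * G z z'"
      by (simp add: algebra_simps)
  qed
  also have "\<dots> = (\<Sum>z\<in>Z. \<Sum>z'\<in>Z. (a z)\<^sup>2 / 2 * G z z') + (\<Sum>z\<in>Z. \<Sum>z'\<in>Z. (a z')\<^sup>2 / 2 * G z z')"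
    by (simp add: sum.distrib)
  also have "(\<Sum>z\<in>Z. \<Sum>z'\<in>Z. (a z')\<^sup>2 / 2 * G z z') = (\<Sum>z\<in>Z. \<Sum>z'\<in>Z. (a z)\<^sup>2 / 2 * G z z')"
    by (subst sum.swap) (simp add: Gs)
  also have "(\<Sum>z\<in>Z. \<Sum>z'\<in>Z. (a z)\<^sup>2 / 2 * G z z') + (\<Sum>z\<in>Z. \<Sum>z'\<in>Z. (a z)\<^sup>2 / 2 * G z z')
      = (\<Sum>z\<in>Z. (a z)\<^sup>2 * (\<Sum>z'\<in>Z. G z z'))"
    unfolding sum.distrib[symmetric] sum_distrib_left by (intro sum.cong refl) (simp add: field_simps)
  also have "\<dots> \<le> (\<Sum>z\<in>Z. (a z)\<^sup>2 * M)"
    using row by (intro sum_mono mult_left_mono) auto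
  finally show ?thesis by (simp add: sum_distrib_left mult.commute)
qed

text \<open>The exponent of the coordinate \<open>\<alpha>\<close> in the product
  \<open>x_i x_j x_k x_l\<close>.\<close>

definition exps :: "nat set \<Rightarrow> nat set \<Rightarrow> nat set \<Rightarrow> nat set \<Rightarrow> nat \<Rightarrow> nat" where
  "exps i j k l \<alpha> = of_bool (\<alpha> \<in> i) + of_bool (\<alpha> \<in> j) + of_bool (\<alpha> \<in> k) + of_bool (\<alpha> \<in> l)"

lemma prod_eq_monomial:
  assumes "i \<subseteq> {1..n}"
  shows "(\<Prod>\<alpha>\<in>i. y \<alpha>) = monomial n (\<lambda>\<alpha>. of_bool (\<alpha> \<in> i)) y"
  unfolding monomial_def by (rule prod.mono_neutral_cong_left) (use assms in auto)

lemma prod4_eq_monomial: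
  assumes "i \<subseteq> {1..n}" "j \<subseteq> {1..n}" "k \<subseteq> {1..n}" "l \<subseteq> {1..n}"
  shows "(\<Prod>\<alpha>\<in>i. y \<alpha>) * (\<Prod>\<alpha>\<in>j. y \<alpha>) * (\<Prod>\<alpha>\<in>k. y \<alpha>) * (\<Prod>\<alpha>\<in>l. y \<alpha>) = monomial n (exps i j k l) y"
  unfolding prod_eq_monomial[OF assms(1)] prod_eq_monomial[OF assms(2)] prod_eq_monomial[OF assms(3)]
    prod_eq_monomial[OF assms(4)] monomial_def prod.distrib[symmetric] exps_def power_add ..

text \<open>The exponents of \<open>X_1^4 ... X_r^4 X_{r+1}^2 ... X_{2d-r}^2\<close>, the monomial
  of (C), as the representative of its class under permutations.\<close>

definition canon :: "nat \<Rightarrow> nat \<Rightarrow> nat \<Rightarrow> nat" where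
  "canon d r \<alpha> = (if \<alpha> \<le> r then 4 else if \<alpha> \<le> 2 * d - r then 2 else 0)"

lemma canon_monomial:
  assumes "r \<le> d" "2 * d \<le> n"
  shows "monomial n (canon d r) y = (\<Prod>\<alpha>=1..r. y \<alpha> ^ 4) * (\<Prod>\<alpha>=r+1..2 * d - r. (y \<alpha>)\<^sup>2)"
proof -
  have "monomial n (canon d r) y = (\<Prod>\<alpha>\<in>{1..r} \<union> {r+1..2 * d - r}. y \<alpha> ^ canon d r \<alpha>)"
    unfolding monomial_def
    by (rule prod.mono_neutral_cong_right) (use assms in \<open>auto simp: canon_def\<close>)
  also have "\<dots> = (\<Prod>\<alpha>\<in>{1..r}. y \<alpha> ^ canon d r \<alpha>) * (\<Prod>\<alpha>\<in>{r+1..2 * d - r}. y \<alpha> ^ canon d r \<alpha>)"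
    by (rule prod.union_disjoint) auto
  also have "(\<Prod>\<alpha>\<in>{1..r}. y \<alpha> ^ canon d r \<alpha>) = (\<Prod>\<alpha>\<in>{1..r}. y \<alpha> ^ 4)"
    by (intro prod.cong refl) (auto simp: canon_def)
  also have "(\<Prod>\<alpha>\<in>{r+1..2 * d - r}. y \<alpha> ^ canon d r \<alpha>) = (\<Prod>\<alpha>\<in>{r+1..2 * d - r}. (y \<alpha>)\<^sup>2)"
    by (intro prod.cong refl) (auto simp: canon_def)
  finally show ?thesis .
qed

lemma canon_card:
  assumes "r \<le> d" "2 * d \<le> n"
  shows "card {\<alpha>\<in>{1..n}. canon d r \<alpha> = 4} = r" "card {\<alpha>\<in>{1..n}. canon d r \<alpha> = 2} = 2 * d - 2 * r"
proof -
  have "{\<alpha>\<in>{1..n}. canon d r \<alpha> = 4} = {1..r}" "{\<alpha>\<in>{1..n}. canon d r \<alpha> = 2} = {r+1..2 * d - r}"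
    using assms by (auto simp: canon_def split: if_splits)
  then show "card {\<alpha>\<in>{1..n}. canon d r \<alpha> = 4} = r" "card {\<alpha>\<in>{1..n}. canon d r \<alpha> = 2} = 2 * d - 2 * r"
    using assms by simp_all
qed

section \<open>Quadratic forms in principal tensors\<close>

text \<open>For \<open>1 <= r <= d\<close> the moment bounded in (C). At \<open>r = 0\<close> it is
  the first moment in (B), so that disjoint and overlapping index sets form one family.\<close>

definition fourth_moment :: "'b measure \<Rightarrow> ('b \<Rightarrow> nat \<Rightarrow> real) \<Rightarrow> nat \<Rightarrow> nat \<Rightarrow> real" where
  "fourth_moment N X d r = (\<integral>\<omega>. (\<Prod>i=1..r. X \<omega> i ^ 4) * (\<Prod>i=r+1..2 * d - r. (X \<omega> i)\<^sup>2) \<partial>N)"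

definition square_moment :: "'b measure \<Rightarrow> ('b \<Rightarrow> nat \<Rightarrow> real) \<Rightarrow> nat \<Rightarrow> real" where
  "square_moment N X d = (\<integral>\<omega>. (\<Prod>i=1..d. (X \<omega> i)\<^sup>2) \<partial>N)"

context
  fixes N :: "'b measure" and X :: "'b \<Rightarrow> nat \<Rightarrow> real" and n d :: nat and L :: real
  assumes N: "prob_space N" and X [measurable]: "X \<in> N \<rightarrow>\<^sub>M vecspace {1..n}"
    and exch: "exchangeable n N X" and uncond: "unconditional n N X"
    and d: "1 \<le> d" and dn: "2 * d \<le> n" and L: "1 \<le> L"
    and \<phi>i: "\<And>r. r \<le> d \<Longrightarrow> integrable N (\<lambda>\<omega>. (\<Prod>i=1..r. X \<omega> i ^ 4) * (\<Prod>i=r+1..2 * d - r. (X \<omega> i)\<^sup>2))"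
    and \<phi>b: "\<And>r. r \<le> d \<Longrightarrow> fourth_moment N X d r \<le> 2 * L ^ r"
    and \<psi>i: "integrable N (\<lambda>\<omega>. \<Prod>i=1..d. (X \<omega> i)\<^sup>2)"
    and \<psi>b: "square_moment N X d \<le> 2"
begin

abbreviation "D \<equiv> dsubsets n d"

definition prin :: "nat set \<Rightarrow> 'b \<Rightarrow> real" where
  "prin i \<omega> = (\<Prod>\<alpha>\<in>i. X \<omega> \<alpha>)"

abbreviation "\<phi> \<equiv> fourth_moment N X d"
abbreviation "\<psi> \<equiv> square_moment N X d"

lemma D_sub: "i \<in> D \<Longrightarrow> i \<subseteq> {1..n}" "i \<in> D \<Longrightarrow> card i = d" "i \<in> D \<Longrightarrow> finite i"
  by (auto simp: dsubsets_def intro: finite_subset)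

lemma X_measurable: "\<alpha> \<in> {1..n} \<Longrightarrow> (\<lambda>\<omega>. X \<omega> \<alpha>) \<in> borel_measurable N"
  by (rule measurable_compose[OF X measurable_component_singleton])

lemma prin_measurable:
  assumes "i \<in> D"
  shows "prin i \<in> borel_measurable N"
  unfolding prin_def[abs_def] using D_sub(1)[OF assms] by (intro borel_measurable_prod X_measurable) blast

lemma prin4: "i \<in> D \<Longrightarrow> j \<in> D \<Longrightarrow> k \<in> D \<Longrightarrow> l \<in> D \<Longrightarrow>
    prin i \<omega> * prin j \<omega> * prin k \<omega> * prin l \<omega> = monomial n (exps i j k l) (X \<omega>)"
  unfolding prin_def by (intro prod4_eq_monomial D_sub)

lemma \<phi>_nonneg: "0 \<le> \<phi> r"
  unfolding fourth_moment_def by (intro integral_nonneg_AE AE_I2 mult_nonneg_nonneg prod_nonneg) auto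

lemma \<psi>_bounds: "0 \<le> \<psi>" "\<psi> \<le> 2"
  using \<psi>b by (auto simp: square_moment_def intro!: integral_nonneg_AE AE_I2 prod_nonneg)

text \<open>All exponents are 0, 2 or 4 and they sum to \<open>4 d\<close>. The value 4 is taken
  exactly on the \<open>r\<close> points of the fourfold intersection, so the value 2 is taken
  \<open>2 d - 2 r\<close> times, as for \<open>canon d r\<close>.\<close>

lemma even_exps:
  assumes D: "i \<in> D" "j \<in> D" "k \<in> D" "l \<in> D"
    and even: "\<forall>\<alpha>\<in>{1..n}. even (exps i j k l \<alpha>)"
  shows "image_mset (exps i j k l) (mset_set {1..n}) = image_mset (canon d (card (i \<inter> j \<inter> k \<inter> l))) (mset_set {1..n})"
    "card (i \<inter> j \<inter> k \<inter> l) \<le> d"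
proof -
  let ?e = "exps i j k l"
  define r where "r = card (i \<inter> j \<inter> k \<inter> l)"
  show r: "card (i \<inter> j \<inter> k \<inter> l) \<le> d"
    using card_mono[of i "i \<inter> j \<inter> k \<inter> l"] D_sub[OF D(1)] by auto
  have val: "?e \<alpha> \<in> {0, 2, 4}" if "\<alpha> \<in> {1..n}" for \<alpha>
  proof -
    have "x = 0 \<or> x = 2 \<or> x = 4" if "x \<le> 4" "even x" for x :: nat using that by presburger
    moreover have "?e \<alpha> \<le> 4" by (simp add: exps_def of_bool_def)
    moreover have "even (?e \<alpha>)" using even that by blast
    ultimately show ?thesis by blast
  qed
  let ?F = "{\<alpha>\<in>{1..n}. ?e \<alpha> = 4}" and ?T = "{\<alpha>\<in>{1..n}. ?e \<alpha> = 2}"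
  have F: "?F = i \<inter> j \<inter> k \<inter> l"
    using D_sub(1)[OF D(1)] by (auto simp: exps_def of_bool_def split: if_splits)
  have one: "(\<Sum>\<alpha>\<in>{1..n}. of_bool (\<alpha> \<in> s)) = d" if "s \<in> D" for s
  proof -
    have "{1..n} \<inter> {\<alpha>. \<alpha> \<in> s} = s" using D_sub(1)[OF that] by auto
    then show ?thesis using D_sub(2)[OF that] by (simp add: of_bool_def sum.If_cases)
  qed
  have "4 * d = (\<Sum>\<alpha>\<in>{1..n}. ?e \<alpha>)"
    unfolding exps_def sum.distrib one[OF D(1)] one[OF D(2)] one[OF D(3)] one[OF D(4)] by simp
  also have "\<dots> = (\<Sum>\<alpha>\<in>{1..n}. (if ?e \<alpha> = 4 then 4 else 0) + (if ?e \<alpha> = 2 then 2 else 0))"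
    by (intro sum.cong refl) (drule val, auto)
  also have "\<dots> = 4 * card ?F + 2 * card ?T"
    by (simp add: sum.distrib sum.If_cases Int_def)
  finally have T: "card ?T = 2 * d - 2 * r" unfolding F r_def by simp
  show "image_mset ?e (mset_set {1..n}) = image_mset (canon d (card (i \<inter> j \<inter> k \<inter> l))) (mset_set {1..n})"
    unfolding r_def[symmetric]
  proof (rule image_mset_eq_of_card)
    show "card ?F = card {\<alpha>\<in>{1..n}. canon d r \<alpha> = 4}"
      unfolding F canon_card(1)[OF r[folded r_def] dn] by (rule r_def[symmetric])
    show "card ?T = card {\<alpha>\<in>{1..n}. canon d r \<alpha> = 2}"
      unfolding T canon_card(2)[OF r[folded r_def] dn] by (rule refl)
  qed (use val in \<open>auto simp: canon_def\<close>)
qed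

lemma fourth_moment_even:
  assumes D: "i \<in> D" "j \<in> D" "k \<in> D" "l \<in> D"
    and even: "\<forall>\<alpha>\<in>{1..n}. even (exps i j k l \<alpha>)"
  shows "integrable N (\<lambda>\<omega>. prin i \<omega> * prin j \<omega> * prin k \<omega> * prin l \<omega>)"
    "(\<integral>\<omega>. prin i \<omega> * prin j \<omega> * prin k \<omega> * prin l \<omega> \<partial>N) = \<phi> (card (i \<inter> j \<inter> k \<inter> l))"
  unfolding prin4[OF D] exchangeable_monomial[OF N X exch uncond even_exps(1)[OF D even]]
    canon_monomial[OF even_exps(2)[OF D even] dn] fourth_moment_def
  by (rule \<phi>i[OF even_exps(2)[OF D even]], rule refl)

lemma fourth_moment_odd:
  assumes D: "i \<in> D" "j \<in> D" "k \<in> D" "l \<in> D"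
    and odd: "\<not> (\<forall>\<alpha>\<in>{1..n}. even (exps i j k l \<alpha>))"
  shows "(\<integral>\<omega>. prin i \<omega> * prin j \<omega> * prin k \<omega> * prin l \<omega> \<partial>N) = 0"
  unfolding prin4[OF D] using odd unconditional_monomial[OF N X exch uncond] by blast

lemma even_exps_pair: "\<forall>\<alpha>\<in>{1..n}. even (exps i i k k \<alpha>)"
  by (auto simp: exps_def)

text \<open>\<open>|a b| <= a^2 + b^2\<close> with \<open>a = x_i x_j\<close> and
  \<open>b = x_k x_l\<close>; the squares are fourth moments with even exponents. In the odd case
  this shows that the vanishing moment is a genuine integral, as linearity requires.\<close>

lemma integrable_prin4:
  assumes D: "i \<in> D" "j \<in> D" "k \<in> D" "l \<in> D"
  shows "integrable N (\<lambda>\<omega>. prin i \<omega> * prin j \<omega> * (prin k \<omega> * prin l \<omega>))"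
proof (rule Bochner_Integration.integrable_bound)
  show "integrable N (\<lambda>\<omega>. prin i \<omega> * prin i \<omega> * prin j \<omega> * prin j \<omega> + prin k \<omega> * prin k \<omega> * prin l \<omega> * prin l \<omega>)"
    by (intro Bochner_Integration.integrable_add fourth_moment_even(1) D even_exps_pair)
  show "(\<lambda>\<omega>. prin i \<omega> * prin j \<omega> * (prin k \<omega> * prin l \<omega>)) \<in> borel_measurable N"
    by (intro borel_measurable_times prin_measurable D)
  have "\<bar>a * b\<bar> \<le> a * a + b * b" for a b :: real
    using sum_squares_bound[of a b] sum_squares_bound[of "- a" b] by (auto simp: power2_eq_square abs_if)
  from this[of "prin i \<omega> * prin j \<omega>" "prin k \<omega> * prin l \<omega>" for \<omega>]
  show "AE \<omega> in N. norm (prin i \<omega> * prin j \<omega> * (prin k \<omega> * prin l \<omega>))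
      \<le> norm (prin i \<omega> * prin i \<omega> * prin j \<omega> * prin j \<omega> + prin k \<omega> * prin k \<omega> * prin l \<omega> * prin l \<omega>)"
    by (intro AE_I2) (simp add: ac_simps, smt (verit))
qed

lemma second_moment:
  assumes i: "i \<in> D"
  shows "integrable N (\<lambda>\<omega>. (prin i \<omega>)\<^sup>2)" "(\<integral>\<omega>. (prin i \<omega>)\<^sup>2 \<partial>N) = \<psi>"
proof -
  let ?e = "\<lambda>s \<alpha>. (if \<alpha> \<in> s then 2 else 0::nat)"
  have pm: "(\<Prod>\<alpha>\<in>s. (y \<alpha>)\<^sup>2) = monomial n (?e s) y" if "s \<subseteq> {1..n}" for s and y :: "nat \<Rightarrow> real"
    proof -
    have "(\<Prod>\<alpha>\<in>s. (y \<alpha>)\<^sup>2) = (\<Prod>\<alpha>\<in>s. y \<alpha> ^ ?e s \<alpha>)" by (intro prod.cong refl) simp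
    also have "\<dots> = (\<Prod>\<alpha>\<in>{1..n}. y \<alpha> ^ ?e s \<alpha>)"
      using that by (intro prod.mono_neutral_left) (simp_all del: One_nat_def)
    finally show ?thesis by (simp only: monomial_def)
  qed
  have sub: "{1..d} \<subseteq> {1..n}" using dn by auto
  have "image_mset (?e i) (mset_set {1..n}) = image_mset (?e {1..d}) (mset_set {1..n})"
  proof (rule image_mset_eq_of_card)
    have setc: "{\<alpha>\<in>{1..n}. ?e s \<alpha> = 2} = s" if "s \<subseteq> {1..n}" for s using that by auto
    show "card {\<alpha>\<in>{1..n}. ?e i \<alpha> = 2} = card {\<alpha>\<in>{1..n}. ?e {1..d} \<alpha> = 2}"
      unfolding setc[OF D_sub(1)[OF i]] setc[OF sub] by (simp add: D_sub(2)[OF i])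
  qed (auto split: if_splits)
  note eq = exchangeable_monomial[OF N X exch uncond this]
  have pr: "(prin i \<omega>)\<^sup>2 = monomial n (?e i) (X \<omega>)" for \<omega>
    using pm[OF D_sub(1)[OF i], of "X \<omega>"] by (simp add: prin_def prod_power_distrib)
  show "integrable N (\<lambda>\<omega>. (prin i \<omega>)\<^sup>2)"
    unfolding pr eq unfolding pm[OF sub, symmetric] by (rule \<psi>i)
  show "(\<integral>\<omega>. (prin i \<omega>)\<^sup>2 \<partial>N) = \<psi>"
    unfolding pr eq unfolding pm[OF sub, symmetric] square_moment_def ..
qed

text \<open>Relative to the number of all \<open>d\<close>-subsets, a bound for the
  \<open>L\<close>-weighted count of those that meet a given set of at most \<open>2 d\<close>
  points. It is at most \<open>exp (2 L d^2 / n) - 1\<close>.\<close>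

abbreviation "\<kappa> \<equiv> (1 + L * real d / real n) ^ (2 * d) - 1"

lemma base_ge1: "1 \<le> 1 + L * real d / real n"
  using L by simp

lemma sum_meeting:
  assumes U: "U \<subseteq> {1..n}" "card U \<le> 2 * d"
  shows "(\<Sum>k | k \<in> D \<and> k \<inter> U \<noteq> {}. L ^ card (k \<inter> U)) \<le> real (card D) * \<kappa>"
proof -
  have "(\<Sum>k | k \<in> D \<and> k \<inter> U \<noteq> {}. L ^ card (k \<inter> U))
      \<le> real (n choose d) * ((1 + L * real d / real n) ^ card U - 1)"
    using L d dn U by (intro sum_meeting_dsubsets) auto
  also have "\<dots> \<le> real (n choose d) * \<kappa>"
    using base_ge1 U(2) by (intro mult_left_mono diff_right_mono power_increasing) auto
  finally show ?thesis by (simp add: card_dsubsets)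
qed

section \<open>The off-diagonal part of the quadratic form\<close>

definition "offd = {z \<in> D \<times> D. fst z \<noteq> snd z}"

definition "prod2 z \<omega> = prin (fst z) \<omega> * prin (snd z) \<omega>"

definition "G z z' = (\<integral>\<omega>. prod2 z \<omega> * prod2 z' \<omega> \<partial>N)"

lemma G_cases:
  assumes "z \<in> D \<times> D" "z' \<in> D \<times> D"
  shows "G z z' = (if \<forall>\<alpha>\<in>{1..n}. even (exps (fst z) (snd z) (fst z') (snd z') \<alpha>)
      then \<phi> (card (fst z \<inter> snd z \<inter> fst z' \<inter> snd z')) else 0)"
proof -
  have D: "fst z \<in> D" "snd z \<in> D" "fst z' \<in> D" "snd z' \<in> D" using assms by auto
  have "G z z' = (\<integral>\<omega>. prin (fst z) \<omega> * prin (snd z) \<omega> * prin (fst z') \<omega> * prin (snd z') \<omega> \<partial>N)"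
    unfolding G_def prod2_def mult.assoc ..
  then show ?thesis
    using fourth_moment_even(2)[OF D] fourth_moment_odd[OF D] by presburger
qed

lemma offdD:
  assumes "z \<in> offd"
  shows "fst z \<in> D" "snd z \<in> D" "fst z \<noteq> snd z" "z \<in> D \<times> D"
  using assms unfolding offd_def mem_Times_iff by blast+

lemma finite_offd: "finite offd"
proof (rule finite_subset)
  show "offd \<subseteq> D \<times> D" using offdD(4) by blast
qed simp

text \<open>For \<open>z = (i, j)\<close> a nonzero term has \<open>k \<triangle> l = i \<triangle> j\<close>, so that \<open>l\<close> is determined by \<open>k\<close>; and \<open>k\<close>
  meets \<open>i \<union> j\<close>, since otherwise \<open>k = l\<close>.\<close>

lemma G_row:
  assumes z: "z \<in> offd"
  shows "(\<Sum>z'\<in>offd. G z z') \<le> 2 * (real (card D) * \<kappa>)"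
proof -
  define i j where "i = fst z" and "j = snd z"
  have ij: "z = (i, j)" "i \<in> D" "j \<in> D" "i \<noteq> j" using offdD[OF z] by (simp_all add: i_def j_def)
  let ?U = "i \<union> j"
  let ?ev = "\<lambda>z'. \<forall>\<alpha>\<in>{1..n}. even (exps i j (fst z') (snd z') \<alpha>)"
  let ?Z = "{z'\<in>offd. ?ev z'}"
  have "(\<Sum>z'\<in>offd. G z z') = (\<Sum>z'\<in>?Z. G z z')"
    using finite_offd by (intro sum.mono_neutral_right) (use offdD(4) z ij in \<open>auto simp: G_cases\<close>)
  also have "\<dots> \<le> (\<Sum>z'\<in>?Z. 2 * L ^ card (fst z' \<inter> ?U))"
  proof (rule sum_mono)
    fix z' assume z': "z' \<in> ?Z"
    define k l where "k = fst z'" and "l = snd z'"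
    have kl: "z' = (k, l)" "k \<in> D" "l \<in> D" using offdD[of z'] z' by (simp_all add: k_def l_def)
    have "G z z' = \<phi> (card (i \<inter> j \<inter> k \<inter> l))"
      using z' offdD(4)[OF z] offdD(4)[of z'] kl ij by (simp add: G_cases)
    also have "\<dots> \<le> 2 * L ^ card (i \<inter> j \<inter> k \<inter> l)"
      using z' kl ij by (intro \<phi>b even_exps(2)) auto
    also have "\<dots> \<le> 2 * L ^ card (k \<inter> ?U)"
      using L D_sub(3)[OF kl(2)] by (intro mult_left_mono power_increasing card_mono) auto
    finally show "G z z' \<le> 2 * L ^ card (fst z' \<inter> ?U)" using kl by simp
  qed
  also have "\<dots> = (\<Sum>k\<in>fst ` ?Z. 2 * L ^ card (k \<inter> ?U))"
  proof (rule sum.reindex_cong[symmetric, OF _ refl refl])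
    show "inj_on fst ?Z"
    proof (rule inj_onI)
      fix y z' assume y: "y \<in> ?Z" and z': "z' \<in> ?Z" and eq: "fst y = fst z'"
      have "y \<in> offd" "z' \<in> offd" using y z' by simp_all
      then have "snd y \<subseteq> {1..n}" "snd z' \<subseteq> {1..n}" by (simp_all only: D_sub(1) offdD(2))
      moreover have "\<alpha> \<in> snd y \<longleftrightarrow> \<alpha> \<in> snd z'" if "\<alpha> \<in> {1..n}" for \<alpha>
      proof -
        have "even (exps i j (fst y) (snd y) \<alpha>)" "even (exps i j (fst z') (snd z') \<alpha>)" using y z' that by blast+
        then show ?thesis unfolding exps_def eq by (cases "\<alpha> \<in> snd y"; cases "\<alpha> \<in> snd z'") auto
      qed
      ultimately have "snd y = snd z'" by blast
      then show "y = z'" using eq by (simp add: prod_eq_iff)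
    qed
  qed
  also have "\<dots> \<le> (\<Sum>k | k \<in> D \<and> k \<inter> ?U \<noteq> {}. 2 * L ^ card (k \<inter> ?U))"
  proof (rule sum_mono2)
    show "fst ` ?Z \<subseteq> {k. k \<in> D \<and> k \<inter> ?U \<noteq> {}}"
    proof clarify
      fix z' assume z': "z' \<in> offd" "?ev z'"
      define k l where "k = fst z'" and "l = snd z'"
      have kl: "z' = (k, l)" "k \<in> D" "l \<in> D" "k \<noteq> l" using offdD[OF z'(1)] by (simp_all add: k_def l_def)
      have "k \<inter> ?U \<noteq> {}"
      proof
        assume e: "k \<inter> ?U = {}"
        have "k \<subseteq> l"
        proof
          fix \<alpha> assume \<alpha>: "\<alpha> \<in> k"
          then have "\<alpha> \<in> {1..n}" using D_sub(1)[OF kl(2)] by blast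
          then have "even (exps i j k l \<alpha>)" using z'(2) kl by auto
          moreover have "\<alpha> \<notin> i" "\<alpha> \<notin> j" using e \<alpha> by auto
          ultimately show "\<alpha> \<in> l" using \<alpha> by (auto simp: exps_def of_bool_def split: if_splits)
        qed
        then have "k = l" using D_sub kl by (metis card_subset_eq)
        then show False using kl by simp
      qed
      then show "fst z' \<in> D \<and> fst z' \<inter> ?U \<noteq> {}" using kl by simp
    qed
  qed (use L in auto)
  also have "\<dots> = 2 * (\<Sum>k | k \<in> D \<and> k \<inter> ?U \<noteq> {}. L ^ card (k \<inter> ?U))"
    by (simp add: sum_distrib_left)
  also have "\<dots> \<le> 2 * (real (card D) * \<kappa>)"
  proof (intro mult_left_mono sum_meeting)
    show "?U \<subseteq> {1..n}" using D_sub(1) ij by auto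
    show "card ?U \<le> 2 * d" using card_Un_le[of i j] D_sub(2) ij by simp
  qed simp
  finally show ?thesis .
qed

lemma integrable_prod2:
  "z \<in> D \<times> D \<Longrightarrow> z' \<in> D \<times> D \<Longrightarrow> integrable N (\<lambda>\<omega>. prod2 z \<omega> * prod2 z' \<omega>)"
  unfolding prod2_def mem_Times_iff by (intro integrable_prin4) blast+

text \<open>The second moment is the form with matrix \<open>G\<close> in the coefficients
  \<open>a\<close>. The entries of \<open>G\<close> are nonnegative, being 0 or an even moment, so
  the Schur test applies with the row bound.\<close>

lemma offdiagonal_second_moment:
  "integrable N (\<lambda>\<omega>. (\<Sum>z\<in>offd. a z * prod2 z \<omega>)\<^sup>2)"
  "(\<integral>\<omega>. (\<Sum>z\<in>offd. a z * prod2 z \<omega>)\<^sup>2 \<partial>N) \<le> 2 * (real (card D) * \<kappa>) * (\<Sum>z\<in>offd. (a z)\<^sup>2)"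
proof -
  have sq: "(\<Sum>z\<in>offd. a z * prod2 z \<omega>)\<^sup>2 = (\<Sum>z\<in>offd. \<Sum>z'\<in>offd. a z * a z' * (prod2 z \<omega> * prod2 z' \<omega>))" for \<omega>
    unfolding power2_eq_square sum_product by (simp add: ac_simps)
  have int: "integrable N (\<lambda>\<omega>. a z * a z' * (prod2 z \<omega> * prod2 z' \<omega>))" if "z \<in> offd" "z' \<in> offd" for z z'
    using that offdD(4) by (intro integrable_mult_right integrable_prod2)
  show "integrable N (\<lambda>\<omega>. (\<Sum>z\<in>offd. a z * prod2 z \<omega>)\<^sup>2)"
    unfolding sq by (intro Bochner_Integration.integrable_sum int)
  have "(\<integral>\<omega>. (\<Sum>z\<in>offd. a z * prod2 z \<omega>)\<^sup>2 \<partial>N)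
      = (\<Sum>z\<in>offd. \<integral>\<omega>. (\<Sum>z'\<in>offd. a z * a z' * (prod2 z \<omega> * prod2 z' \<omega>)) \<partial>N)"
    unfolding sq by (intro Bochner_Integration.integral_sum Bochner_Integration.integrable_sum int)
  also have "\<dots> = (\<Sum>z\<in>offd. \<Sum>z'\<in>offd. \<integral>\<omega>. a z * a z' * (prod2 z \<omega> * prod2 z' \<omega>) \<partial>N)"
    by (intro sum.cong refl Bochner_Integration.integral_sum int)
  also have "\<dots> = (\<Sum>z\<in>offd. \<Sum>z'\<in>offd. a z * a z' * G z z')"
    unfolding G_def by simp
  also have "\<dots> \<le> 2 * (real (card D) * \<kappa>) * (\<Sum>z\<in>offd. (a z)\<^sup>2)"
  proof (rule symmetric_form_bound[OF finite_offd])
    show "0 \<le> G z z'" if "z \<in> offd" "z' \<in> offd" for z z'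
      unfolding G_cases[OF offdD(4)[OF that(1)] offdD(4)[OF that(2)]] using \<phi>_nonneg by simp
    show "G z z' = G z' z" for z z' unfolding G_def by (simp only: mult.commute)
  qed (rule G_row)
  finally show "(\<integral>\<omega>. (\<Sum>z\<in>offd. a z * prod2 z \<omega>)\<^sup>2 \<partial>N) \<le> 2 * (real (card D) * \<kappa>) * (\<Sum>z\<in>offd. (a z)\<^sup>2)" .
qed

section \<open>The diagonal part of the quadratic form\<close>

abbreviation "\<delta> \<equiv> \<bar>\<phi> 0 - 2 * \<psi> + 1\<bar>"

abbreviation "cprin i \<omega> \<equiv> (prin i \<omega>)\<^sup>2 - 1"
abbreviation "cov i k \<equiv> \<phi> (card (i \<inter> k)) - 2 * \<psi> + 1"

text \<open>For the quadruple \<open>(i, i, k, k)\<close> all exponents are even and the fourfold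
  intersection is \<open>i \<inter> k\<close>. The variables are centred at 1 and not at their mean
  \<open>\<psi>\<close>, because the form is compared with the trace; hence the term
  \<open>- 2 \<psi> + 1\<close>.\<close>

lemma diagonal_covariance:
  assumes D: "i \<in> D" "k \<in> D"
  shows "integrable N (\<lambda>\<omega>. cprin i \<omega> * cprin k \<omega>)"
    "(\<integral>\<omega>. cprin i \<omega> * cprin k \<omega> \<partial>N) = cov i k"
proof -
  interpret N: prob_space N by (rule N)
  have eq: "cprin i \<omega> * cprin k \<omega>
      = prin i \<omega> * prin i \<omega> * prin k \<omega> * prin k \<omega> - (prin i \<omega>)\<^sup>2 - (prin k \<omega>)\<^sup>2 + 1" for \<omega>
    by (simp add: power2_eq_square algebra_simps)
  note i4 = fourth_moment_even[OF D(1) D(1) D(2) D(2) even_exps_pair]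
  note i2 = second_moment[OF D(1)] and k2 = second_moment[OF D(2)]
  show "integrable N (\<lambda>\<omega>. cprin i \<omega> * cprin k \<omega>)"
    unfolding eq by (intro Bochner_Integration.integrable_add Bochner_Integration.integrable_diff i4(1) i2(1) k2(1) N.integrable_const)
  have "(\<integral>\<omega>. prin i \<omega> * prin i \<omega> * prin k \<omega> * prin k \<omega> - (prin i \<omega>)\<^sup>2 - (prin k \<omega>)\<^sup>2 + 1 \<partial>N)
      = (\<integral>\<omega>. prin i \<omega> * prin i \<omega> * prin k \<omega> * prin k \<omega> \<partial>N) - (\<integral>\<omega>. (prin i \<omega>)\<^sup>2 \<partial>N) - (\<integral>\<omega>. (prin k \<omega>)\<^sup>2 \<partial>N) + (\<integral>\<omega>. 1 \<partial>N)"
    using i4(1) i2(1) k2(1) by (subst Bochner_Integration.integral_add Bochner_Integration.integral_diff, simp, simp)+ simp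
  then show "(\<integral>\<omega>. cprin i \<omega> * cprin k \<omega> \<partial>N) = cov i k"
    unfolding eq i4(2) i2(2) k2(2) by (simp add: N.prob_space Int_assoc)
qed

lemma diagonal_row:
  assumes i: "i \<in> D"
  shows "(\<Sum>k\<in>D. \<bar>cov i k\<bar>) \<le> real (card D) * (\<delta> + 7 * \<kappa>)"
proof -
  have "(\<Sum>k\<in>D. \<bar>cov i k\<bar>)
      \<le> (\<Sum>k\<in>D. \<delta> + (if k \<inter> i \<noteq> {} then 7 * L ^ card (k \<inter> i) else 0))"
  proof (rule sum_mono)
    fix k assume k: "k \<in> D"
    show "\<bar>cov i k\<bar> \<le> \<delta> + (if k \<inter> i \<noteq> {} then 7 * L ^ card (k \<inter> i) else 0)"
    proof (cases "k \<inter> i = {}")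
      case False
      have ki: "k \<inter> i = i \<inter> k" by (rule Int_commute)
      have "card (i \<inter> k) \<le> d" using card_mono[of i "i \<inter> k"] D_sub(2,3)[OF i] by simp
      then have "\<phi> (card (i \<inter> k)) \<le> 2 * L ^ card (i \<inter> k)" by (rule \<phi>b)
      moreover have "1 \<le> L ^ card (i \<inter> k)" using L by (rule one_le_power)
      \<comment> \<open>Crudely \<open>2 + 4 + 1 = 7\<close>: the moment is at most
        \<open>2 L ^ r\<close>, \<open>2 \<psi>\<close> is at most 4, and \<open>L ^ r\<close> is at
        least 1.\<close>
      ultimately have "\<bar>cov i k\<bar> \<le> 7 * L ^ card (i \<inter> k)"
        using \<psi>_bounds \<phi>_nonneg[of "card (i \<inter> k)"] by linarith
      then show ?thesis using False by (simp add: ki)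
    qed (simp add: Int_commute)
  qed
  also have "\<dots> = real (card D) * \<delta> + 7 * (\<Sum>k | k \<in> D \<and> k \<inter> i \<noteq> {}. L ^ card (k \<inter> i))"
    by (simp add: sum.distrib sum.If_cases Int_def sum_distrib_left)
  also have "\<dots> \<le> real (card D) * \<delta> + 7 * (real (card D) * \<kappa>)"
  proof (intro add_left_mono mult_left_mono sum_meeting)
    show "i \<subseteq> {1..n}" "card i \<le> 2 * d" using D_sub(1,2)[OF i] by simp_all
  qed simp
  finally show ?thesis by (simp add: algebra_simps)
qed

lemma diagonal_second_moment:
  assumes b: "\<And>i. i \<in> D \<Longrightarrow> \<bar>b i\<bar> \<le> B"
  shows "integrable N (\<lambda>\<omega>. (\<Sum>i\<in>D. b i * cprin i \<omega>)\<^sup>2)"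
    "(\<integral>\<omega>. (\<Sum>i\<in>D. b i * cprin i \<omega>)\<^sup>2 \<partial>N) \<le> B\<^sup>2 * ((real (card D))\<^sup>2 * (\<delta> + 7 * \<kappa>))"
proof -
  have sq: "(\<Sum>i\<in>D. b i * cprin i \<omega>)\<^sup>2
      = (\<Sum>i\<in>D. \<Sum>k\<in>D. b i * b k * (cprin i \<omega> * cprin k \<omega>))" for \<omega>
    unfolding power2_eq_square[of "sum _ _"] sum_product by (simp add: ac_simps)
  have int: "integrable N (\<lambda>\<omega>. b i * b k * (cprin i \<omega> * cprin k \<omega>))"
    if "i \<in> D" "k \<in> D" for i k
    using that by (intro integrable_mult_right diagonal_covariance(1))
  show "integrable N (\<lambda>\<omega>. (\<Sum>i\<in>D. b i * cprin i \<omega>)\<^sup>2)"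
    unfolding sq by (intro Bochner_Integration.integrable_sum int)
  have "(\<integral>\<omega>. (\<Sum>i\<in>D. b i * cprin i \<omega>)\<^sup>2 \<partial>N)
      = (\<Sum>i\<in>D. \<integral>\<omega>. (\<Sum>k\<in>D. b i * b k * (cprin i \<omega> * cprin k \<omega>)) \<partial>N)"
    unfolding sq by (intro Bochner_Integration.integral_sum Bochner_Integration.integrable_sum int)
  also have "\<dots> = (\<Sum>i\<in>D. \<Sum>k\<in>D. \<integral>\<omega>. b i * b k * (cprin i \<omega> * cprin k \<omega>) \<partial>N)"
    by (intro sum.cong refl Bochner_Integration.integral_sum int)
  also have "\<dots> = (\<Sum>i\<in>D. \<Sum>k\<in>D. b i * b k * cov i k)"
    by (intro sum.cong refl) (simp only: integral_mult_right_zero diagonal_covariance(2))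
  also have "\<dots> \<le> (\<Sum>i\<in>D. \<Sum>k\<in>D. B * B * \<bar>cov i k\<bar>)"
  proof (intro sum_mono)
    fix i k assume ik: "i \<in> D" "k \<in> D"
    have "b i * b k * cov i k \<le> \<bar>b i * b k * cov i k\<bar>"
      by (rule abs_ge_self)
    also have "\<dots> = \<bar>b i\<bar> * \<bar>b k\<bar> * \<bar>cov i k\<bar>" by (simp only: abs_mult)
    also have "\<dots> \<le> B * B * \<bar>cov i k\<bar>"
      using b[OF ik(1)] b[OF ik(2)] by (intro mult_right_mono mult_mono) auto
    finally show "b i * b k * cov i k \<le> B * B * \<bar>cov i k\<bar>" .
  qed
  also have "\<dots> = B * B * (\<Sum>i\<in>D. \<Sum>k\<in>D. \<bar>cov i k\<bar>)"
    by (simp only: sum_distrib_left)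
  also have "\<dots> \<le> B * B * (\<Sum>i\<in>D. real (card D) * (\<delta> + 7 * \<kappa>))"
    by (intro mult_left_mono sum_mono diagonal_row) auto
  also have "\<dots> = B\<^sup>2 * ((real (card D))\<^sup>2 * (\<delta> + 7 * \<kappa>))"
    by (simp only: sum_constant power2_eq_square mult.assoc)
  finally show "(\<integral>\<omega>. (\<Sum>i\<in>D. b i * cprin i \<omega>)\<^sup>2 \<partial>N) \<le> B\<^sup>2 * ((real (card D))\<^sup>2 * (\<delta> + 7 * \<kappa>))" .
qed

section \<open>The deviation of the whole quadratic form from the trace\<close>

lemma quad_split:
  "quad D A (\<lambda>i. prin i \<omega>) - tr D A
    = (\<Sum>i\<in>D. A i i * cprin i \<omega>) + (\<Sum>z\<in>offd. A (fst z) (snd z) * prod2 z \<omega>)"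
proof -
  have off: "offd = Sigma D (\<lambda>i. D - {i})"
  proof (rule Set.set_eqI)
    fix z show "z \<in> offd \<longleftrightarrow> z \<in> Sigma D (\<lambda>i. D - {i})"
      unfolding offd_def by (cases z) (simp only: fst_conv snd_conv mem_Collect_eq mem_Sigma_iff Diff_iff singleton_iff, blast)
  qed
  have "(\<Sum>j\<in>D. A i j * prin i \<omega> * prin j \<omega>) = A i i * (prin i \<omega>)\<^sup>2 + (\<Sum>j\<in>D - {i}. A i j * (prin i \<omega> * prin j \<omega>))"
    if "i \<in> D" for i
    using that by (subst sum.remove[of D i]) (simp_all add: power2_eq_square mult.assoc)
  then have "quad D A (\<lambda>i. prin i \<omega>)
      = (\<Sum>i\<in>D. A i i * (prin i \<omega>)\<^sup>2) + (\<Sum>i\<in>D. \<Sum>j\<in>D - {i}. A i j * (prin i \<omega> * prin j \<omega>))"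
    unfolding quad_def by (simp add: sum.distrib)
  also have "(\<Sum>i\<in>D. \<Sum>j\<in>D - {i}. A i j * (prin i \<omega> * prin j \<omega>)) = (\<Sum>z\<in>offd. A (fst z) (snd z) * prod2 z \<omega>)"
    unfolding off prod2_def by (subst sum.Sigma) (simp_all add: case_prod_beta)
  finally show ?thesis by (simp add: tr_def sum_subtractf right_diff_distrib)
qed

text \<open>From \<open>(f + g)^2 <= 2 f^2 + 2 g^2\<close> the second moment is at most
  \<open>(p / t)^2\<close> times \<open>2 (\<delta> + 7 \<kappa>) + 4 \<kappa> = 2 \<delta> + 18
  \<kappa>\<close>. Nonnegativity of the variance passes from the second moment to the
  first.\<close>

lemma quad_mean_deviation:
  assumes t: "0 < t" and diag: "\<And>a. a \<in> D \<Longrightarrow> \<bar>A a a\<bar> \<le> 1 / t"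
    and frob: "(\<Sum>a\<in>D. \<Sum>b\<in>D. (A a b)\<^sup>2) \<le> real (card D) / t\<^sup>2"
  shows "(\<integral>\<^sup>+\<omega>. ennreal \<bar>quad D A (\<lambda>i. prin i \<omega>) - tr D A\<bar> \<partial>N)
    \<le> ennreal (real (card D) * (sqrt (2 * \<delta> + 18 * \<kappa>) / t))"
proof -
  interpret N: prob_space N by (rule N)
  let ?p = "real (card D)"
  define f where "f \<omega> = (\<Sum>i\<in>D. A i i * cprin i \<omega>)" for \<omega>
  define g where "g \<omega> = (\<Sum>z\<in>offd. A (fst z) (snd z) * prod2 z \<omega>)" for \<omega>
  define q where "q \<omega> = \<bar>f \<omega> + g \<omega>\<bar>" for \<omega>
  have f: "integrable N (\<lambda>\<omega>. (f \<omega>)\<^sup>2)" "(\<integral>\<omega>. (f \<omega>)\<^sup>2 \<partial>N) \<le> (1 / t)\<^sup>2 * (?p\<^sup>2 * (\<delta> + 7 * \<kappa>))"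
    unfolding f_def using diagonal_second_moment[of "\<lambda>i. A i i" "1 / t", OF diag] by blast+
  have \<kappa>: "0 \<le> \<kappa>" using one_le_power[OF base_ge1, of "2 * d"] by linarith
  have g: "integrable N (\<lambda>\<omega>. (g \<omega>)\<^sup>2)" "(\<integral>\<omega>. (g \<omega>)\<^sup>2 \<partial>N) \<le> 2 * (?p * \<kappa>) * (?p / t\<^sup>2)"
  proof -
    show "integrable N (\<lambda>\<omega>. (g \<omega>)\<^sup>2)" unfolding g_def by (rule offdiagonal_second_moment(1))
    have "(\<Sum>z\<in>offd. (A (fst z) (snd z))\<^sup>2) \<le> (\<Sum>z\<in>D \<times> D. (A (fst z) (snd z))\<^sup>2)"
      using offdD(4) by (intro sum_mono2) auto
    also have "\<dots> = (\<Sum>a\<in>D. \<Sum>b\<in>D. (A a b)\<^sup>2)"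
      by (simp add: sum.cartesian_product case_prod_beta)
    finally have "(\<Sum>z\<in>offd. (A (fst z) (snd z))\<^sup>2) \<le> ?p / t\<^sup>2" using frob by linarith
    then have "2 * (?p * \<kappa>) * (\<Sum>z\<in>offd. (A (fst z) (snd z))\<^sup>2) \<le> 2 * (?p * \<kappa>) * (?p / t\<^sup>2)"
      using \<kappa> by (intro mult_left_mono mult_nonneg_nonneg) auto
    then show "(\<integral>\<omega>. (g \<omega>)\<^sup>2 \<partial>N) \<le> 2 * (?p * \<kappa>) * (?p / t\<^sup>2)"
      unfolding g_def using offdiagonal_second_moment(2)[of "\<lambda>z. A (fst z) (snd z)"] by linarith
  qed
  have qm: "q \<in> borel_measurable N"
  proof -
    have "f \<in> borel_measurable N" unfolding f_def[abs_def]
      by (intro borel_measurable_sum borel_measurable_times borel_measurable_const borel_measurable_diff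
          borel_measurable_power prin_measurable)
    moreover have "g \<in> borel_measurable N" unfolding g_def[abs_def] prod2_def
      by (intro borel_measurable_sum borel_measurable_times borel_measurable_const prin_measurable offdD)
    ultimately show ?thesis unfolding q_def[abs_def] by measurable
  qed
  have q2: "(q \<omega>)\<^sup>2 \<le> 2 * (f \<omega>)\<^sup>2 + 2 * (g \<omega>)\<^sup>2" for \<omega>
    using sum_squares_bound[of "f \<omega>" "g \<omega>"] by (simp add: q_def power2_sum)
  have rhs: "integrable N (\<lambda>\<omega>. 2 * (f \<omega>)\<^sup>2 + 2 * (g \<omega>)\<^sup>2)"
    by (intro Bochner_Integration.integrable_add integrable_mult_right f(1) g(1))
  have q2i: "integrable N (\<lambda>\<omega>. (q \<omega>)\<^sup>2)"
    by (rule Bochner_Integration.integrable_bound[OF rhs])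
       (use qm q2 in \<open>auto intro!: borel_measurable_power AE_I2\<close>)
  have qi: "integrable N q" by (rule N.square_integrable_imp_integrable[OF qm q2i])
  have "(\<integral>\<omega>. (q \<omega>)\<^sup>2 \<partial>N) \<le> (\<integral>\<omega>. 2 * (f \<omega>)\<^sup>2 + 2 * (g \<omega>)\<^sup>2 \<partial>N)"
    by (rule integral_mono[OF q2i rhs q2])
  also have "\<dots> = 2 * (\<integral>\<omega>. (f \<omega>)\<^sup>2 \<partial>N) + 2 * (\<integral>\<omega>. (g \<omega>)\<^sup>2 \<partial>N)"
    using f(1) g(1) by simp
  also have "\<dots> \<le> 2 * ((1 / t)\<^sup>2 * (?p\<^sup>2 * (\<delta> + 7 * \<kappa>))) + 2 * (2 * (?p * \<kappa>) * (?p / t\<^sup>2))"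
    using f(2) g(2) by linarith
  also have "\<dots> = (?p / t)\<^sup>2 * (2 * \<delta> + 18 * \<kappa>)"
    by (simp add: power_divide power2_eq_square add_divide_distrib algebra_simps)
  finally have m2: "(\<integral>\<omega>. (q \<omega>)\<^sup>2 \<partial>N) \<le> (?p / t)\<^sup>2 * (2 * \<delta> + 18 * \<kappa>)" .
  have "(\<integral>\<omega>. q \<omega> \<partial>N)\<^sup>2 \<le> (\<integral>\<omega>. (q \<omega>)\<^sup>2 \<partial>N)"
    using N.variance_positive[of q] N.variance_eq[OF qi q2i] by linarith
  also note m2
  also have "(?p / t)\<^sup>2 * (2 * \<delta> + 18 * \<kappa>) = (?p * (sqrt (2 * \<delta> + 18 * \<kappa>) / t))\<^sup>2"
    using \<kappa> by (simp add: power_mult_distrib power_divide)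
  finally have "(\<integral>\<omega>. q \<omega> \<partial>N) \<le> ?p * (sqrt (2 * \<delta> + 18 * \<kappa>) / t)"
    by (rule power2_le_imp_le) (use t \<kappa> in simp)
  moreover have "(\<integral>\<^sup>+\<omega>. ennreal \<bar>quad D A (\<lambda>i. prin i \<omega>) - tr D A\<bar> \<partial>N) = ennreal (\<integral>\<omega>. q \<omega> \<partial>N)"
    unfolding quad_split f_def[symmetric] g_def[symmetric] q_def[symmetric]
    by (rule nn_integral_eq_integral[OF qi]) (simp add: q_def)
  ultimately show ?thesis by (simp add: ennreal_leI)
qed

lemma PrincipalT_quad_deviation:
  assumes t: "0 < t" and diag: "\<And>a. a \<in> D \<Longrightarrow> \<bar>A a a\<bar> \<le> 1 / t"
    and frob: "(\<Sum>a\<in>D. \<Sum>b\<in>D. (A a b)\<^sup>2) \<le> real (card D) / t\<^sup>2"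
  shows "(\<integral>\<^sup>+v. ennreal \<bar>quad D A v - tr D A\<bar> \<partial>PrincipalT n d N X)
    \<le> ennreal (real (card D) * (sqrt (2 * \<delta> + 18 * \<kappa>) / t))"
proof -
  have m1: "(\<lambda>\<omega>. \<lambda>i\<in>D. prin i \<omega>) \<in> N \<rightarrow>\<^sub>M vecspace D"
    using prin_measurable by (intro measurable_restrict) auto
  have m2: "(\<lambda>v. ennreal \<bar>quad D A v - tr D A\<bar>) \<in> borel_measurable (vecspace D)"
    unfolding quad_def by measurable
  have "PrincipalT n d N X = distr N (vecspace D) (\<lambda>\<omega>. \<lambda>i\<in>D. prin i \<omega>)"
    unfolding PrincipalT_def prin_def ..
  then have "(\<integral>\<^sup>+v. ennreal \<bar>quad D A v - tr D A\<bar> \<partial>PrincipalT n d N X)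
      = (\<integral>\<^sup>+\<omega>. ennreal \<bar>quad D A (\<lambda>i\<in>D. prin i \<omega>) - tr D A\<bar> \<partial>N)"
    by (simp only:) (rule nn_integral_distr[OF m1], simp add: m2)
  also have "\<dots> = (\<integral>\<^sup>+\<omega>. ennreal \<bar>quad D A (\<lambda>i. prin i \<omega>) - tr D A\<bar> \<partial>N)"
    by (simp add: quad_def cong: sum.cong)
  also have "\<dots> \<le> ennreal (real (card D) * (sqrt (2 * \<delta> + 18 * \<kappa>) / t))"
    by (rule quad_mean_deviation[OF assms])
  finally show ?thesis .
qed

end

section \<open>Convergence of the spectral distributions\<close>

lemma mp_stieltjes_equation:
  assumes c: "0 < c" and t: "0 < t"
  defines "s \<equiv> mp_stieltjes c t"
  shows "0 \<le> s" "1 - t * s - s / (1 + c * s) = 0"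
proof -
  define S where "S = sqrt ((1 - c + t)\<^sup>2 + 4 * c * t)"
  have S2: "S\<^sup>2 = (1 - c + t)\<^sup>2 + 4 * c * t" using c t by (simp add: S_def)
  have s: "s = (S - (1 - c + t)) / (2 * c * t)" by (simp add: s_def mp_stieltjes_def S_def)
  have "1 - c + t \<le> S" unfolding S_def by (rule real_le_rsqrt) (use c t in simp)
  then show s0: "0 \<le> s" using c t by (simp add: s)
  have "2 * c * t * s = S - (1 - c + t)" using c t by (simp add: s)
  then have "(2 * c * t * s + (1 - c + t))\<^sup>2 = (1 - c + t)\<^sup>2 + 4 * c * t" using S2 by simp
  then have "4 * c * t * (c * t * s\<^sup>2 + (1 - c + t) * s - 1) = 0"
    by (simp add: power2_eq_square algebra_simps)
  then have "c * t * s\<^sup>2 + (1 - c + t) * s - 1 = 0" using c t by simp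
  then have q: "(1 - t * s) * (1 + c * s) = s" by (simp add: power2_eq_square algebra_simps)
  have "0 < 1 + c * s" using c s0 by (simp add: add_pos_nonneg)
  then have "s / (1 + c * s) = 1 - t * s" using q by (subst nonzero_divide_eq_eq) simp_all
  then show "1 - t * s - s / (1 + c * s) = 0" by simp
qed

text \<open>The map sending \<open>u\<close> to \<open>t u + u / (1 + c u)\<close> increases on the
  half line with slope at least \<open>t\<close>, so the distance to the solution is at most the
  residual divided by \<open>t\<close>. Replacing \<open>y n\<close> by \<open>c\<close> costs at
  most \<open>|y n - c| / t^2\<close>.\<close>

lemma stieltjes_equation_stable:
  fixes \<sigma> y :: "nat \<Rightarrow> real"
  assumes c: "0 < c" and t: "0 < t" and y: "y \<longlonglongrightarrow> c" and y0: "\<And>n. 0 \<le> y n"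
    and \<sigma>: "\<forall>\<^sub>F n in sequentially. 0 \<le> \<sigma> n \<and> \<sigma> n \<le> 1 / t"
    and eq: "(\<lambda>n. 1 - t * \<sigma> n - \<sigma> n / (1 + y n * \<sigma> n)) \<longlonglongrightarrow> 0"
  shows "\<sigma> \<longlonglongrightarrow> mp_stieltjes c t"
proof -
  define s where "s = mp_stieltjes c t"
  have s: "0 \<le> s" "1 - t * s - s / (1 + c * s) = 0"
    unfolding s_def using mp_stieltjes_equation[OF c t] by auto
  have "(\<lambda>n. (\<bar>1 - t * \<sigma> n - \<sigma> n / (1 + y n * \<sigma> n)\<bar> + \<bar>y n - c\<bar> * (1 / t)\<^sup>2) / t) \<longlonglongrightarrow> (\<bar>0\<bar> + \<bar>c - c\<bar> * (1 / t)\<^sup>2) / t"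
    by (intro tendsto_intros eq y) (use t in auto)
  then have lim: "(\<lambda>n. (\<bar>1 - t * \<sigma> n - \<sigma> n / (1 + y n * \<sigma> n)\<bar> + \<bar>y n - c\<bar> * (1 / t)\<^sup>2) / t) \<longlonglongrightarrow> 0" by simp
  have "\<forall>\<^sub>F n in sequentially. norm (\<sigma> n - s) \<le> (\<bar>1 - t * \<sigma> n - \<sigma> n / (1 + y n * \<sigma> n)\<bar> + \<bar>y n - c\<bar> * (1 / t)\<^sup>2) / t"
    using \<sigma>
  proof eventually_elim
    case (elim n)
    define u where "u = \<sigma> n"
    have u: "0 \<le> u" "u \<le> 1 / t" using elim by (auto simp: u_def)
    have mono: "t * \<bar>u - s\<bar> \<le> \<bar>t * (u - s) + (u / (1 + c * u) - s / (1 + c * s))\<bar>"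
    proof -
      have "u / (1 + c * u) - s / (1 + c * s) = (u - s) / ((1 + c * u) * (1 + c * s))"
        using u s(1) c by (simp add: diff_frac_eq add_nonneg_eq_0_iff algebra_simps)
      then have "t * (u - s) + (u / (1 + c * u) - s / (1 + c * s)) = (t + 1 / ((1 + c * u) * (1 + c * s))) * (u - s)"
        by (simp add: distrib_right)
      moreover have "0 \<le> 1 / ((1 + c * u) * (1 + c * s))" using u s(1) c by simp
      ultimately show ?thesis using t by (simp add: abs_mult mult_right_mono)
    qed
    have close: "\<bar>u / (1 + y n * u) - u / (1 + c * u)\<bar> \<le> \<bar>y n - c\<bar> * (1 / t)\<^sup>2"
    proof -
      have p1: "1 \<le> 1 + y n * u" "1 \<le> 1 + c * u" using u y0[of n] c by auto
      then have "u / (1 + y n * u) - u / (1 + c * u) = u\<^sup>2 * (c - y n) / ((1 + y n * u) * (1 + c * u))"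
        by (simp add: diff_frac_eq power2_eq_square algebra_simps)
      also have "\<bar>\<dots>\<bar> = u\<^sup>2 * \<bar>y n - c\<bar> / ((1 + y n * u) * (1 + c * u))"
        using p1 by (simp add: abs_mult abs_minus_commute)
      also have "\<dots> \<le> u\<^sup>2 * \<bar>y n - c\<bar> / 1"
      proof (rule divide_left_mono)
        show "1 \<le> (1 + y n * u) * (1 + c * u)" using mult_mono[OF p1] p1 by simp
      qed (use p1 in auto)
      also have "\<dots> \<le> (1 / t)\<^sup>2 * \<bar>y n - c\<bar>"
        using u by (simp add: mult_right_mono power_mono del: power_one_over)
      finally show ?thesis by (simp add: mult.commute)
    qed
    have "t * \<bar>u - s\<bar> \<le> \<bar>1 - t * u - u / (1 + y n * u)\<bar> + \<bar>y n - c\<bar> * (1 / t)\<^sup>2"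
      using mono close s(2) by (simp add: algebra_simps)
    then show ?case using t by (simp add: u_def field_simps)
  qed
  then have "(\<lambda>n. \<sigma> n - s) \<longlonglongrightarrow> 0"
    by (rule Lim_null_comparison[OF _ lim])
  then show ?thesis unfolding s_def by (rule LIM_zero_cancel)
qed

text \<open>The first Borel--Cantelli lemma at each threshold \<open>1 / (j + 1)\<close>, followed
  by the intersection of countably many almost sure events.\<close>

lemma AE_tendsto_of_summable_tails:
  fixes F :: "nat \<Rightarrow> 'a \<Rightarrow> real"
  assumes M: "prob_space M" and F: "\<And>n. F n \<in> borel_measurable M"
    and tail: "\<And>e. 0 < e \<Longrightarrow> \<exists>q. 0 \<le> q \<and> q < 1 \<and>
      (\<forall>\<^sub>F n in sequentially. measure M {\<omega>\<in>space M. e \<le> \<bar>F n \<omega>\<bar>} \<le> 2 * q ^ n)"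
  shows "AE \<omega> in M. (\<lambda>n. F n \<omega>) \<longlonglongrightarrow> 0"
proof -
  interpret M: prob_space M by (rule M)
  note F[measurable]
  have "AE \<omega> in M. \<forall>\<^sub>F n in sequentially. \<bar>F n \<omega>\<bar> < e" if e: "0 < e" for e
  proof -
    obtain q where q: "0 \<le> q" "q < 1"
      and ev: "\<forall>\<^sub>F n in sequentially. measure M {\<omega>\<in>space M. e \<le> \<bar>F n \<omega>\<bar>} \<le> 2 * q ^ n"
      using tail[OF e] by blast
    have "summable (\<lambda>n. 2 * q ^ n)"
      using q by (intro summable_mult summable_geometric) auto
    then have "summable (\<lambda>n. measure M {\<omega>\<in>space M. e \<le> \<bar>F n \<omega>\<bar>})"
      by (rule summable_comparison_test_ev[rotated]) (use ev in simp)
    then have "AE \<omega> in M. \<forall>\<^sub>F n in sequentially. \<omega> \<in> space M - {\<omega>\<in>space M. e \<le> \<bar>F n \<omega>\<bar>}"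
      by (intro borel_cantelli_AE1) (auto simp: M.emeasure_eq_measure)
    then show ?thesis
      by eventually_elim (auto elim!: eventually_mono)
  qed
  then have "AE \<omega> in M. \<forall>j. \<forall>\<^sub>F n in sequentially. \<bar>F n \<omega>\<bar> < 1 / real (Suc j)"
    unfolding AE_all_countable by simp
  then show ?thesis
  proof eventually_elim
    case (elim \<omega>)
    show ?case
    proof (rule tendstoI)
      fix e :: real assume "0 < e"
      then obtain j where j: "1 / real (Suc j) < e" using nat_approx_posE by blast
      show "\<forall>\<^sub>F n in sequentially. dist (F n \<omega>) 0 < e"
        using elim[rule_format, of j] by eventually_elim (use j in simp)
    qed
  qed
qed

lemma iid_distr_PiM:
  assumes M: "prob_space M" and J: "J \<noteq> {}"
    and indep: "prob_space.indep_vars M (\<lambda>_. S) x J"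
    and law: "\<And>k. k \<in> J \<Longrightarrow> distr M S (x k) = P"
  shows "(\<lambda>\<omega>. \<lambda>k\<in>J. x k \<omega>) \<in> M \<rightarrow>\<^sub>M PiM J (\<lambda>_. S)"
    "distr M (PiM J (\<lambda>_. S)) (\<lambda>\<omega>. \<lambda>k\<in>J. x k \<omega>) = PiM J (\<lambda>_. P)"
proof -
  interpret M: prob_space M by (rule M)
  have rv: "x k \<in> M \<rightarrow>\<^sub>M S" if "k \<in> J" for k
    using indep that unfolding M.indep_vars_def2 by blast
  show "(\<lambda>\<omega>. \<lambda>k\<in>J. x k \<omega>) \<in> M \<rightarrow>\<^sub>M PiM J (\<lambda>_. S)"
    by (intro measurable_restrict rv)
  have "distr M (PiM J (\<lambda>_. S)) (\<lambda>\<omega>. \<lambda>k\<in>J. x k \<omega>) = PiM J (\<lambda>k. distr M S (x k))"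
    using M.indep_vars_iff_distr_eq_PiM'[where I = J and X = x and M' = "\<lambda>_. S", OF J rv] indep by blast
  also have "\<dots> = PiM J (\<lambda>_. P)" by (intro PiM_cong refl law)
  finally show "distr M (PiM J (\<lambda>_. S)) (\<lambda>\<omega>. \<lambda>k\<in>J. x k \<omega>) = PiM J (\<lambda>_. P)" .
qed

lemma sample_trace_restrict: "sample_trace I t m (\<lambda>k\<in>{1..m}. x k) = sample_trace I t m x"
proof -
  have "map (\<lambda>k\<in>{1..m}. x k) [1..<Suc m] = map x [1..<Suc m]"
    by (intro map_cong refl) (auto simp del: upt_Suc)
  then show ?thesis unfolding sample_trace_def by (simp only:)
qed

text \<open>Only the joint law of the samples for one \<open>n\<close> enters, and by independence
  it is the product law on which the concentration bound was proved.\<close>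

lemma sample_trace_of_samples:
  assumes M: "prob_space M" and m: "1 \<le> m" and I: "finite I" "I \<noteq> {}" and t: "0 < t"
    and indep: "prob_space.indep_vars M (\<lambda>_. vecspace I) x {1..m}"
    and law: "\<And>k. k \<in> {1..m} \<Longrightarrow> distr M (vecspace I) (x k) = P"
    and P: "prob_space P" and setsP: "sets P = sets (vecspace I)"
  shows "(\<lambda>\<omega>. sample_trace I t m (\<lambda>k. x k \<omega>)) \<in> borel_measurable M"
    "0 < e \<Longrightarrow> measure M {\<omega>\<in>space M. e \<le> \<bar>sample_trace I t m (\<lambda>k. x k \<omega>) - (\<integral>x. sample_trace I t m x \<partial>PiM {1..m} (\<lambda>_. P))\<bar>}
      \<le> 2 * exp (- 2 * e\<^sup>2 * t\<^sup>2 * (real (card I))\<^sup>2 / real m)"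
proof -
  define J where "J = {1..m}"
  let ?Q = "PiM J (\<lambda>_. P)"
  define Y where "Y \<omega> = (\<lambda>k\<in>J. x k \<omega>)" for \<omega>
  have J: "J \<noteq> {}" using m by (auto simp: J_def)
  have Y0: "Y \<in> M \<rightarrow>\<^sub>M PiM J (\<lambda>_. vecspace I)" and d0: "distr M (PiM J (\<lambda>_. vecspace I)) Y = ?Q"
    using iid_distr_PiM[OF M J indep[folded J_def] law[folded J_def]] unfolding Y_def[abs_def] by auto
  have seq: "sets (PiM J (\<lambda>_. vecspace I)) = sets ?Q"
    by (intro sets_PiM_cong refl) (simp add: setsP)
  have Y [measurable]: "Y \<in> M \<rightarrow>\<^sub>M ?Q" using Y0 unfolding measurable_cong_sets[OF refl seq] .
  have dY: "distr M ?Q Y = ?Q"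
    using d0 by (metis distr_cong seq)
  have F [measurable]: "sample_trace I t m \<in> borel_measurable ?Q"
    by (rule sample_trace_measurable[OF I t m J_def P setsP])
  have FY: "sample_trace I t m (\<lambda>k. x k \<omega>) = sample_trace I t m (Y \<omega>)" for \<omega>
    unfolding Y_def J_def by (rule sample_trace_restrict[symmetric])
  show "(\<lambda>\<omega>. sample_trace I t m (\<lambda>k. x k \<omega>)) \<in> borel_measurable M"
    unfolding FY by measurable
  assume e: "0 < e"
  let ?s = "\<integral>x. sample_trace I t m x \<partial>?Q"
  have A: "{z\<in>space ?Q. e \<le> \<bar>sample_trace I t m z - ?s\<bar>} \<in> sets ?Q" by measurable
  have "{\<omega>\<in>space M. e \<le> \<bar>sample_trace I t m (Y \<omega>) - ?s\<bar>}
      = Y -` {z\<in>space ?Q. e \<le> \<bar>sample_trace I t m z - ?s\<bar>} \<inter> space M"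
    using measurable_space[OF Y] by auto
  then have "measure M {\<omega>\<in>space M. e \<le> \<bar>sample_trace I t m (Y \<omega>) - ?s\<bar>}
      = measure (distr M ?Q Y) {z\<in>space ?Q. e \<le> \<bar>sample_trace I t m z - ?s\<bar>}"
    using measure_distr[OF Y A] by simp
  also have "\<dots> \<le> 2 * exp (- 2 * e\<^sup>2 * t\<^sup>2 * (real (card I))\<^sup>2 / real m)"
    unfolding dY by (rule sample_trace_tail[OF I t m J_def P setsP e])
  finally show "measure M {\<omega>\<in>space M. e \<le> \<bar>sample_trace I t m (\<lambda>k. x k \<omega>) - (\<integral>x. sample_trace I t m x \<partial>PiM {1..m} (\<lambda>_. P))\<bar>}
      \<le> 2 * exp (- 2 * e\<^sup>2 * t\<^sup>2 * (real (card I))\<^sup>2 / real m)"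
    unfolding FY J_def .
qed

lemma PrincipalT_prob_space:
  assumes N: "prob_space N" and X: "X \<in> N \<rightarrow>\<^sub>M vecspace {1..n}"
  shows "prob_space (PrincipalT n d N X)" "sets (PrincipalT n d N X) = sets (vecspace (dsubsets n d))"
proof -
  interpret N: prob_space N by (rule N)
  have "(\<lambda>\<omega>. X \<omega> \<alpha>) \<in> borel_measurable N" if "\<alpha> \<in> {1..n}" for \<alpha>
    by (rule measurable_compose[OF X measurable_component_singleton[OF that]])
  then have "(\<lambda>\<omega>. \<lambda>i\<in>dsubsets n d. \<Prod>\<alpha>\<in>i. X \<omega> \<alpha>) \<in> N \<rightarrow>\<^sub>M vecspace (dsubsets n d)"
    by (intro measurable_restrict borel_measurable_prod) (auto simp: dsubsets_def simp del: One_nat_def)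
  then show "prob_space (PrincipalT n d N X)" unfolding PrincipalT_def by (rule N.prob_space_distr)
qed (simp add: PrincipalT_def)

section \<open>Estimates for all large \<open>n\<close>\<close>

context
  fixes N :: "nat \<Rightarrow> 'b measure" and X :: "nat \<Rightarrow> 'b \<Rightarrow> nat \<Rightarrow> real"
    and d p m :: "nat \<Rightarrow> nat" and c :: real and L :: "nat \<Rightarrow> real"
  assumes N: "\<And>n. prob_space (N n)"
    and X: "\<And>n. X n \<in> measurable (N n) (vecspace {1..n})"
    and d_pos: "\<And>n. 1 \<le> d n"
    and p_eq: "\<And>n. p n = n choose d n"
    and c_pos: "0 < c"
    and ratio: "(\<lambda>n. real (p n) / real (m (p n))) \<longlonglongrightarrow> c"
    and L: "(\<lambda>n. L n * (real (d n))\<^sup>2 / real n) \<longlonglongrightarrow> 0"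
    and A: "(\<lambda>n. \<integral>\<omega>. (\<Prod>i=1..d n. (X n \<omega> i)\<^sup>2) \<partial>N n) \<longlonglongrightarrow> 1"
    and B: "(\<lambda>n. (\<integral>\<omega>. (\<Prod>i=1..2 * d n. (X n \<omega> i)\<^sup>2) \<partial>N n)
              - (\<integral>\<omega>. (\<Prod>i=1..d n. (X n \<omega> i)\<^sup>2) \<partial>N n)\<^sup>2) \<longlonglongrightarrow> 0"
    and C: "\<forall>\<^sub>F n in sequentially. \<forall>r\<in>{1..d n}.
      integrable (N n) (\<lambda>\<omega>. (\<Prod>i=1..r. X n \<omega> i ^ 4) * (\<Prod>i=r+1..2 * d n - r. (X n \<omega> i)\<^sup>2)) \<and>
      (\<integral>\<omega>. (\<Prod>i=1..r. X n \<omega> i ^ 4) * (\<Prod>i=r+1..2 * d n - r. (X n \<omega> i)\<^sup>2) \<partial>N n) \<le> L n ^ r"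
begin

abbreviation "psi n \<equiv> \<integral>\<omega>. (\<Prod>i=1..d n. (X n \<omega> i)\<^sup>2) \<partial>N n"
abbreviation "phi0 n \<equiv> \<integral>\<omega>. (\<Prod>i=1..2 * d n. (X n \<omega> i)\<^sup>2) \<partial>N n"
abbreviation "L1 n \<equiv> max 1 (L n)"
abbreviation "mixed n r \<omega> \<equiv> (\<Prod>i=1..r. X n \<omega> i ^ 4) * (\<Prod>i=r+1..2 * d n - r. (X n \<omega> i)\<^sup>2)"
abbreviation "Dn n \<equiv> dsubsets n (d n)"
abbreviation "Pn n \<equiv> PrincipalT n (d n) (N n) (X n)"
abbreviation "tail_n e t n \<equiv> exp (- 2 * e\<^sup>2 * t\<^sup>2 * (real (p n))\<^sup>2 / real (m (p n)))"

text \<open>A quotient with \<open>p n = 0\<close> or \<open>m (p n) = 0\<close> is 0 by convention,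
  so convergence to \<open>c > 0\<close> rules both out for large \<open>n\<close>; and
  \<open>n choose d n\<close> is nonzero only if \<open>d n <= n\<close>.\<close>

lemma ev_size: "\<forall>\<^sub>F n in sequentially. 0 < p n \<and> 0 < m (p n) \<and> c / 2 < real (p n) / real (m (p n)) \<and> d n \<le> n"
proof -
  have "\<forall>\<^sub>F n in sequentially. c / 2 < real (p n) / real (m (p n))"
    by (rule order_tendstoD(1)[OF ratio]) (use c_pos in simp)
  then show ?thesis
  proof eventually_elim
    case (elim n)
    then have "p n \<noteq> 0 \<and> m (p n) \<noteq> 0" using c_pos by (cases "p n = 0"; cases "m (p n) = 0") simp_all
    moreover have "d n \<le> n"
    proof (rule ccontr)
      assume "\<not> d n \<le> n"
      then have "p n = 0" using p_eq by (simp add: binomial_eq_0)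
      then show False using \<open>p n \<noteq> 0 \<and> m (p n) \<noteq> 0\<close> by simp
    qed
    ultimately show ?case using elim by simp
  qed
qed

lemma phi0_conv: "phi0 \<longlonglongrightarrow> 1"
proof -
  have "(\<lambda>n. (phi0 n - (psi n)\<^sup>2) + (psi n)\<^sup>2) \<longlonglongrightarrow> 0 + 1\<^sup>2"
    by (intro tendsto_add B tendsto_power A)
  then show ?thesis by simp
qed

lemma ev_moments: "\<forall>\<^sub>F n in sequentially. 1 / 2 < psi n \<and> psi n < 2 \<and> 1 / 2 < phi0 n \<and> phi0 n < 2"
proof -
  have "\<forall>\<^sub>F n in sequentially. 1 / 2 < psi n" "\<forall>\<^sub>F n in sequentially. psi n < 2"
    "\<forall>\<^sub>F n in sequentially. 1 / 2 < phi0 n" "\<forall>\<^sub>F n in sequentially. phi0 n < 2"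
    by (rule order_tendstoD[OF A] order_tendstoD[OF phi0_conv]; simp)+
  then show ?thesis by eventually_elim simp
qed

text \<open>Condition (C) with \<open>r = d\<close> and the Cauchy--Schwarz inequality keep \<open>L\<close> away from 0, so that
  \<open>L d\<^sup>2 / n \<rightarrow> 0\<close> forces \<open>d\<^sup>2 / n \<rightarrow> 0\<close>.\<close>

lemma ev_L: "\<forall>\<^sub>F n in sequentially. 1 / 4 \<le> L n"
  using C ev_moments ev_size
proof eventually_elim
  case (elim n)
  interpret prob_space "N n" by (rule N)
  let ?f = "\<lambda>\<omega>. \<Prod>i=1..d n. (X n \<omega> i)\<^sup>2"
  have sq: "(\<Prod>i=1..d n. X n \<omega> i ^ 4) = (?f \<omega>)\<^sup>2" for \<omega>
    by (simp add: prod_power_distrib power_mult[symmetric])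
  have "integrable (N n) (\<lambda>\<omega>. (\<Prod>i=1..d n. X n \<omega> i ^ 4) * (\<Prod>i=d n+1..2 * d n - d n. (X n \<omega> i)\<^sup>2)) \<and>
      (\<integral>\<omega>. (\<Prod>i=1..d n. X n \<omega> i ^ 4) * (\<Prod>i=d n+1..2 * d n - d n. (X n \<omega> i)\<^sup>2) \<partial>N n) \<le> L n ^ d n"
    by (rule bspec[OF elim(1)]) (use d_pos[of n] in simp)
  then have i2: "integrable (N n) (\<lambda>\<omega>. (?f \<omega>)\<^sup>2)" and b: "(\<integral>\<omega>. (?f \<omega>)\<^sup>2 \<partial>N n) \<le> L n ^ d n"
    unfolding sq by simp_all
  have i1: "integrable (N n) ?f"
  proof (rule ccontr)
    \<comment> \<open>A nonzero integral cannot be the default value of a function that is not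
      integrable.\<close>
    assume "\<not> integrable (N n) ?f"
    then have "psi n = 0" by (rule not_integrable_integral_eq)
    then show False using elim(2) by simp
  qed
  have "(psi n)\<^sup>2 \<le> (\<integral>\<omega>. (?f \<omega>)\<^sup>2 \<partial>N n)"
    using variance_positive[of ?f] variance_eq[OF i1 i2] by linarith
  moreover have "(1 / 2)\<^sup>2 \<le> (psi n)\<^sup>2" using elim(2) by (intro power_mono) auto
  ultimately have q: "1 / 4 \<le> L n ^ d n" using b by (simp add: power2_eq_square)
  \<comment> \<open>The instance \<open>r = 1\<close> gives the sign of \<open>L\<close>: for even
    \<open>d\<close> the bound on \<open>L ^ d\<close> would also admit negative
    \<open>L\<close>.\<close>
  have "integrable (N n) (\<lambda>\<omega>. (\<Prod>i=1..1. X n \<omega> i ^ 4) * (\<Prod>i=1+1..2 * d n - 1. (X n \<omega> i)\<^sup>2)) \<and>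
      (\<integral>\<omega>. (\<Prod>i=1..1. X n \<omega> i ^ 4) * (\<Prod>i=1+1..2 * d n - 1. (X n \<omega> i)\<^sup>2) \<partial>N n) \<le> L n ^ 1"
    by (rule bspec[OF elim(1)]) (use d_pos[of n] in simp)
  moreover have "0 \<le> (\<integral>\<omega>. (\<Prod>i=1..1. X n \<omega> i ^ 4) * (\<Prod>i=1+1..2 * d n - 1. (X n \<omega> i)\<^sup>2) \<partial>N n)"
    by (intro integral_nonneg_AE AE_I2 mult_nonneg_nonneg prod_nonneg) auto
  ultimately have L0: "0 \<le> L n" by simp
  show "1 / 4 \<le> L n"
  proof (cases "L n \<le> 1")
    case True
    have "L n ^ d n \<le> L n ^ 1" using True L0 d_pos[of n] by (intro power_decreasing) auto
    then show ?thesis using q by simp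
  qed simp
qed

lemma d2_conv: "(\<lambda>n. (real (d n))\<^sup>2 / real n) \<longlonglongrightarrow> 0"
proof (rule Lim_null_comparison)
  show "\<forall>\<^sub>F n in sequentially. norm ((real (d n))\<^sup>2 / real n) \<le> 4 * (L n * (real (d n))\<^sup>2 / real n)"
    using ev_L
  proof eventually_elim
    case (elim n)
    have "1 * ((real (d n))\<^sup>2 / real n) \<le> 4 * L n * ((real (d n))\<^sup>2 / real n)"
      using elim by (intro mult_right_mono) auto
    then show ?case by simp
  qed
  show "(\<lambda>n. 4 * (L n * (real (d n))\<^sup>2 / real n)) \<longlonglongrightarrow> 0"
    using tendsto_mult_right_zero[OF L, of 4] by simp
qed

lemma L1_conv: "(\<lambda>n. L1 n * (real (d n))\<^sup>2 / real n) \<longlonglongrightarrow> 0"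
proof -
  have "L1 n * (real (d n))\<^sup>2 / real n = max ((real (d n))\<^sup>2 / real n) (L n * (real (d n))\<^sup>2 / real n)" for n
  proof -
    have a: "0 \<le> (real (d n))\<^sup>2 / real n" by simp
    show ?thesis
    proof (cases "1 \<le> L n")
      case True
      then show ?thesis using mult_right_mono[OF True a] by (simp add: max_def)
    next
      case False
      then show ?thesis using mult_right_mono[OF _ a, of "L n" 1] by (simp add: max_def)
    qed
  qed
  moreover have "(\<lambda>n. max ((real (d n))\<^sup>2 / real n) (L n * (real (d n))\<^sup>2 / real n)) \<longlonglongrightarrow> max 0 0"
    by (intro tendsto_max d2_conv L)
  ultimately show ?thesis by simp
qed

lemma ev_dn: "\<forall>\<^sub>F n in sequentially. 2 * d n \<le> n"
proof -
  have "\<forall>\<^sub>F n in sequentially. (real (d n))\<^sup>2 / real n < 1 / 2"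
    by (rule order_tendstoD(2)[OF d2_conv]) simp
  then show ?thesis using eventually_gt_at_top[of 0]
  proof eventually_elim
    case (elim n)
    then have "2 * (real (d n))\<^sup>2 < real n" by (simp add: field_simps)
    moreover have "real (d n) * 1 \<le> real (d n) * real (d n)"
      using d_pos[of n] by (intro mult_left_mono) auto
    ultimately have "2 * real (d n) < real n" by (simp add: power2_eq_square)
    then show ?case by linarith
  qed
qed

text \<open>Binomial coefficients increase up to the middle and \<open>1 <= d <= n / 2\<close>. An
  exponent of order \<open>p\<close> in the tail bound is therefore at least of order
  \<open>n\<close>, which gives geometric decay.\<close>

lemma ev_p_ge: "\<forall>\<^sub>F n in sequentially. n \<le> p n"
  using ev_dn
proof eventually_elim
  case (elim n)
  then show ?case using binomial_mono[of 1 "d n" n] d_pos[of n] by (simp add: p_eq)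
qed

text \<open>The factor \<open>2 \<delta> + 18 \<kappa>\<close> of the bound on quadratic forms, with
  \<open>L\<close> replaced by \<open>max 1 L\<close>.\<close>

definition eta2 :: "nat \<Rightarrow> real" where
  "eta2 n = 2 * \<bar>phi0 n - 2 * psi n + 1\<bar> + 18 * ((1 + L1 n * real (d n) / real n) ^ (2 * d n) - 1)"

lemma eta2_nonneg: "0 \<le> eta2 n"
proof -
  have "1 \<le> (1 + L1 n * real (d n) / real n) ^ (2 * d n)" by (rule one_le_power) simp
  then show ?thesis unfolding eta2_def by (intro add_nonneg_nonneg) auto
qed

text \<open>\<open>(1 + y)^(2 d) <= exp (2 d y)\<close> with \<open>y = L d / n\<close> has the
  exponent \<open>2 L d^2 / n\<close>, where \<open>L\<close> is the modified one: this is where the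
  rate in the hypothesis on \<open>L\<close> comes from. The other summand tends to
  \<open>|1 - 2 + 1| = 0\<close>.\<close>

lemma eta2_conv: "eta2 \<longlonglongrightarrow> 0"
proof (rule Lim_null_comparison)
  have "(1 + L1 n * real (d n) / real n) ^ (2 * d n) \<le> exp (2 * (L1 n * (real (d n))\<^sup>2 / real n))" for n
  proof -
    have "(1 + L1 n * real (d n) / real n) ^ (2 * d n) \<le> exp (L1 n * real (d n) / real n) ^ (2 * d n)"
      by (intro power_mono exp_ge_add_one_self) (simp add: add_nonneg_nonneg)
    also have "\<dots> = exp (real (2 * d n) * (L1 n * real (d n) / real n))" by (rule exp_of_nat_mult[symmetric])
    also have "real (2 * d n) * (L1 n * real (d n) / real n) = 2 * (L1 n * (real (d n))\<^sup>2 / real n)"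
      by (simp add: power2_eq_square)
    finally show ?thesis .
  qed
  then show "\<forall>\<^sub>F n in sequentially. norm (eta2 n) \<le> 2 * \<bar>phi0 n - 2 * psi n + 1\<bar> + 18 * (exp (2 * (L1 n * (real (d n))\<^sup>2 / real n)) - 1)"
    using eta2_nonneg by (intro always_eventually allI) (simp add: eta2_def)
  have "(\<lambda>n. 2 * \<bar>phi0 n - 2 * psi n + 1\<bar> + 18 * (exp (2 * (L1 n * (real (d n))\<^sup>2 / real n)) - 1))
      \<longlonglongrightarrow> 2 * \<bar>1 - 2 * 1 + 1\<bar> + 18 * (exp (2 * 0) - 1)"
    by (intro tendsto_intros phi0_conv A L1_conv)
  then show "(\<lambda>n. 2 * \<bar>phi0 n - 2 * psi n + 1\<bar> + 18 * (exp (2 * (L1 n * (real (d n))\<^sup>2 / real n)) - 1)) \<longlonglongrightarrow> 0"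
    by simp
qed

text \<open>Verifies the abstract moment assumptions for large \<open>n\<close>. The factor 2 in
  front of \<open>L1 n ^ r\<close> accommodates \<open>r = 0\<close>, which (C) leaves out and where
  the moment is only known to be below 2.\<close>

lemma ev_quad_deviation:
  assumes exch: "\<And>n. exchangeable n (N n) (X n)" and uncond: "\<And>n. unconditional n (N n) (X n)"
    and t: "0 < t"
  shows "\<forall>\<^sub>F n in sequentially. \<forall>A. (\<forall>a\<in>Dn n. \<bar>A a a\<bar> \<le> 1 / t) \<longrightarrow>
      (\<Sum>a\<in>Dn n. \<Sum>b\<in>Dn n. (A a b)\<^sup>2) \<le> real (card (Dn n)) / t\<^sup>2 \<longrightarrow>
      (\<integral>\<^sup>+v. ennreal \<bar>quad (Dn n) A v - tr (Dn n) A\<bar> \<partial>Pn n)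
        \<le> ennreal (real (card (Dn n)) * (sqrt (eta2 n) / t))"
  using C ev_moments ev_L ev_dn
proof eventually_elim
  case (elim n)
  \<comment> \<open>Integrability of the monomials in (A) and (B) is read off from their integrals
    being positive, since the default value is 0.\<close>
  have int0: "integrable (N n) f" if "0 < integral\<^sup>L (N n) f" for f :: "'b \<Rightarrow> real"
    using that not_integrable_integral_eq[of "N n" f] by (cases "integrable (N n) f") auto
  have hyp: "integrable (N n) (\<lambda>\<omega>. mixed n r \<omega>) \<and>
      (\<integral>\<omega>. mixed n r \<omega> \<partial>N n) \<le> 2 * L1 n ^ r" if r: "r \<le> d n" for r
  proof (cases "r = 0")
    case True
    then show ?thesis using elim(2) int0[of "\<lambda>\<omega>. \<Prod>i=1..2 * d n. (X n \<omega> i)\<^sup>2"] by simp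
  next
    case False
    then have "integrable (N n) (\<lambda>\<omega>. mixed n r \<omega>) \<and>
      (\<integral>\<omega>. mixed n r \<omega> \<partial>N n) \<le> L n ^ r"
      by (intro bspec[OF elim(1)]) (use r in simp)
    moreover have "L n ^ r \<le> L1 n ^ r" using elim(3) by (intro power_mono) auto
    moreover have "0 \<le> L1 n ^ r" by simp
    ultimately show ?thesis by (meson order_trans mult_le_cancel_right1 one_le_numeral linorder_not_le mult_right_le_imp_le mult_nonneg_nonneg)
  qed
  have \<psi>2: "square_moment (N n) (X n) (d n) \<le> 2" using elim(2) by (simp add: square_moment_def)
  have \<psi>i: "integrable (N n) (\<lambda>\<omega>. \<Prod>i=1..d n. (X n \<omega> i)\<^sup>2)"
    using elim(2) by (intro int0) simp
  have L1: "1 \<le> L1 n" by simp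
  have \<phi>b: "fourth_moment (N n) (X n) (d n) r \<le> 2 * L1 n ^ r" if "r \<le> d n" for r
    using hyp[OF that] by (simp only: fourth_moment_def)
  have eta: "2 * \<bar>fourth_moment (N n) (X n) (d n) 0 - 2 * square_moment (N n) (X n) (d n) + 1\<bar>
      + 18 * ((1 + L1 n * real (d n) / real n) ^ (2 * d n) - 1) = eta2 n"
    by (simp add: eta2_def fourth_moment_def square_moment_def)
  note hyps = N X exch uncond d_pos elim(4) L1 conjunct1[OF hyp] \<phi>b \<psi>i \<psi>2
  show ?case
  proof (intro allI impI)
    fix A :: "nat set \<Rightarrow> nat set \<Rightarrow> real"
    assume A: "\<forall>a\<in>Dn n. \<bar>A a a\<bar> \<le> 1 / t"
      "(\<Sum>a\<in>Dn n. \<Sum>b\<in>Dn n. (A a b)\<^sup>2) \<le> real (card (Dn n)) / t\<^sup>2"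
    show "(\<integral>\<^sup>+v. ennreal \<bar>quad (Dn n) A v - tr (Dn n) A\<bar> \<partial>Pn n)
        \<le> ennreal (real (card (Dn n)) * (sqrt (eta2 n) / t))"
      unfolding eta[symmetric]
      by (rule PrincipalT_quad_deviation[OF hyps t bspec[OF A(1)] A(2)])
  qed
qed

lemma card_dsubsets_eq: "card (Dn n) = p n"
  by (simp add: card_dsubsets p_eq)

text \<open>\<open>p^2 / m\<close> is the product of \<open>p >= n\<close> and
  \<open>p / m > c / 2\<close>.\<close>

lemma ev_exp_tail:
  assumes e: "0 < e" and t: "0 < t"
  shows "\<forall>\<^sub>F n in sequentially. tail_n e t n \<le> exp (- (e\<^sup>2 * t\<^sup>2 * c)) ^ n"
  using ev_size ev_p_ge
proof eventually_elim
  case (elim n)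
  have "real n * (c / 2) \<le> real (p n) * (real (p n) / real (m (p n)))"
    using elim c_pos by (intro mult_mono) auto
  then have "e\<^sup>2 * t\<^sup>2 * (real n * (c / 2)) \<le> e\<^sup>2 * t\<^sup>2 * (real (p n) * (real (p n) / real (m (p n))))"
    by (intro mult_left_mono) auto
  then have "- 2 * e\<^sup>2 * t\<^sup>2 * (real (p n))\<^sup>2 / real (m (p n)) \<le> real n * (- (e\<^sup>2 * t\<^sup>2 * c))"
    by (simp add: power2_eq_square ac_simps)
  then show ?case by (simp only: exp_of_nat_mult[symmetric] exp_le_cancel_iff)
qed

lemma exp_rate: "0 < e \<Longrightarrow> 0 < t \<Longrightarrow> 0 \<le> exp (- (e\<^sup>2 * t\<^sup>2 * c)) \<and> exp (- (e\<^sup>2 * t\<^sup>2 * c)) < 1"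
  using c_pos by simp

abbreviation "mean_trace t n \<equiv> \<integral>x. sample_trace (Dn n) t (m (p n)) x
    \<partial>PiM {1..m (p n)} (\<lambda>_. Pn n)"

lemma mean_trace_conv:
  assumes exch: "\<And>n. exchangeable n (N n) (X n)" and uncond: "\<And>n. unconditional n (N n) (X n)"
    and t: "0 < t"
  shows "mean_trace t \<longlonglongrightarrow> mp_stieltjes c t"
proof -
  let ?res = "\<lambda>n. 1 - t * mean_trace t n - mean_trace t n / (1 + real (p n) / real (m (p n)) * mean_trace t n)"
  have main: "\<forall>\<^sub>F n in sequentially. 0 \<le> mean_trace t n \<and> mean_trace t n \<le> 1 / t \<and>
      \<bar>?res n\<bar> \<le> sqrt (eta2 n) / t + 1 / (t * real (p n))
        + (e + 2 / t * tail_n e t n)" if e: "0 < e" for e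
    using ev_quad_deviation[OF exch uncond t] ev_size
  proof eventually_elim
    case (elim n)
    let ?I = "Dn n" and ?P = "Pn n"
    have I: "finite ?I" "?I \<noteq> {}" using elim(2) card_dsubsets_eq[of n] by auto
    have m1: "1 \<le> m (p n)" using elim(2) by simp
    have eta0: "0 \<le> sqrt (eta2 n) / t" using eta2_nonneg t by simp
    have q: "(\<integral>\<^sup>+v. ennreal \<bar>quad ?I A v - tr ?I A\<bar> \<partial>?P) \<le> ennreal (real (card ?I) * (sqrt (eta2 n) / t))"
      if "\<And>a. a \<in> ?I \<Longrightarrow> \<bar>A a a\<bar> \<le> 1 / t" "(\<Sum>a\<in>?I. \<Sum>b\<in>?I. (A a b)\<^sup>2) \<le> real (card ?I) / t\<^sup>2" for A
      using elim(1) that by blast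
    note eq = sample_trace_mean_equation[OF I t m1 refl PrincipalT_prob_space[OF N X] q eta0 e]
    show ?case using eq unfolding card_dsubsets_eq by blast
  qed
  show ?thesis
  proof (rule stieltjes_equation_stable[OF c_pos t ratio])
    show "\<forall>\<^sub>F n in sequentially. 0 \<le> mean_trace t n \<and> mean_trace t n \<le> 1 / t"
      using main[of 1] by (auto elim!: eventually_mono)
    show "?res \<longlonglongrightarrow> 0"
    proof (rule tendstoI)
      fix \<epsilon> :: real assume \<epsilon>: "0 < \<epsilon>"
      \<comment> \<open>Half of the target goes to the fluctuation threshold \<open>e\<close>, which
        stays fixed while \<open>n\<close> grows; all remaining terms of the bound vanish.\<close>
      define e where "e = \<epsilon> / 2"
      have e: "0 < e" using \<epsilon> by (simp add: e_def)
      define q where "q = exp (- (e\<^sup>2 * t\<^sup>2 * c))"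
      have q: "0 \<le> q" "q < 1" using exp_rate[OF e t] by (auto simp: q_def)
      have "(\<lambda>n. sqrt (eta2 n) / t + 1 / t * inverse (real n) + (e + 2 / t * q ^ n))
          \<longlonglongrightarrow> sqrt 0 / t + 1 / t * 0 + (e + 2 / t * 0)"
        using q t by (intro tendsto_intros eta2_conv lim_inverse_n LIMSEQ_power_zero) auto
      then have "\<forall>\<^sub>F n in sequentially. sqrt (eta2 n) / t + 1 / t * inverse (real n) + (e + 2 / t * q ^ n) < \<epsilon>"
        by (rule order_tendstoD(2)) (use \<epsilon> in \<open>simp add: e_def\<close>)
      then show "\<forall>\<^sub>F n in sequentially. dist (?res n) 0 < \<epsilon>"
        using main[OF e] ev_exp_tail[OF e t] ev_p_ge eventually_gt_at_top[of 0]
      proof eventually_elim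
        case (elim n)
        have "1 / (t * real (p n)) \<le> 1 / t * inverse (real n)"
          using elim(4,5) t by (simp add: field_simps)
        moreover have "2 / t * tail_n e t n \<le> 2 / t * q ^ n"
          using elim(3) t unfolding q_def by (intro mult_left_mono) auto
        ultimately have "\<bar>?res n\<bar> < \<epsilon>" using elim(1,2) by linarith
        then show ?case by simp
      qed
    qed
  qed simp
qed

lemma AE_sample_trace_conv:
  fixes M :: "'a measure" and x :: "nat \<Rightarrow> nat \<Rightarrow> 'a \<Rightarrow> nat set \<Rightarrow> real"
  assumes exch: "\<And>n. exchangeable n (N n) (X n)" and uncond: "\<And>n. unconditional n (N n) (X n)"
    and M: "prob_space M"
    and indep: "\<And>n. prob_space.indep_vars M (\<lambda>_. vecspace (Dn n)) (x n) {1..m (p n)}"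
    and law: "\<And>n k. k \<in> {1..m (p n)} \<Longrightarrow>
      distr M (vecspace (Dn n)) (x n k) = Pn n"
    and t: "0 < t"
  shows "AE \<omega> in M. (\<lambda>n. sample_trace (Dn n) t (m (p n)) (\<lambda>k. x n k \<omega>)) \<longlonglongrightarrow> mp_stieltjes c t"
proof -
  let ?T = "\<lambda>n \<omega>. sample_trace (Dn n) t (m (p n)) (\<lambda>k. x n k \<omega>)"
  define good where "good n \<longleftrightarrow> 0 < p n \<and> 0 < m (p n)" for n
  define F where "F n \<omega> = (if good n then ?T n \<omega> - mean_trace t n else 0)" for n \<omega>
  have I: "Dn n \<noteq> {}" "1 \<le> m (p n)" if "good n" for n
    using that card_dsubsets_eq[of n] by (auto simp: good_def)
  note samples = sample_trace_of_samples[OF M _ finite_dsubsets _ t indep law PrincipalT_prob_space[OF N X]]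
  have meas: "F n \<in> borel_measurable M" for n
  proof (cases "good n")
    case True
    have "F n = (\<lambda>\<omega>. ?T n \<omega> - mean_trace t n)" using True by (simp add: F_def fun_eq_iff)
    then show ?thesis using samples(1)[OF I(2,1)[OF True]] by (simp only: borel_measurable_diff borel_measurable_const)
  next
    case False
    then have "F n = (\<lambda>\<omega>. 0)" by (simp add: F_def fun_eq_iff)
    then show ?thesis by simp
  qed
  have "AE \<omega> in M. (\<lambda>n. F n \<omega>) \<longlonglongrightarrow> 0"
  proof (rule AE_tendsto_of_summable_tails[OF M meas])
    fix e :: real assume e: "0 < e"
    have "\<forall>\<^sub>F n in sequentially. measure M {\<omega>\<in>space M. e \<le> \<bar>F n \<omega>\<bar>} \<le> 2 * exp (- (e\<^sup>2 * t\<^sup>2 * c)) ^ n"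
      using ev_exp_tail[OF e t] ev_size
    proof eventually_elim
      case (elim n)
      then have g: "good n" by (simp add: good_def)
      have "measure M {\<omega>\<in>space M. e \<le> \<bar>F n \<omega>\<bar>} \<le> 2 * tail_n e t n"
        using samples(2)[OF I(2,1)[OF g] _ e] g unfolding card_dsubsets_eq F_def by simp
      then show ?case using elim(1) by linarith
    qed
    then show "\<exists>q. 0 \<le> q \<and> q < 1 \<and> (\<forall>\<^sub>F n in sequentially. measure M {\<omega>\<in>space M. e \<le> \<bar>F n \<omega>\<bar>} \<le> 2 * q ^ n)"
      using exp_rate[OF e t] by blast
  qed
  then show ?thesis
  proof eventually_elim
    case (elim \<omega>)
    have "(\<lambda>n. F n \<omega> + mean_trace t n) \<longlonglongrightarrow> 0 + mp_stieltjes c t"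
      by (intro tendsto_add elim mean_trace_conv exch uncond t)
    moreover have "\<forall>\<^sub>F n in sequentially. F n \<omega> + mean_trace t n = ?T n \<omega>"
      using ev_size by eventually_elim (simp add: F_def good_def)
    ultimately show ?case by (simp add: tendsto_cong)
  qed
qed

end

theorem theorem2p1:
  fixes N :: "nat \<Rightarrow> 'b measure"
    and X :: "nat \<Rightarrow> 'b \<Rightarrow> nat \<Rightarrow> real"
    and d p m :: "nat \<Rightarrow> nat"
    and c :: real
    and L :: "nat \<Rightarrow> real"
    and M :: "'a measure"
    and x :: "nat \<Rightarrow> nat \<Rightarrow> 'a \<Rightarrow> nat set \<Rightarrow> real"
  assumes N: "\<And>n. prob_space (N n)"
    and X: "\<And>n. X n \<in> measurable (N n) (vecspace {1..n})"
    and exch: "\<And>n. exchangeable n (N n) (X n)"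
    and uncond: "\<And>n. unconditional n (N n) (X n)"
    and d_pos: "\<And>n. 1 \<le> d n"
    and p_eq: "\<And>n. p n = n choose d n"
    and c_pos: "0 < c"
    and ratio: "(\<lambda>n. real (p n) / real (m (p n))) \<longlonglongrightarrow> c"
    and M: "prob_space M"
    and indep: "\<And>n. prob_space.indep_vars M (\<lambda>_. vecspace (dsubsets n (d n))) (x n) {1..m (p n)}"
    and law: "\<And>n k. k \<in> {1..m (p n)} \<Longrightarrow>
      distr M (vecspace (dsubsets n (d n))) (x n k) = PrincipalT n (d n) (N n) (X n)"
    and L: "(\<lambda>n. L n * (real (d n))\<^sup>2 / real n) \<longlonglongrightarrow> 0"
    and A: "(\<lambda>n. \<integral>\<omega>. (\<Prod>i=1..d n. (X n \<omega> i)\<^sup>2) \<partial>N n) \<longlonglongrightarrow> 1"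
    and B: "(\<lambda>n. (\<integral>\<omega>. (\<Prod>i=1..2 * d n. (X n \<omega> i)\<^sup>2) \<partial>N n)
              - (\<integral>\<omega>. (\<Prod>i=1..d n. (X n \<omega> i)\<^sup>2) \<partial>N n)\<^sup>2) \<longlonglongrightarrow> 0"
    and C: "\<forall>\<^sub>F n in sequentially. \<forall>r\<in>{1..d n}.
      integrable (N n) (\<lambda>\<omega>. (\<Prod>i=1..r. X n \<omega> i ^ 4) * (\<Prod>i=r+1..2 * d n - r. (X n \<omega> i)\<^sup>2)) \<and>
      (\<integral>\<omega>. (\<Prod>i=1..r. X n \<omega> i ^ 4) * (\<Prod>i=r+1..2 * d n - r. (X n \<omega> i)\<^sup>2) \<partial>N n) \<le> L n ^ r"
  shows "AE \<omega> in M. weak_conv_m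
    (\<lambda>n. ESD (sample_cov (p n) (m (p n)) (\<lambda>k. coord_vec n (d n) (x n k \<omega>))))
    (marchenko_pastur c)"
proof -
  let ?T = "\<lambda>t n \<omega>. sample_trace (dsubsets n (d n)) t (m (p n)) (\<lambda>k. x n k \<omega>)"
  let ?K = "\<lambda>n \<omega>. sample_cov (p n) (m (p n)) (\<lambda>k. coord_vec n (d n) (x n k \<omega>))"
  \<comment> \<open>The exceptional null set depends on \<open>t\<close>, so a common one is
    obtained for a countable set of arguments only.\<close>
  have "AE \<omega> in M. \<forall>t\<in>{t\<in>\<rat>. 1 < t}. (\<lambda>n. ?T t n \<omega>) \<longlonglongrightarrow> mp_stieltjes c t"
  proof (rule AE_ball_countable')
    show "AE \<omega> in M. (\<lambda>n. ?T t n \<omega>) \<longlonglongrightarrow> mp_stieltjes c t" if "t \<in> {t\<in>\<rat>. 1 < t}" for t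
      by (rule AE_sample_trace_conv[OF N X d_pos p_eq c_pos ratio L A B C exch uncond M indep law])
        (use that in auto)
    show "countable {t\<in>\<rat>. 1 < (t::real)}"
      by (rule countable_subset[OF _ countable_rat]) auto
  qed
  then show ?thesis
  proof eventually_elim
    case (elim \<omega>)
    define good where "good n \<longleftrightarrow> 0 < p n \<and> 0 < m (p n)" for n
    \<comment> \<open>The criterion for weak convergence asks for probability laws on the half line
      at every \<open>n\<close>, while the spectral law of an empty matrix is not one. A point mass
      at 0 fills in for the degenerate \<open>n\<close>, of which there are finitely many.\<close>
    define \<mu> where "\<mu> n = (if good n then ESD (?K n \<omega>) else return borel 0)" for n
    have ev: "\<forall>\<^sub>F n in sequentially. \<mu> n = ESD (?K n \<omega>)"
      using ev_size[OF N X d_pos p_eq c_pos ratio L A B C] by eventually_elim (simp add: \<mu>_def good_def)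
    have ret: "real_distribution (return borel (0::real))"
      unfolding real_distribution_def real_distribution_axioms_def by (simp add: prob_space_return)
    have \<mu>: "real_distribution (\<mu> n) \<and> (AE x in \<mu> n. 0 \<le> x)" for n
    proof (cases "good n")
      case True
      then have "0 < n choose d n" "0 < m (p n)" by (simp_all add: good_def p_eq)
      from ESD_sample_cov(1,2)[OF this] show ?thesis
        using True unfolding \<mu>_def p_eq[symmetric] by simp
    next
      case False
      then have "\<mu> n = return borel 0" by (simp add: \<mu>_def)
      then show ?thesis using ret by (simp only:) (subst AE_return, auto)
    qed
    have "weak_conv_m \<mu> (marchenko_pastur c)"
    proof (rule weak_conv_of_stieltjes[OF conjunct1[OF \<mu>] _ conjunct2[OF \<mu>] AE_marchenko_pastur_nonneg[OF c_pos]])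
      show "real_distribution (marchenko_pastur c)"
        using prob_space_marchenko_pastur[OF c_pos]
        by (simp add: real_distribution_def real_distribution_axioms_def)
      fix t :: real assume t: "t \<in> \<rat>" "1 < t"
      have "\<forall>\<^sub>F n in sequentially. ?T t n \<omega> = (\<integral>x. 1 / (x + t) \<partial>\<mu> n)"
        using ev_size[OF N X d_pos p_eq c_pos ratio L A B C]
      proof eventually_elim
        case (elim n)
        then show ?case
          using ESD_sample_cov(3)[of n "d n" "m (p n)" t "\<lambda>k. x n k \<omega>"] t
          by (simp add: \<mu>_def good_def p_eq sample_trace_def card_dsubsets del: upt_Suc)
      qed
      moreover have "(\<lambda>n. ?T t n \<omega>) \<longlonglongrightarrow> mp_stieltjes c t" using elim t by blast
      ultimately show "(\<lambda>n. \<integral>x. 1 / (x + t) \<partial>\<mu> n) \<longlonglongrightarrow> (\<integral>x. 1 / (x + t) \<partial>marchenko_pastur c)"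
        using stieltjes_marchenko_pastur[OF c_pos, of t] t by (simp add: Lim_transform_eventually)
    qed
    then have conv: "(\<lambda>n. cdf (\<mu> n) y) \<longlonglongrightarrow> cdf (marchenko_pastur c) y" if "isCont (cdf (marchenko_pastur c)) y" for y
      using that by (simp add: weak_conv_m_def weak_conv_def)
    have same: "\<forall>\<^sub>F n in sequentially. cdf (\<mu> n) y = cdf (ESD (?K n \<omega>)) y" for y
      using ev by eventually_elim simp
    show ?case
      unfolding weak_conv_m_def weak_conv_def
    proof (intro allI impI)
      fix y assume "isCont (cdf (marchenko_pastur c)) y"
      from Lim_transform_eventually[OF conv[OF this] same]
      show "(\<lambda>n. cdf (ESD (?K n \<omega>)) y) \<longlonglongrightarrow> cdf (marchenko_pastur c) y" .
    qed
  qed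
qed

end
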